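(* Consider the multicolored multiple-drawing randomly reinforced urn described in the context. Assume: (A1) there is a constant $C_2$ such that $\sup_n \mathbb{E}(A_{nk}^3)<C_2$ for all $k\in\{1,\dots,d\}$; (A2) for all $k\in\{1,\dots,d\}$, $m_{nk}:=\mathbb{E}(A_{nk})\to m_k$ as $n\to\infty$, where $m_1,\dots,m_d$ are finite reals with $m_1=\dots=m_t>m_{t+1}\ge m_{t+2}\ge\dots\ge m_d$ for some $t\in\{1,\dots,d\}$; moreover $m_{n1}=m_{n2}=\dots=m_{nt}$ for all $n\ge 1$; (A3) for all $k,j\in\{1,\dots,d\}$, $\sum_{n=1}^\infty \frac{|m_{n+1,k}m_j-m_km_{n+1,j}|}{n}<\infty$; (N) $\mathbb E(N_{n+1}\mid\mathcal F_n)\to N$ almost surely, for some random variable $N$; (Q) $\mathbb E(N_{n+1}^2\mid\mathcal F_n)\to Q$ almost surely, for some random variable $Q$. Let $Z_k$ be the almost sure limit of $Z_{nk}$, $k\in\{1,\dots,d\}$. Then, almost surely as $n\to\infty$, $$\hat\mu_n=\frac{\sum_{j=1}^nN_j}{n}\to N,\qquad \hat q_{N,n}=\frac{\sum_{j=1}^nN_j^2}{n}\to Q,\qquad \hat\nu_{nk}=\frac1n\sum_{j=1}^n\frac{X_{jk}}{N_j}\to Z_k\quad(k\in\{1,\dots,d\}),$$ and, for each $k\in\{1,\dots,d\}$, $\hat m_{A_k,n}=\dfrac{\sum_{j=1}^nA_{jk}X_{jk}}{N_{A_k,n}}$ is a strongly consistent estimator of $m_k$, i.e. $\hat m_{A_k,n}\to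 m_k$ almost surely. Assume further that $q_{A_k,n}:=\mathbb E(A_{nk}^2)\to q_k$ and $q_{A_kA_s,n}:=\mathbb E(A_{nk}A_{ns})\to q_{ks}$ as $n\to\infty$, for all $k,s$. Then: - for $k\in\{1,\dots,d\}$, $\hat q_{A_k,n}=\dfrac{\sum_{j=1}^nA_{jk}^2X_{jk}}{N_{A_k,n}}\to q_k$ almost surely; - for $k,s$ such that $m_k+m_s>m_1$, on the event $\{Q>N\}=\{N>1\}$ (equality up to null sets), $\hat q_{A_kA_s,n}=\dfrac{\sum_{j=1}^nA_{jk}A_{js}X_{jk}X_{js}}{\sum_{j=1}^nX_{jk}X_{js}}\to q_{ks}$ almost surely; - for $k,s$ such that $m_k+m_s\le m_1$, $\tilde q_{A_kA_s,n}=\dfrac{\sum_{j=1}^nA_{jk}A_{js}X_{jk}}{N_{A_k,n}}\to q_{ks}$ almost surely.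
   Context: Urn model. An urn contains balls of $d\ge 2$ colors. The initial composition is a deterministic vector $\mathbf H_0=(H_{01},\dots,H_{0d})^\top$ of positive integers. At each stage $n\ge1$, a random number $N_n$ of balls is drawn without replacement; $\mathbf X_n=(X_{n1},\dots,X_{nd})^\top$ records how many balls of each color are drawn, so $\sum_k X_{nk}=N_n$. The drawn balls are then returned together with $A_{nk}X_{nk}$ new balls of color $k$, for each $k$. Here $\mathbf R_n=\mathrm{diag}(A_{n1},\dots,A_{nd})$ is the random replacement matrix. So $H_{nk}=H_{0k}+\sum_{i=1}^n A_{ik}X_{ik}$, $S_n=\sum_{k=1}^d H_{nk}$ and $Z_{nk}=H_{nk}/S_n$; $N_{A_k,n}=\sum_{j=1}^nX_{jk}$ is the number of color-$k$ balls drawn in the first $n$ stages. Let $\mathcal F_0$ be trivial, $\mathcal F_n=\sigma\{N_1,\mathbf X_1,\mathbf R_1,\dots,N_n,\mathbf X_n,\mathbf R_n\}$ and $\mathcal G_n=\sigma(\mathcal F_n,N_{n+1})$. Standing assumptions, for all $n\ge0$: (I) $N_{n+1}$ takes values in $\{1,2,\dots,\min(S_n,C_1)\}$ for some constant positive integer $C_1$. (II) Conditionally on $\mathcal G_n$, $\mathbf X_{n+1}$ is multivariate hypergeometric with parameters $(S_n,N_{n+1},\mathbf H_n)$: $\mathbb P(\mathbf X_{n+1}=\mathbf x\mid\mathcal G_n)=\prod_{k=1}^d\binom{H_{nk}}{x_k}\big/\binom{S_n}{N_{n+1}}$ for integer vectors $\mathbf x$ with $0\le x_k\le H_{nk}$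 and $\sum_k x_k=N_{n+1}$. (III) Each $A_{n+1,k}$ takes (integer) values in $[1,\infty)$, and $\mathbf R_{n+1}$ is independent of $\sigma(\mathcal G_n,\mathbf X_{n+1})$. The components of $\mathbf R_{n+1}$ may be correlated with each other. Under (A1)–(A2) the almost sure limits $Z_k=\lim_nZ_{nk}$ exist for all $k$. *)

theory Defs
  imports "HOL-Probability.Probability"
begin

text \<open>
  Colours are the indices \<open>k \<in> {1..d}\<close>. For stages \<open>n \<ge> 1\<close>, \<open>N n\<close> is the number of balls drawn,
  \<open>X n k\<close> the number of drawn balls of colour \<open>k\<close>, and \<open>A n k\<close> the \<open>k\<close>-th diagonal entry of the
  replacement matrix; values at stage \<open>0\<close> or at colours outside \<open>{1..d}\<close> play no role.
\<close>

definition balls ::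
  "(nat \<Rightarrow> nat) \<Rightarrow> (nat \<Rightarrow> nat \<Rightarrow> 'a \<Rightarrow> nat) \<Rightarrow> (nat \<Rightarrow> nat \<Rightarrow> 'a \<Rightarrow> nat) \<Rightarrow> nat \<Rightarrow> nat \<Rightarrow> 'a \<Rightarrow> nat"
  where "balls H0 X A n k \<omega> = H0 k + (\<Sum>i=1..n. A i k \<omega> * X i k \<omega>)"

definition total ::
  "nat \<Rightarrow> (nat \<Rightarrow> nat) \<Rightarrow> (nat \<Rightarrow> nat \<Rightarrow> 'a \<Rightarrow> nat) \<Rightarrow> (nat \<Rightarrow> nat \<Rightarrow> 'a \<Rightarrow> nat) \<Rightarrow> nat \<Rightarrow> 'a \<Rightarrow> nat"
  where "total d H0 X A n \<omega> = (\<Sum>k=1..d. balls H0 X A n k \<omega>)"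

definition proportion ::
  "nat \<Rightarrow> (nat \<Rightarrow> nat) \<Rightarrow> (nat \<Rightarrow> nat \<Rightarrow> 'a \<Rightarrow> nat) \<Rightarrow> (nat \<Rightarrow> nat \<Rightarrow> 'a \<Rightarrow> nat) \<Rightarrow> nat \<Rightarrow> nat \<Rightarrow> 'a \<Rightarrow> real"
  where "proportion d H0 X A n k \<omega> = real (balls H0 X A n k \<omega>) / real (total d H0 X A n \<omega>)"

definition drawn :: "(nat \<Rightarrow> nat \<Rightarrow> 'a \<Rightarrow> nat) \<Rightarrow> nat \<Rightarrow> nat \<Rightarrow> 'a \<Rightarrow> nat"
  where "drawn X n k \<omega> = (\<Sum>j=1..n. X j k \<omega>)"

text \<open>The sub-sigma-algebra generated by a family of \<open>nat\<close>-valued random variables.\<close>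

definition gen_algebra :: "'a measure \<Rightarrow> ('a \<Rightarrow> nat) set \<Rightarrow> 'a measure"
  where "gen_algebra M V = sigma (space M) {f -` B \<inter> space M | f B. f \<in> V}"

definition history ::
  "nat \<Rightarrow> (nat \<Rightarrow> 'a \<Rightarrow> nat) \<Rightarrow> (nat \<Rightarrow> nat \<Rightarrow> 'a \<Rightarrow> nat) \<Rightarrow> (nat \<Rightarrow> nat \<Rightarrow> 'a \<Rightarrow> nat) \<Rightarrow> nat \<Rightarrow> ('a \<Rightarrow> nat) set"
  where "history d N X A n =
    {N i | i. i \<in> {1..n}} \<union> {X i k | i k. i \<in> {1..n} \<and> k \<in> {1..d}} \<union>
    {A i k | i k. i \<in> {1..n} \<and> k \<in> {1..d}}"

definition F_alg ::
  "'a measure \<Rightarrow> nat \<Rightarrow> (nat \<Rightarrow> 'a \<Rightarrow> nat) \<Rightarrow> (nat \<Rightarrow> nat \<Rightarrow> 'a \<Rightarrow> nat) \<Rightarrow> (nat \<Rightarrow> nat \<Rightarrow> 'a \<Rightarrow> nat) \<Rightarrow> nat \<Rightarrow> 'a measure"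
  where "F_alg M d N X A n = gen_algebra M (history d N X A n)"

definition G_alg ::
  "'a measure \<Rightarrow> nat \<Rightarrow> (nat \<Rightarrow> 'a \<Rightarrow> nat) \<Rightarrow> (nat \<Rightarrow> nat \<Rightarrow> 'a \<Rightarrow> nat) \<Rightarrow> (nat \<Rightarrow> nat \<Rightarrow> 'a \<Rightarrow> nat) \<Rightarrow> nat \<Rightarrow> 'a measure"
  where "G_alg M d N X A n = gen_algebra M (insert (N (Suc n)) (history d N X A n))"

text \<open>Probability of \<open>x\<close> when \<open>r\<close> balls are drawn without replacement from \<open>s\<close> balls, \<open>h k\<close> of
  them of colour \<open>k\<close>.\<close>

definition mv_hypergeometric :: "nat \<Rightarrow> nat \<Rightarrow> nat \<Rightarrow> (nat \<Rightarrow> nat) \<Rightarrow> (nat \<Rightarrow> nat) \<Rightarrow> real"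
  where "mv_hypergeometric d s r h x =
    (if (\<forall>k\<in>{1..d}. x k \<le> h k) \<and> (\<Sum>k=1..d. x k) = r
     then (\<Prod>k=1..d. real (h k choose x k)) / real (s choose r) else 0)"

text \<open>The assumption \<open>indep\<close> concerns the whole vector \<open>A (Suc n) 1, \<dots>, A (Suc n) d\<close>; nothing is
  assumed about the dependence between its components.\<close>

locale reinforced_urn = prob_space M for M :: "'a measure" +
  fixes d :: nat and H0 :: "nat \<Rightarrow> nat" and C1 :: nat
    and N :: "nat \<Rightarrow> 'a \<Rightarrow> nat"
    and X :: "nat \<Rightarrow> nat \<Rightarrow> 'a \<Rightarrow> nat"
    and A :: "nat \<Rightarrow> nat \<Rightarrow> 'a \<Rightarrow> nat"
  assumes colours: "d \<ge> 2"
    and initial: "\<And>k. k \<in> {1..d} \<Longrightarrow> H0 k > 0"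
    and C1_pos: "C1 > 0"
    and N_measurable: "\<And>n. n \<ge> 1 \<Longrightarrow> N n \<in> measurable M (count_space UNIV)"
    and X_measurable: "\<And>n k. n \<ge> 1 \<Longrightarrow> k \<in> {1..d} \<Longrightarrow> X n k \<in> measurable M (count_space UNIV)"
    and A_measurable: "\<And>n k. n \<ge> 1 \<Longrightarrow> k \<in> {1..d} \<Longrightarrow> A n k \<in> measurable M (count_space UNIV)"
    and draw_total: "\<And>n. n \<ge> 1 \<Longrightarrow> AE \<omega> in M. (\<Sum>k=1..d. X n k \<omega>) = N n \<omega>"
    and draw_size: "\<And>n. AE \<omega> in M. N (Suc n) \<omega> \<in> {1..min (total d H0 X A n \<omega>) C1}"
    and draw_law: "\<And>n x. AE \<omega> in M.
      real_cond_exp M (G_alg M d N X A n)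
        (indicator {\<omega> \<in> space M. \<forall>k\<in>{1..d}. X (Suc n) k \<omega> = x k}) \<omega> =
      mv_hypergeometric d (total d H0 X A n \<omega>) (N (Suc n) \<omega>) (\<lambda>k. balls H0 X A n k \<omega>) x"
    and A_ge_1: "\<And>n k. k \<in> {1..d} \<Longrightarrow> AE \<omega> in M. A (Suc n) k \<omega> \<ge> 1"
    and indep: "\<And>n. indep_set
      (sets (gen_algebra M {A (Suc n) k | k. k \<in> {1..d}}))
      (sets (gen_algebra M
        (insert (N (Suc n)) (history d N X A n) \<union> {X (Suc n) k | k. k \<in> {1..d}})))"

definition mean_repl :: "'a measure \<Rightarrow> (nat \<Rightarrow> nat \<Rightarrow> 'a \<Rightarrow> nat) \<Rightarrow> nat \<Rightarrow> nat \<Rightarrow> real"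
  where "mean_repl M A n k = (\<integral>\<omega>. real (A n k \<omega>) \<partial>M)"

text \<open>The estimators; a quotient with denominator \<open>0\<close> (possible only for small \<open>n\<close>) is \<open>0\<close>.\<close>

definition mu_hat :: "(nat \<Rightarrow> 'a \<Rightarrow> nat) \<Rightarrow> nat \<Rightarrow> 'a \<Rightarrow> real"
  where "mu_hat N n \<omega> = (\<Sum>j=1..n. real (N j \<omega>)) / real n"

definition qN_hat :: "(nat \<Rightarrow> 'a \<Rightarrow> nat) \<Rightarrow> nat \<Rightarrow> 'a \<Rightarrow> real"
  where "qN_hat N n \<omega> = (\<Sum>j=1..n. (real (N j \<omega>))\<^sup>2) / real n"

definition nu_hat ::
  "(nat \<Rightarrow> 'a \<Rightarrow> nat) \<Rightarrow> (nat \<Rightarrow> nat \<Rightarrow> 'a \<Rightarrow> nat) \<Rightarrow> nat \<Rightarrow> nat \<Rightarrow> 'a \<Rightarrow> real"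
  where "nu_hat N X n k \<omega> = 1 / real n * (\<Sum>j=1..n. real (X j k \<omega>) / real (N j \<omega>))"

definition m_hat ::
  "(nat \<Rightarrow> nat \<Rightarrow> 'a \<Rightarrow> nat) \<Rightarrow> (nat \<Rightarrow> nat \<Rightarrow> 'a \<Rightarrow> nat) \<Rightarrow> nat \<Rightarrow> nat \<Rightarrow> 'a \<Rightarrow> real"
  where "m_hat X A n k \<omega> =
    (\<Sum>j=1..n. real (A j k \<omega>) * real (X j k \<omega>)) / real (drawn X n k \<omega>)"

definition q_hat ::
  "(nat \<Rightarrow> nat \<Rightarrow> 'a \<Rightarrow> nat) \<Rightarrow> (nat \<Rightarrow> nat \<Rightarrow> 'a \<Rightarrow> nat) \<Rightarrow> nat \<Rightarrow> nat \<Rightarrow> 'a \<Rightarrow> real"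
  where "q_hat X A n k \<omega> =
    (\<Sum>j=1..n. (real (A j k \<omega>))\<^sup>2 * real (X j k \<omega>)) / real (drawn X n k \<omega>)"

definition qq_hat ::
  "(nat \<Rightarrow> nat \<Rightarrow> 'a \<Rightarrow> nat) \<Rightarrow> (nat \<Rightarrow> nat \<Rightarrow> 'a \<Rightarrow> nat) \<Rightarrow> nat \<Rightarrow> nat \<Rightarrow> nat \<Rightarrow> 'a \<Rightarrow> real"
  where "qq_hat X A n k s \<omega> =
    (\<Sum>j=1..n. real (A j k \<omega>) * real (A j s \<omega>) * real (X j k \<omega>) * real (X j s \<omega>)) /
    (\<Sum>j=1..n. real (X j k \<omega>) * real (X j s \<omega>))"

definition qq_tilde ::
  "(nat \<Rightarrow> nat \<Rightarrow> 'a \<Rightarrow> nat) \<Rightarrow> (nat \<Rightarrow> nat \<Rightarrow> 'a \<Rightarrow> nat) \<Rightarrow> nat \<Rightarrow> nat \<Rightarrow> nat \<Rightarrow> 'a \<Rightarrow> real"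
  where "qq_tilde X A n k s \<omega> =
    (\<Sum>j=1..n. real (A j k \<omega>) * real (A j s \<omega>) * real (X j k \<omega>)) / real (drawn X n k \<omega>)"

end

theory Submission
  imports Defs
begin

text \<open>
  The estimators are averages, so the theorem splits into a law of large numbers for martingale
  differences and an analysis of how fast the individual colours grow.

  \<^emph>\<open>Laws of large numbers.\<close> The replacements have bounded third moments, so the products
  \<open>A j k * A j s\<close> have bounded moments of order \<open>3/2\<close>, and these take the place of variances
  throughout. The basic tool is \<open>mart_diff_convergent\<close>: martingale differences \<open>D n\<close> for which the
  expectations of \<open>\<bar>D n\<bar> powr (3/2)\<close> have a finite sum have an almost surely convergent sum. It is
  proved as Kolmogorov's maximal inequality, with the power \<open>3/2\<close> in place of the square. Dividing
  by one plus the partial sums of predictable weights and applying Kronecker's lemma yields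
  \<open>mart_diff_lln\<close>, and from it the convergence of averages with convergent conditional means
  (\<open>average_tendsto\<close>), a conditional Borel--Cantelli lemma (\<open>cond_borel_cantelli\<close>), and a law of large
  numbers with random weights (\<open>weighted_slln\<close>). The first one settles the averages of \<open>N j\<close>, of its
  square and of \<open>X j k / N j\<close>, once the proportions are known to converge. In all other
  estimators a function of the replacement matrix of stage \<open>j\<close> is averaged with the weight \<open>X j k\<close> or
  \<open>X j k * X j s\<close>, which is known before this matrix is revealed and independent of it. Hence they
  converge wherever the weights have an infinite sum.

  \<^emph>\<open>Growth of the colours.\<close> Write \<open>h n k\<close> for the number of balls of colour \<open>k\<close> and \<open>s n\<close> for the
  total after \<open>n\<close> stages, \<open>\<mu> n k\<close> for the mean of \<open>A n k\<close> and \<open>m k\<close> for the limit of these means. Given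
  the past and \<open>N (n+1)\<close>, the increment \<open>h (n+1) k - h n k\<close> has mean
  \<open>\<mu> (n+1) k * N (n+1) * h n k / s n\<close>. The sum of \<open>X (n+1) k / h n k powr (3/2)\<close> over \<open>n\<close> is bounded
  by a constant, whatever the draws are. Therefore the centred increments divided by \<open>h n k\<close> have an
  almost surely convergent sum, and so have the powers \<open>3/2\<close> of the relative increments, which bound
  the error of linearizing the logarithm. It follows that
  \<open>ln (h n k) = (\<Sum>i<n. \<mu> (i+1) k * N (i+1) / s i) + convergent\<close> for every colour (\<open>log_growth\<close>).
  The clock \<open>\<Sum>i<n. N (i+1) / s i\<close> tends to infinity, since \<open>ln (s n)\<close> is at most a constant plus a
  multiple of it. Everything else is read off. All \<open>h n k\<close> tend to infinity, so each colour is drawn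
  infinitely often. The ratio \<open>h n k / h n 1\<close> converges, to a positive limit for the colours of maximal
  mean and to \<open>0\<close> for the others, so the proportions converge and that of colour \<open>1\<close> has a positive
  limit. If \<open>m k + m l > m 1\<close>, then \<open>h n k * h n l / h n 1\<close> tends to infinity, so
  \<open>h n k * h n l / s n ^ 2\<close> exceeds a multiple of \<open>1 / s n\<close>, whose sum is infinite. For \<open>k \<noteq> l\<close>, the
  conditional mean of \<open>X (n+1) k * X (n+1) l\<close> given the first \<open>n\<close> stages is asymptotically
  \<open>(Q - N) * h n k * h n l / s n ^ 2\<close>, so the conditional Borel--Cantelli lemma shows that these weights
  have an infinite sum on the event \<open>Q > N\<close>.
\<close>

section \<open>Sequences and series\<close>

text \<open>Divergence to infinity.\<close>

abbreviation diverges :: "(nat \<Rightarrow> real) \<Rightarrow> bool"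
  where "diverges x \<equiv> filterlim x at_top sequentially"

lemma toeplitz:
  fixes w a :: "nat \<Rightarrow> real"
  assumes w: "\<And>i. 0 \<le> w i" and W: "diverges (\<lambda>n. \<Sum>i<n. w i)"
    and a: "a \<longlonglongrightarrow> L"
  shows "(\<lambda>n. (\<Sum>i<n. w i * a i) / (\<Sum>i<n. w i)) \<longlonglongrightarrow> L"
proof (rule LIMSEQ_I)
  fix e :: real assume e: "0 < e"
  define W where "W n = (\<Sum>i<n. w i)" for n
  obtain n0 where n0: "\<And>i. i \<ge> n0 \<Longrightarrow> \<bar>a i - L\<bar> < e / 2"
    using LIMSEQ_D[OF a, of "e / 2"] e by auto
  define C where "C = (\<Sum>i<n0. w i * \<bar>a i - L\<bar>)"
  have C: "0 \<le> C" using w by (auto simp: C_def intro!: sum_nonneg)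
  have bound: "\<bar>\<Sum>i<n. w i * (a i - L)\<bar> \<le> C + e / 2 * W n" for n
  proof -
    have "\<bar>\<Sum>i<n. w i * (a i - L)\<bar> \<le> (\<Sum>i<n. w i * \<bar>a i - L\<bar>)"
      by (rule order_trans[OF sum_abs]) (simp add: abs_mult w)
    also have "\<dots> \<le> (\<Sum>i<n. (if i < n0 then w i * \<bar>a i - L\<bar> else 0) + w i * (e / 2))"
    proof (rule sum_mono)
      fix i
      show "w i * \<bar>a i - L\<bar> \<le> (if i < n0 then w i * \<bar>a i - L\<bar> else 0) + w i * (e / 2)"
        using mult_left_mono[of "\<bar>a i - L\<bar>" "e / 2" "w i"] n0[of i] w[of i] e
        by (cases "i < n0") auto
    qed
    also have "\<dots> = (\<Sum>i\<in>{..<n} \<inter> {..<n0}. w i * \<bar>a i - L\<bar>) + e / 2 * W n"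
    proof -
      have "(\<Sum>i<n. w i * (e / 2)) = e / 2 * W n"
        by (simp only: W_def sum_distrib_right[symmetric] mult.commute)
      then show ?thesis
        using sum.inter_restrict[of "{..<n}" "\<lambda>i. w i * \<bar>a i - L\<bar>" "{..<n0}"]
        by (simp add: sum.distrib)
    qed
    also have "(\<Sum>i\<in>{..<n} \<inter> {..<n0}. w i * \<bar>a i - L\<bar>) \<le> C"
      unfolding C_def using w by (intro sum_mono2) auto
    finally show ?thesis by simp
  qed
  have "eventually (\<lambda>n. W n > 2 * C / e + 1) sequentially"
    using W unfolding filterlim_at_top_dense W_def by blast
  then obtain n1 where n1: "\<And>n. n \<ge> n1 \<Longrightarrow> W n > 2 * C / e + 1"
    by (auto simp: eventually_sequentially)
  show "\<exists>no. \<forall>n\<ge>no. norm ((\<Sum>i<n. w i * a i) / (\<Sum>i<n. w i) - L) < e"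
  proof (intro exI allI impI)
    fix n assume "n \<ge> n1"
    then have Wn: "W n > 2 * C / e + 1" by (rule n1)
    have "0 \<le> 2 * C / e" using C e by simp
    with Wn have Wpos: "W n > 0" by linarith
    have "C < e / 2 * W n" using Wn e by (simp add: field_simps)
    then have "\<bar>\<Sum>i<n. w i * (a i - L)\<bar> < e * W n" using bound[of n] by linarith
    moreover have "(\<Sum>i<n. w i * a i) / W n - L = (\<Sum>i<n. w i * (a i - L)) / W n"
      using Wpos by (simp add: W_def field_simps sum_subtractf sum_distrib_left sum_distrib_right)
    ultimately show "norm ((\<Sum>i<n. w i * a i) / (\<Sum>i<n. w i) - L) < e"
      using Wpos unfolding W_def[symmetric] by (simp add: field_simps)
  qed
qed

text \<open>A form of Kronecker's lemma. The normalizer of \<open>x i\<close> is \<open>1 + (\<Sum>j<Suc i. w j)\<close>: the summand \<open>1\<close> keeps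
  it away from \<open>0\<close> before the first positive weight and is negligible in the limit.\<close>

lemma kronecker:
  fixes w x :: "nat \<Rightarrow> real"
  assumes w: "\<And>i. 0 \<le> w i" and W: "diverges (\<lambda>n. \<Sum>i<n. w i)"
    and conv: "convergent (\<lambda>n. \<Sum>i<n. x i / (1 + (\<Sum>j<Suc i. w j)))"
  shows "(\<lambda>n. (\<Sum>i<n. x i) / (\<Sum>i<n. w i)) \<longlonglongrightarrow> 0"
proof -
  define U where "U n = 1 + (\<Sum>j<n. w j)" for n
  define s where "s n = (\<Sum>i<n. x i / U (Suc i))" for n
  have U1: "1 \<le> U n" for n using w by (simp add: U_def sum_nonneg)
  obtain L where L: "s \<longlonglongrightarrow> L"
    using conv unfolding convergent_def s_def U_def by auto
  have abel: "(\<Sum>i<n. x i) = U n * s n - (\<Sum>i<n. w i * s i)" for n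
  proof (induction n)
    case 0 then show ?case by (simp add: s_def)
  next
    case (Suc n)
    have "x n = U (Suc n) * (s (Suc n) - s n)"
      using U1[of "Suc n"] by (simp add: s_def)
    then show ?case using Suc by (simp add: algebra_simps U_def)
  qed
  have inv: "(\<lambda>n. inverse (\<Sum>i<n. w i)) \<longlonglongrightarrow> 0"
    by (rule tendsto_inverse_0_at_top[OF W])
  have nz: "eventually (\<lambda>n. (\<Sum>i<n. w i) > 0) sequentially"
    using W unfolding filterlim_at_top_dense by blast
  have "(\<lambda>n. (1 + inverse (\<Sum>i<n. w i)) * s n - (\<Sum>i<n. w i * s i) / (\<Sum>i<n. w i))
      \<longlonglongrightarrow> (1 + 0) * L - L"
    by (intro tendsto_intros inv L toeplitz[OF w W])
  moreover have "eventually (\<lambda>n. (1 + inverse (\<Sum>i<n. w i)) * s n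
      - (\<Sum>i<n. w i * s i) / (\<Sum>i<n. w i) = (\<Sum>i<n. x i) / (\<Sum>i<n. w i)) sequentially"
    using nz by eventually_elim (simp add: abel U_def field_simps)
  ultimately show ?thesis by (simp add: filterlim_cong)
qed

lemma sum_at_top_comparison:
  fixes w x :: "nat \<Rightarrow> real"
  assumes W: "diverges (\<lambda>n. \<Sum>i<n. w i)" and c: "0 < c"
    and le: "eventually (\<lambda>i. c * w i \<le> x i) sequentially"
  shows "diverges (\<lambda>n. \<Sum>i<n. x i)"
proof -
  obtain n0 where n0: "\<And>i. i \<ge> n0 \<Longrightarrow> c * w i \<le> x i" using le by (auto simp: eventually_sequentially)
  have "(\<Sum>i<n0. x i - c * w i) + c * (\<Sum>i<n. w i) \<le> (\<Sum>i<n. x i)" if "n \<ge> n0" for n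
    using that
  proof (induction n rule: dec_induct)
    case base then show ?case by (simp add: sum_subtractf sum_distrib_left)
  next
    case (step n) then show ?case using n0[of n] by (simp add: distrib_left)
  qed
  then have *: "eventually (\<lambda>n. (\<Sum>i<n0. x i - c * w i) + c * (\<Sum>i<n. w i) \<le> (\<Sum>i<n. x i)) sequentially"
    by (auto simp: eventually_sequentially)
  have "diverges (\<lambda>n. (\<Sum>i<n0. x i - c * w i) + c * (\<Sum>i<n. w i))"
    by (rule filterlim_tendsto_add_at_top[OF tendsto_const])
      (rule filterlim_tendsto_pos_mult_at_top[OF tendsto_const c W])
  then show ?thesis by (rule filterlim_at_top_mono[OF _ *])
qed

lemma sum_nat_at_top:
  fixes f :: "nat \<Rightarrow> nat"
  assumes "\<And>n. \<exists>i\<ge>n. 1 \<le> f i"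
  shows "diverges (\<lambda>n. \<Sum>i<n. real (f i))"
proof -
  have ex: "\<exists>n. real Z \<le> (\<Sum>i<n. real (f i))" for Z :: nat
  proof (induction Z)
    case 0 show ?case by (auto intro: exI[of _ 0])
  next
    case (Suc Z)
    then obtain n where n: "real Z \<le> (\<Sum>i<n. real (f i))" by blast
    obtain i where i: "i \<ge> n" "1 \<le> f i" using assms by blast
    have "(\<Sum>i<n. real (f i)) \<le> (\<Sum>j<i. real (f j))" using i(1) by (intro sum_mono2) auto
    then have "real (Suc Z) \<le> (\<Sum>j<Suc i. real (f j))" using n i(2) by simp
    then show ?case by blast
  qed
  show ?thesis
    unfolding filterlim_at_top
  proof
    fix Z :: real
    obtain n where n: "real (nat \<lceil>Z\<rceil>) \<le> (\<Sum>i<n. real (f i))" using ex by blast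
    have "Z \<le> (\<Sum>i<m. real (f i))" if "n \<le> m" for m
    proof -
      have "Z \<le> real (nat \<lceil>Z\<rceil>)" by linarith
      also note n
      also have "(\<Sum>i<n. real (f i)) \<le> (\<Sum>i<m. real (f i))" using that by (intro sum_mono2) auto
      finally show ?thesis .
    qed
    then show "eventually (\<lambda>m. Z \<le> (\<Sum>i<m. real (f i))) sequentially"
      by (auto simp: eventually_sequentially)
  qed
qed

section \<open>The power 3/2\<close>

text \<open>The function \<open>\<bar>x\<bar> powr (3/2)\<close>, written so that it is defined and continuous at \<open>0\<close> without a
  case distinction.\<close>

definition pow32 :: "real \<Rightarrow> real"
  where "pow32 x = \<bar>x\<bar> * sqrt \<bar>x\<bar>"

lemma pow32_nonneg [simp]: "0 \<le> pow32 x"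
  by (simp add: pow32_def)

lemma pow32_zero [simp]: "pow32 0 = 0"
  by (simp add: pow32_def)

lemma pow32_mult: "pow32 (x * y) = pow32 x * pow32 y"
  by (simp add: pow32_def abs_mult real_sqrt_mult)

lemma pow32_mono: "\<bar>x\<bar> \<le> \<bar>y\<bar> \<Longrightarrow> pow32 x \<le> pow32 y"
  unfolding pow32_def by (intro mult_mono) auto

lemma pow32_diff_le: "0 \<le> x \<Longrightarrow> 0 \<le> y \<Longrightarrow> pow32 (x - y) \<le> pow32 x + pow32 y"
proof -
  assume a: "0 \<le> x" "0 \<le> y"
  show ?thesis
  proof (cases "x \<le> y")
    case True
    then have "pow32 (x - y) \<le> pow32 y" using a by (intro pow32_mono) auto
    then show ?thesis by (simp add: add_increasing)
  next
    case False
    then have "pow32 (x - y) \<le> pow32 x" using a by (intro pow32_mono) auto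
    then show ?thesis by (simp add: add_increasing2)
  qed
qed

lemma pow32_le_linear: "0 \<le> x \<Longrightarrow> x \<le> K \<Longrightarrow> pow32 x \<le> sqrt K * x"
  unfolding pow32_def by (simp add: mult.commute[of "sqrt K"] mult_left_mono)

lemma abs_le_pow32: "\<bar>x\<bar> \<le> 1 + pow32 x"
proof (cases "\<bar>x\<bar> \<le> 1")
  case True then show ?thesis by (simp add: add_increasing2)
next
  case False
  then have "\<bar>x\<bar> * 1 \<le> \<bar>x\<bar> * sqrt \<bar>x\<bar>" by (intro mult_left_mono) auto
  then show ?thesis unfolding pow32_def by simp
qed

text \<open>The substitute for \<open>(a + b)\<^sup>2 = a\<^sup>2 + 2 * a * b + b\<^sup>2\<close>: the middle term is the derivative of
  \<open>pow32\<close> at \<open>a\<close> times \<open>b\<close>, so its expectation vanishes if \<open>b\<close> is a martingale difference.\<close>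

lemma pow32_add_le:
  "pow32 (a + b) \<le> pow32 a + 3 / 2 * sgn a * sqrt \<bar>a\<bar> * b + 3 * pow32 b"
proof -
  have pos: "pow32 (a + b) \<le> pow32 a + 3 / 2 * sqrt a * b + 3 * pow32 b"
    if a: "0 \<le> a" for a b :: real
  proof -
    \<comment> \<open>in the square roots u and v all terms except pow32 b are polynomial\<close>
    define u where "u = sqrt a"
    define v where "v = sqrt \<bar>a + b\<bar>"
    have u: "0 \<le> u" "a = u\<^sup>2" and v: "0 \<le> v" "\<bar>a + b\<bar> = v\<^sup>2"
      using a by (auto simp: u_def v_def)
    have ab: "pow32 (a + b) = v ^ 3"
      unfolding pow32_def v_def [symmetric] v(2) using v(1)
      by (simp add: power2_eq_square power3_eq_cube)
    have aa: "pow32 a = u ^ 3"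
      using a unfolding pow32_def u_def[symmetric] by (simp add: u(2) u(1) power2_eq_square power3_eq_cube)
    show ?thesis
    proof (cases "0 \<le> a + b")
      case True
      then have b: "b = v\<^sup>2 - u\<^sup>2" using u v by auto
      have e: "\<bar>b\<bar> = \<bar>v - u\<bar> * (v + u)"
        using u(1) v(1) unfolding b power2_eq_square square_diff_square_factored
        by (simp add: abs_mult mult.commute)
      have "\<bar>v - u\<bar> \<le> sqrt \<bar>b\<bar>"
      proof (rule real_le_rsqrt)
        have "\<bar>v - u\<bar> * \<bar>v - u\<bar> \<le> \<bar>v - u\<bar> * (v + u)"
          using u(1) v(1) by (intro mult_left_mono) auto
        then show "\<bar>v - u\<bar>\<^sup>2 \<le> \<bar>b\<bar>" by (simp only: e power2_eq_square)
      qed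
      then have "\<bar>b\<bar> * \<bar>v - u\<bar> \<le> pow32 b"
        unfolding pow32_def by (intro mult_left_mono) auto
      moreover have "\<bar>b\<bar> * \<bar>v - u\<bar> = (v - u)\<^sup>2 * (v + u)"
        unfolding e by (simp add: power2_eq_square)
      moreover have "(v - u)\<^sup>2 * (v + u / 2) \<le> (v - u)\<^sup>2 * (v + u)"
        using u(1) by (intro mult_left_mono) auto
      moreover have "2 * v ^ 3 - 2 * u ^ 3 - 3 * (u * b) = 2 * ((v - u)\<^sup>2 * (v + u / 2))"
      proof -
        have "2 * v ^ 3 - 2 * u ^ 3 - 3 * (u * (v\<^sup>2 - u\<^sup>2)) = (v - u)\<^sup>2 * (2 * v + u)"
          by algebra
        then show ?thesis unfolding b by (simp add: distrib_left)
      qed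
      ultimately have "v ^ 3 \<le> u ^ 3 + 3 / 2 * (u * b) + pow32 b" by linarith
      then show ?thesis unfolding ab aa u_def[symmetric]
        unfolding mult.assoc using pow32_nonneg[of b] by linarith
    next
      case False
      then have b: "b = - (u\<^sup>2 + v\<^sup>2)" using u v by auto
      define r where "r = sqrt \<bar>b\<bar>"
      have r: "0 \<le> r" "r\<^sup>2 = u\<^sup>2 + v\<^sup>2" by (auto simp: r_def b)
      have pb: "pow32 b = r ^ 3"
        unfolding pow32_def r_def[symmetric] using r(2) b
        by (simp add: power2_eq_square power3_eq_cube)
      have ru: "u \<le> r" and rv: "v \<le> r"
        using r by (auto intro: power2_le_imp_le)
      have 1: "v ^ 3 \<le> r ^ 3" using rv v(1) by (intro power_mono) auto
      have 2: "u ^ 3 \<le> r ^ 3" using ru u(1) by (intro power_mono) auto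
      have 3: "u * v\<^sup>2 \<le> r ^ 3"
      proof -
        have "u * v\<^sup>2 \<le> r * r\<^sup>2" using ru rv u(1) v(1) r(1) by (intro mult_mono power_mono) auto
        then show ?thesis by (simp add: power2_eq_square power3_eq_cube)
      qed
      have 4: "u * b = - (u ^ 3 + u * v\<^sup>2)"
        unfolding b by (simp add: power2_eq_square power3_eq_cube algebra_simps)
      have "v ^ 3 \<le> u ^ 3 + 3 / 2 * (u * b) + 3 * r ^ 3"
        unfolding 4 mult_minus_right distrib_left using 1 2 3 by linarith
      then show ?thesis unfolding ab aa u_def[symmetric] pb by (simp add: mult.assoc)
    qed
  qed
  show ?thesis
  proof (cases "0 \<le> a")
    case True
    then show ?thesis using pos[of a b] by (cases "a = 0") auto
  next
    case False
    then have "pow32 (- a + - b) \<le> pow32 (- a) + 3 / 2 * sqrt (- a) * (- b) + 3 * pow32 (- b)"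
      by (intro pos) auto
    moreover have "pow32 (- a + - b) = pow32 (a + b)" "pow32 (- a) = pow32 a" "pow32 (- b) = pow32 b"
    proof -
      have "\<bar>- a + - b\<bar> = \<bar>a + b\<bar>" by linarith
      then show "pow32 (- a + - b) = pow32 (a + b)" unfolding pow32_def by (simp only:)
    qed (simp_all add: pow32_def)
    ultimately show ?thesis using False by (simp add: sgn_if)
  qed
qed

lemma diff_ln_le_pow32:
  assumes "0 \<le> x" shows "x - ln (1 + x) \<le> pow32 x"
proof (cases "x \<le> 1")
  case True
  have "x - x\<^sup>2 \<le> ln (1 + x)" using assms True by (rule ln_one_plus_pos_lower_bound)
  moreover have "x * x \<le> x * sqrt x"
    using assms True by (intro mult_left_mono real_le_rsqrt) (auto simp: power2_eq_square mult_left_le)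
  ultimately show ?thesis using assms by (simp add: pow32_def power2_eq_square)
next
  case False
  then have "x * 1 \<le> x * sqrt x" by (intro mult_left_mono) auto
  moreover have "0 \<le> ln (1 + x)" using assms by simp
  ultimately have "x - ln (1 + x) \<le> x * sqrt x" by linarith
  then show ?thesis using assms unfolding pow32_def by simp
qed

lemma pow32_measurable [measurable]: "pow32 \<in> borel_measurable borel"
  unfolding pow32_def [abs_def] by measurable

lemma nat_le_cube: "real a \<le> real a ^ 3"
  using self_le_power[of "real a" 3] by (cases "a = 0") auto

lemma pow32_square: "0 \<le> x \<Longrightarrow> pow32 (x * x) = x ^ 3"
  by (simp add: pow32_def power3_eq_cube)

lemma pow32_nat_le_cube: "pow32 (real a) \<le> real a ^ 3"
proof -
  have "\<bar>real a\<bar> \<le> \<bar>real a * real a\<bar>" by (cases "a = 0") auto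
  then have "pow32 (real a) \<le> pow32 (real a * real a)" by (rule pow32_mono)
  then show ?thesis by (simp add: pow32_square)
qed

lemma pow32_product_le:
  assumes "0 \<le> x" "0 \<le> y" shows "pow32 (x * y) \<le> x ^ 3 + y ^ 3"
proof -
  define z where "z = max x y"
  have z: "0 \<le> z" "x \<le> z" "y \<le> z" using assms by (auto simp: z_def)
  have "x * y \<le> z * z" using z assms by (intro mult_mono) auto
  then have "pow32 (x * y) \<le> pow32 (z * z)" using assms by (intro pow32_mono) auto
  also have "\<dots> = z ^ 3" by (rule pow32_square[OF z(1)])
  also have "\<dots> \<le> x ^ 3 + y ^ 3" using assms by (auto simp: z_def max_def)
  finally show ?thesis .
qed

text \<open>The sum is a Riemann sum for the integral of \<open>1 / pow32 x\<close> over \<open>{1..}\<close>, which equals \<open>2\<close>.\<close>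

lemma sum_div_pow32_le:
  fixes w :: "nat \<Rightarrow> real"
  assumes "\<And>i. 0 \<le> w i"
  shows "(\<Sum>i<n. w i * pow32 (1 / (1 + (\<Sum>j<Suc i. w j)))) \<le> 2"
proof -
  define U where "U n = 1 + (\<Sum>j<n. w j)" for n
  have U1: "1 \<le> U n" for n using assms by (simp add: U_def sum_nonneg)
  have "(\<Sum>i<n. w i * pow32 (1 / U (Suc i))) \<le> 2 - 2 / sqrt (U n)" for n
  proof (induction n)
    case 0 then show ?case by (simp add: U_def)
  next
    case (Suc n)
    define a where "a = sqrt (U n)"
    define b where "b = sqrt (U (Suc n))"
    have U: "U (Suc n) = U n + w n" by (simp add: U_def)
    have a: "1 \<le> a" using U1 by (simp add: a_def)
    have ab: "a \<le> b" unfolding a_def b_def U using assms by simp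
    have sq: "U n = a * a" "U (Suc n) = b * b"
      using U1[of n] U1[of "Suc n"] by (auto simp: a_def b_def)
    have w: "w n = (b - a) * (b + a)" using U sq by (simp add: algebra_simps)
    have p: "pow32 (1 / U (Suc n)) = 1 / (b * b * b)"
      unfolding pow32_def using U1[of "Suc n"] sq(2) a ab
      by (simp add: real_sqrt_divide real_sqrt_mult)
    have "(b - a) * ((b + a) * a) \<le> (b - a) * (2 * (b * b))"
    proof (intro mult_left_mono)
      have "b * a \<le> b * b" "a * a \<le> b * b" using a ab by (auto intro!: mult_mono)
      then show "(b + a) * a \<le> 2 * (b * b)" by (simp add: algebra_simps)
    qed (use ab in auto)
    note * = this
    have "w n * pow32 (1 / U (Suc n)) \<le> 2 / a - 2 / b"
    proof -
      have "w n * pow32 (1 / U (Suc n)) = (b - a) * ((b + a) * a) / (a * (b * b * b))"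
        unfolding p w using a ab by simp
      also have "\<dots> \<le> (b - a) * (2 * (b * b)) / (a * (b * b * b))"
        using * a ab by (intro divide_right_mono) auto
      also have "\<dots> = 2 / a - 2 / b" using a ab by (simp add: field_simps)
      finally show ?thesis .
    qed
    then show ?case using Suc unfolding a_def b_def by simp
  qed
  then have "(\<Sum>i<n. w i * pow32 (1 / U (Suc i))) \<le> 2 - 2 / sqrt (U n)" .
  also have "\<dots> \<le> 2" using U1[of n] by simp
  finally show ?thesis by (simp only: U_def)
qed

section \<open>Martingale differences with moments of order 3/2\<close>

text \<open>A filtration indexed by the natural numbers.\<close>

locale nat_filtration = prob_space M for M :: "'a measure" +
  fixes F :: "nat \<Rightarrow> 'a measure"
  assumes subalg: "\<And>n. subalgebra M (F n)"
    and subalg_Suc: "\<And>n. subalgebra (F (Suc n)) (F n)"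
begin

lemma measurable_F_mono:
  assumes "m \<le> n" "f \<in> measurable (F m) R" shows "f \<in> measurable (F n) R"
  using assms(1)
proof (induction n rule: dec_induct)
  case base then show ?case by (rule assms(2))
next
  case (step n)
  from measurable_from_subalg[OF subalg_Suc step.IH] show ?case .
qed

lemma measurable_F_M: "f \<in> measurable (F n) R \<Longrightarrow> f \<in> measurable M R"
  by (rule measurable_from_subalg[OF subalg])

lemma finite_measure_subalgebra_F: "finite_measure_subalgebra M (F n)"
  by (simp add: finite_measure_axioms finite_measure_subalgebra_axioms_def
      finite_measure_subalgebra_def subalg)

text \<open>Martingale differences, with the shift that \<open>D n\<close> is revealed at time \<open>Suc n\<close>. That the
  conditional mean given \<open>F n\<close> vanishes is expressed by orthogonality to all bounded functions
  measurable at time \<open>n\<close>.\<close>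

definition mart_diff :: "(nat \<Rightarrow> 'a \<Rightarrow> real) \<Rightarrow> bool" where
  "mart_diff D \<longleftrightarrow> (\<forall>n. D n \<in> borel_measurable (F (Suc n)) \<and> integrable M (D n) \<and>
    (\<forall>g K. g \<in> borel_measurable (F n) \<longrightarrow> (\<forall>\<omega>. \<bar>g \<omega>\<bar> \<le> K) \<longrightarrow> (LINT \<omega>|M. g \<omega> * D n \<omega>) = 0))"

lemma mart_diff_transform:
  assumes D: "mart_diff D" and c: "\<And>n. c n \<in> borel_measurable (F n)"
    and bound: "\<And>n \<omega>. \<bar>c n \<omega>\<bar> \<le> K"
  shows "mart_diff (\<lambda>n \<omega>. c n \<omega> * D n \<omega>)"
  unfolding mart_diff_def
proof (intro allI conjI impI)
  fix n
  have Dn: "D n \<in> borel_measurable (F (Suc n))" "integrable M (D n)"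
    using D by (auto simp: mart_diff_def)
  have cS: "c n \<in> borel_measurable (F (Suc n))"
    using c[of n] by (rule measurable_F_mono[rotated]) simp
  show "(\<lambda>\<omega>. c n \<omega> * D n \<omega>) \<in> borel_measurable (F (Suc n))"
    using Dn(1) cS by measurable
  have cM[measurable]: "c n \<in> borel_measurable M" by (rule measurable_F_M[OF c])
  have [measurable]: "D n \<in> borel_measurable M" by (rule measurable_F_M[OF Dn(1)])
  show "integrable M (\<lambda>\<omega>. c n \<omega> * D n \<omega>)"
    using bound by (intro Bochner_Integration.integrable_bound[OF integrable_mult_right[OF Dn(2), of K]])
      (auto simp: abs_mult
        intro!: mult_right_mono order_trans[OF bound abs_ge_self])
  fix g :: "'a \<Rightarrow> real" and K' assume g: "g \<in> borel_measurable (F n)" "\<forall>\<omega>. \<bar>g \<omega>\<bar> \<le> K'"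
  have "(\<lambda>\<omega>. g \<omega> * c n \<omega>) \<in> borel_measurable (F n)" using g(1) c[of n] by measurable
  moreover have "\<forall>\<omega>. \<bar>g \<omega> * c n \<omega>\<bar> \<le> K' * K"
  proof
    fix \<omega>
    have "0 \<le> K'" using g(2) by (meson abs_ge_zero order_trans)
    then show "\<bar>g \<omega> * c n \<omega>\<bar> \<le> K' * K"
      using g(2) bound[of n \<omega>] by (simp add: abs_mult mult_mono)
  qed
  ultimately have "(LINT \<omega>|M. (g \<omega> * c n \<omega>) * D n \<omega>) = 0"
    using D unfolding mart_diff_def by blast
  then show "(LINT \<omega>|M. g \<omega> * (c n \<omega> * D n \<omega>)) = 0" by (simp add: mult.assoc)
qed

text \<open>Kolmogorov's inequality for the power \<open>3/2\<close>, for the partial sums after time \<open>m\<close>. The sums are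
  stopped when they first leave the interval from \<open>- e\<close> to \<open>e\<close>; the stopped sums still have the
  martingale property, and Markov's inequality is applied to the last one.\<close>

lemma mart_diff_maximal:
  assumes D: "mart_diff D" and int: "\<And>n. integrable M (\<lambda>\<omega>. pow32 (D n \<omega>))" and e: "0 < e"
  shows "prob {\<omega>\<in>space M. \<exists>k\<le>n. e \<le> \<bar>\<Sum>i<k. D (m + i) \<omega>\<bar>}
    \<le> 3 * (\<Sum>i<n. LINT \<omega>|M. pow32 (D (m + i) \<omega>)) / pow32 e"
proof -
  define T where "T k \<omega> = (\<Sum>i<k. D (m + i) \<omega>)" for k \<omega>
  define act where "act n \<omega> \<longleftrightarrow> (\<forall>k\<le>n. \<bar>T k \<omega>\<bar> < e)" for n \<omega>
  define R where "R n \<omega> = (\<Sum>i<n. if act i \<omega> then D (m + i) \<omega> else 0)" for n \<omega>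
  have DF: "D n \<in> borel_measurable (F (Suc n))" for n using D by (simp add: mart_diff_def)
  have [measurable]: "D n \<in> borel_measurable M" for n by (rule measurable_F_M[OF DF])
  have TF: "T k \<in> borel_measurable (F (m + n))" if "k \<le> n" for k n
    unfolding T_def [abs_def]
  proof (rule borel_measurable_sum)
    fix i assume "i \<in> {..<k}"
    then have "Suc (m + i) \<le> m + n" using that by simp
    then show "D (m + i) \<in> borel_measurable (F (m + n))" by (rule measurable_F_mono[OF _ DF])
  qed
  have actF: "Measurable.pred (F (m + n)) (act n)" for n
  proof -
    have [measurable]: "k \<in> {..n} \<Longrightarrow> T k \<in> borel_measurable (F (m + n))" for k using TF[of k n] by simp
    have "Measurable.pred (F (m + n)) (\<lambda>\<omega>. \<forall>k\<in>{..n}. \<bar>T k \<omega>\<bar> < e)" by measurable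
    then show ?thesis by (simp add: act_def [abs_def])
  qed
  have RF: "R n \<in> borel_measurable (F (m + n))" for n
    unfolding R_def [abs_def]
  proof (rule borel_measurable_sum)
    fix i assume i: "i \<in> {..<n}"
    then have "Suc (m + i) \<le> m + n" by simp
    then have [measurable]: "D (m + i) \<in> borel_measurable (F (m + n))" by (rule measurable_F_mono[OF _ DF])
    have [measurable]: "Measurable.pred (F (m + n)) (act i)"
      by (rule measurable_F_mono[OF _ actF]) (use i in simp)
    show "(\<lambda>\<omega>. if act i \<omega> then D (m + i) \<omega> else 0) \<in> borel_measurable (F (m + n))" by measurable
  qed
  have [measurable]: "Measurable.pred M (act n)" "R n \<in> borel_measurable M" for n
    by (rule measurable_F_M[OF actF], rule measurable_F_M[OF RF])
  \<comment> \<open>R is the stopped sum: it follows T up to and including the first exit and stays there\<close>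
  have R: "(act n \<omega> \<longrightarrow> R n \<omega> = T n \<omega>) \<and> (\<not> act n \<omega> \<longrightarrow> e \<le> \<bar>R n \<omega>\<bar>)" for n \<omega>
  proof (induction n)
    case 0 show ?case using e by (simp add: act_def T_def R_def)
  next
    case (Suc n)
    have *: "act (Suc n) \<omega> \<longleftrightarrow> act n \<omega> \<and> \<bar>T (Suc n) \<omega>\<bar> < e"
      unfolding act_def by (auto simp: le_Suc_eq)
    show ?case
    proof (cases "act n \<omega>")
      case True
      then have "R (Suc n) \<omega> = T (Suc n) \<omega>" using Suc by (simp add: R_def T_def)
      then show ?thesis using True * by auto
    next
      case False
      then have "R (Suc n) \<omega> = R n \<omega>" by (simp add: R_def)
      then show ?thesis using False Suc * by auto
    qed
  qed
  have ER: "integrable M (\<lambda>\<omega>. pow32 (R n \<omega>)) \<and>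
      (LINT \<omega>|M. pow32 (R n \<omega>)) \<le> 3 * (\<Sum>i<n. LINT \<omega>|M. pow32 (D (m + i) \<omega>))" for n
  proof (induction n)
    case 0 show ?case by (simp add: R_def)
  next
    case (Suc n)
    define g where "g \<omega> = (if act n \<omega> then 3 / 2 * sgn (R n \<omega>) * sqrt \<bar>R n \<omega>\<bar> else 0)" for \<omega>
    have gF: "g \<in> borel_measurable (F (m + n))"
      using RF[of n] actF[of n] unfolding g_def [abs_def] by measurable
    have gM [measurable]: "g \<in> borel_measurable M" by (rule measurable_F_M[OF gF])
    \<comment> \<open>the factor of the linear term is bounded, because R is smaller than e before the exit\<close>
    have gb: "\<bar>g \<omega>\<bar> \<le> 3 / 2 * sqrt e" for \<omega>
    proof (cases "act n \<omega>")
      case True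
      then have "\<bar>R n \<omega>\<bar> < e" using R[of n \<omega>] by (auto simp: act_def)
      then have "sqrt \<bar>R n \<omega>\<bar> \<le> sqrt e" by simp
      then show ?thesis using True e by (cases "R n \<omega> = 0") (auto simp: g_def abs_mult abs_sgn_eq)
    qed (use e in \<open>simp add: g_def\<close>)
    have Dint: "integrable M (D (m + n))" using D by (simp add: mart_diff_def)
    have gDint: "integrable M (\<lambda>\<omega>. g \<omega> * D (m + n) \<omega>)"
    proof (rule Bochner_Integration.integrable_bound[OF integrable_mult_right[OF Dint, of "3 / 2 * sqrt e"]])
      show "(\<lambda>\<omega>. g \<omega> * D (m + n) \<omega>) \<in> borel_measurable M" by measurable
    next
      have "norm (g \<omega> * D (m + n) \<omega>) \<le> norm (3 / 2 * sqrt e * D (m + n) \<omega>)" for \<omega>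
        using mult_right_mono[OF gb[of \<omega>], of "\<bar>D (m + n) \<omega>\<bar>"] e by (simp add: abs_mult)
      then show "AE \<omega> in M. norm (g \<omega> * D (m + n) \<omega>) \<le> norm (3 / 2 * sqrt e * D (m + n) \<omega>)"
        by (rule AE_I2)
    qed
    have gD: "(LINT \<omega>|M. g \<omega> * D (m + n) \<omega>) = 0"
      using D gF gb unfolding mart_diff_def by blast
    let ?B = "\<lambda>\<omega>. pow32 (R n \<omega>) + g \<omega> * D (m + n) \<omega> + 3 * pow32 (D (m + n) \<omega>)"
    have Bint: "integrable M ?B" using Suc int gDint by (intro Bochner_Integration.integrable_add integrable_mult_right) auto
    have le: "pow32 (R (Suc n) \<omega>) \<le> ?B \<omega>" for \<omega>
      using pow32_add_le[of "R n \<omega>" "D (m + n) \<omega>"] by (simp add: R_def[of "Suc n"] R_def[of n] g_def)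
    have Sint: "integrable M (\<lambda>\<omega>. pow32 (R (Suc n) \<omega>))"
      by (rule Bochner_Integration.integrable_bound[OF Bint])
        (auto intro!: AE_I2 order_trans[OF le abs_ge_self])
    have "(LINT \<omega>|M. pow32 (R (Suc n) \<omega>)) \<le> (LINT \<omega>|M. ?B \<omega>)"
      by (intro integral_mono Sint Bint le)
    also have "\<dots> = (LINT \<omega>|M. pow32 (R n \<omega>)) + 3 * (LINT \<omega>|M. pow32 (D (m + n) \<omega>))"
      using Suc gDint int gD by simp
    finally show ?case using Suc Sint by simp
  qed
  have "prob {\<omega>\<in>space M. \<exists>k\<le>n. e \<le> \<bar>T k \<omega>\<bar>} \<le> prob {\<omega>\<in>space M. pow32 e \<le> pow32 (R n \<omega>)}"
  proof (intro finite_measure_mono subsetI)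
    fix \<omega> assume "\<omega> \<in> {\<omega>\<in>space M. \<exists>k\<le>n. e \<le> \<bar>T k \<omega>\<bar>}"
    then have "\<omega> \<in> space M" "\<not> act n \<omega>" by (auto simp: act_def not_less)
    then have "pow32 e \<le> pow32 (R n \<omega>)" using R[of n \<omega>] e by (intro pow32_mono) auto
    with \<open>\<omega> \<in> space M\<close> show "\<omega> \<in> {\<omega>\<in>space M. pow32 e \<le> pow32 (R n \<omega>)}" by simp
  qed measurable
  also have "\<dots> \<le> (LINT \<omega>|M. pow32 (R n \<omega>)) / pow32 e"
    using ER[of n] e by (intro integral_Markov_inequality_measure[where A = "{}"]) (auto simp: pow32_def)
  also have "\<dots> \<le> 3 * (\<Sum>i<n. LINT \<omega>|M. pow32 (D (m + i) \<omega>)) / pow32 e"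
    using ER[of n] e by (intro divide_right_mono) auto
  finally show ?thesis by (simp only: T_def)
qed

theorem mart_diff_convergent:
  assumes D: "mart_diff D" and int: "\<And>n. integrable M (\<lambda>\<omega>. pow32 (D n \<omega>))"
    and bound: "\<And>n. (\<Sum>i<n. LINT \<omega>|M. pow32 (D i \<omega>)) \<le> C"
  shows "AE \<omega> in M. convergent (\<lambda>n. \<Sum>i<n. D i \<omega>)"
proof -
  define a where "a i = (LINT \<omega>|M. pow32 (D i \<omega>))" for i
  have a: "0 \<le> a i" for i by (simp add: a_def)
  have sa: "summable a" proof (rule bounded_imp_summable[OF a])
    show "(\<Sum>i\<le>n. a i) \<le> C" for n
      using bound[of "Suc n"] by (simp add: a_def lessThan_Suc_atMost)
  qed
  define Tm where "Tm m k \<omega> = (\<Sum>i<k. D (m + i) \<omega>)" for m k \<omega>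
  have DM [measurable]: "D n \<in> borel_measurable M" for n
    using D measurable_F_M by (auto simp: mart_diff_def)
  have [measurable]: "Tm m k \<in> borel_measurable M" for m k unfolding Tm_def[abs_def] by measurable
  have close: "AE \<omega> in M. \<exists>m. \<forall>k. \<bar>Tm m k \<omega>\<bar> < e" if e: "0 < e" for e
  proof -
    define Bad where "Bad m = {\<omega>\<in>space M. \<exists>k. e \<le> \<bar>Tm m k \<omega>\<bar>}" for m
    have [measurable]: "Bad m \<in> sets M" for m unfolding Bad_def by measurable
    have Bad_le: "prob (Bad m) \<le> 3 * (\<Sum>i. a (m + i)) / pow32 e" for m
    proof -
      define E where "E n = {\<omega>\<in>space M. \<exists>k\<le>n. e \<le> \<bar>Tm m k \<omega>\<bar>}" for n
      have "(\<lambda>n. prob (E n)) \<longlonglongrightarrow> prob (\<Union>n. E n)"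
        by (intro finite_Lim_measure_incseq) (auto simp: E_def incseq_def intro: order_trans)
      moreover have "(\<Union>n. E n) = Bad m" by (auto simp: E_def Bad_def)
      moreover have "prob (E n) \<le> 3 * (\<Sum>i. a (m + i)) / pow32 e" for n
      proof -
        have "prob (E n) \<le> 3 * (\<Sum>i<n. a (m + i)) / pow32 e"
          unfolding E_def Tm_def a_def by (rule mart_diff_maximal[OF D int e])
        also have "\<dots> \<le> 3 * (\<Sum>i. a (m + i)) / pow32 e"
        proof -
          have "summable (\<lambda>i. a (m + i))" using sa summable_iff_shift[of a m] by (simp add: add.commute)
          then have "(\<Sum>i<n. a (m + i)) \<le> (\<Sum>i. a (m + i))" by (rule sum_le_suminf) (auto simp: a)
          then show ?thesis by (intro divide_right_mono) auto
        qed
        finally show ?thesis .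
      qed
      ultimately show ?thesis by (auto intro: LIMSEQ_le_const2)
    qed
    have tail: "(\<lambda>m. 3 * (\<Sum>i. a (m + i)) / pow32 e) \<longlonglongrightarrow> 3 * 0 / pow32 e"
      using suminf_exist_split2[OF sa] e
      by (intro tendsto_intros) (auto simp: add.commute pow32_def)
    have "prob (\<Inter>m. Bad m) \<le> 3 * (\<Sum>i. a (m + i)) / pow32 e" for m
      by (rule order_trans[OF finite_measure_mono Bad_le[of m]]) auto
    then have "prob (\<Inter>m. Bad m) \<le> 3 * 0 / pow32 e"
      using tail by (intro LIMSEQ_le_const) auto
    then have "(\<Inter>m. Bad m) \<in> null_sets M"
      by (intro null_setsI) (auto simp: emeasure_eq_measure measure_le_0_iff)
    then show ?thesis
      by (rule AE_I') (auto simp: Bad_def not_less)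
  qed
  have "AE \<omega> in M. \<forall>j. \<exists>m. \<forall>k. \<bar>Tm m k \<omega>\<bar> < inverse (real (Suc j))"
    unfolding AE_all_countable by (intro allI close) simp
  then show ?thesis
  proof (rule AE_mp, intro AE_I2 impI)
    fix \<omega> assume *: "\<forall>j. \<exists>m. \<forall>k. \<bar>Tm m k \<omega>\<bar> < inverse (real (Suc j))"
    have "Cauchy (\<lambda>n. \<Sum>i<n. D i \<omega>)"
    proof (rule metric_CauchyI)
      fix e :: real assume "0 < e"
      then obtain j where j: "inverse (real (Suc j)) < e / 2" using reals_Archimedean[of "e / 2"] by auto
      obtain m where m: "\<And>k. \<bar>Tm m k \<omega>\<bar> < inverse (real (Suc j))" using * by blast
      have split: "(\<Sum>i<n. D i \<omega>) = (\<Sum>i<m. D i \<omega>) + Tm m (n - m) \<omega>" if "n \<ge> m" for n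
        using that
          sum.atLeastLessThan_concat[of 0 m n "\<lambda>i. D i \<omega>"]
          sum.shift_bounds_nat_ivl[of "\<lambda>i. D i \<omega>" 0 m "n - m"]
        by (simp add: Tm_def lessThan_atLeast0 add.commute)
      show "\<exists>M. \<forall>p\<ge>M. \<forall>n\<ge>M. dist (\<Sum>i<p. D i \<omega>) (\<Sum>i<n. D i \<omega>) < e"
      proof (intro exI allI impI)
        fix p n assume "m \<le> p" "m \<le> n"
        then show "dist (\<Sum>i<p. D i \<omega>) (\<Sum>i<n. D i \<omega>) < e"
          using m[of "p - m"] m[of "n - m"] j unfolding split[OF \<open>m \<le> p\<close>] split[OF \<open>m \<le> n\<close>] dist_real_def
          by linarith
      qed
    qed
    then show "convergent (\<lambda>n. \<Sum>i<n. D i \<omega>)" by (rule Cauchy_convergent)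
  qed
qed

end

section \<open>Laws of large numbers\<close>

context nat_filtration
begin

lemma AE_bound_nonneg:
  fixes K :: real
  assumes "AE \<omega> in M. 0 \<le> f \<omega> \<and> f \<omega> \<le> K" shows "0 \<le> K"
proof -
  have "AE \<omega> in M. 0 \<le> K" using assms by eventually_elim simp
  then show ?thesis by simp
qed

lemma integrable_of_pow32:
  assumes [measurable]: "f \<in> borel_measurable M" and i: "integrable M (\<lambda>\<omega>. pow32 (f \<omega>))"
  shows "integrable M f"
proof (rule Bochner_Integration.integrable_bound[of _ "\<lambda>\<omega>. 1 + pow32 (f \<omega>)"])
  show "integrable M (\<lambda>\<omega>. 1 + pow32 (f \<omega>))" using i by simp
  show "AE \<omega> in M. norm (f \<omega>) \<le> norm (1 + pow32 (f \<omega>))"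
    using abs_le_pow32 by (intro AE_I2) (simp add: abs_of_nonneg)
qed simp

lemma integrable_bounded_mult:
  fixes f g :: "'a \<Rightarrow> real"
  assumes f: "integrable M f" and [measurable]: "g \<in> borel_measurable M"
    and b: "AE \<omega> in M. \<bar>g \<omega>\<bar> \<le> K"
  shows "integrable M (\<lambda>\<omega>. g \<omega> * f \<omega>)"
proof (rule Bochner_Integration.integrable_bound[OF integrable_mult_right[OF f, of K]])
  have [measurable]: "f \<in> borel_measurable M" using f by simp
  show "(\<lambda>\<omega>. g \<omega> * f \<omega>) \<in> borel_measurable M" by measurable
  show "AE \<omega> in M. norm (g \<omega> * f \<omega>) \<le> norm (K * f \<omega>)"
    using b by eventually_elim (auto simp: abs_mult intro!: mult_right_mono)
qed

text \<open>A law of large numbers with predictable weights \<open>w n\<close> that control the conditional moments of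
  order \<open>3/2\<close> of the differences.\<close>

theorem mart_diff_lln:
  assumes D: "mart_diff D" and int: "\<And>n. integrable M (\<lambda>\<omega>. pow32 (D n \<omega>))"
    and wF: "\<And>n. w n \<in> borel_measurable (F n)" and w0: "\<And>n \<omega>. 0 \<le> w n \<omega>"
    and wi: "\<And>n. integrable M (w n)" and C: "0 \<le> C"
    and dom: "\<And>n g. g \<in> borel_measurable (F n) \<Longrightarrow> (\<And>\<omega>. 0 \<le> g \<omega> \<and> g \<omega> \<le> 1) \<Longrightarrow>
      (LINT \<omega>|M. g \<omega> * pow32 (D n \<omega>)) \<le> C * (LINT \<omega>|M. g \<omega> * w n \<omega>)"
  shows "AE \<omega> in M. diverges (\<lambda>n. \<Sum>i<n. w i \<omega>) \<longrightarrow>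
    (\<lambda>n. (\<Sum>i<n. D i \<omega>) / (\<Sum>i<n. w i \<omega>)) \<longlonglongrightarrow> 0"
proof -
  define c where "c n \<omega> = 1 / (1 + (\<Sum>j<Suc n. w j \<omega>))" for n \<omega>
  have cF: "c n \<in> borel_measurable (F n)" for n
  proof -
    have [measurable]: "j \<in> {..<Suc n} \<Longrightarrow> w j \<in> borel_measurable (F n)" for j
      by (rule measurable_F_mono[OF _ wF]) auto
    have "(\<lambda>\<omega>. \<Sum>j\<in>{..<Suc n}. w j \<omega>) \<in> borel_measurable (F n)" by (rule borel_measurable_sum) simp
    then show ?thesis unfolding c_def [abs_def] by measurable
  qed
  have c01: "0 \<le> c n \<omega> \<and> c n \<omega> \<le> 1" for n \<omega>
  proof -
    have "0 \<le> (\<Sum>j<Suc n. w j \<omega>)" by (intro sum_nonneg w0)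
    then show ?thesis unfolding c_def by (simp del: sum.lessThan_Suc)
  qed
  have p01: "0 \<le> pow32 (c n \<omega>) \<and> pow32 (c n \<omega>) \<le> 1" for n \<omega>
    using pow32_mono[of "c n \<omega>" 1] c01[of n \<omega>] by (simp add: pow32_def[of 1])
  have pF: "(\<lambda>\<omega>. pow32 (c n \<omega>)) \<in> borel_measurable (F n)" for n
    using cF[of n] by measurable
  have pM [measurable]: "(\<lambda>\<omega>. pow32 (c n \<omega>)) \<in> borel_measurable M" for n
    by (rule measurable_F_M[OF pF])
  have md: "mart_diff (\<lambda>n \<omega>. c n \<omega> * D n \<omega>)"
    by (rule mart_diff_transform[OF D cF, of 1]) (use c01 in simp)
  have pint: "integrable M (\<lambda>\<omega>. pow32 (c n \<omega>) * w n \<omega>)" for n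
    by (rule integrable_bounded_mult[OF wi, of _ 1]) (use p01 in auto)
  have "AE \<omega> in M. convergent (\<lambda>n. \<Sum>i<n. c i \<omega> * D i \<omega>)"
  proof (rule mart_diff_convergent[OF md])
    show "integrable M (\<lambda>\<omega>. pow32 (c n \<omega> * D n \<omega>))" for n
      unfolding pow32_mult by (rule integrable_bounded_mult[OF int, of _ 1]) (use p01 in auto)
    fix n
    have "(\<Sum>i<n. LINT \<omega>|M. pow32 (c i \<omega> * D i \<omega>)) \<le> (\<Sum>i<n. C * (LINT \<omega>|M. pow32 (c i \<omega>) * w i \<omega>))"
      unfolding pow32_mult by (intro sum_mono dom pF p01)
    also have "\<dots> = C * (LINT \<omega>|M. (\<Sum>i<n. pow32 (c i \<omega>) * w i \<omega>))"
      by (simp add: sum_distrib_left pint)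
    also have "\<dots> \<le> C * (LINT \<omega>|M. 2)"
    proof (intro mult_left_mono[OF _ C] integral_mono)
      fix \<omega>
      show "(\<Sum>i<n. pow32 (c i \<omega>) * w i \<omega>) \<le> 2"
        using sum_div_pow32_le[of "\<lambda>i. w i \<omega>" n] w0 by (simp add: c_def mult.commute)
    qed (use pint in auto)
    also have "\<dots> = 2 * C" by (simp add: prob_space)
    finally show "(\<Sum>i<n. LINT \<omega>|M. pow32 (c i \<omega> * D i \<omega>)) \<le> 2 * C" .
  qed
  then show ?thesis
  proof eventually_elim
    case (elim \<omega>)
    then show ?case
      using kronecker[of "\<lambda>i. w i \<omega>" "\<lambda>i. D i \<omega>"] w0 by (auto simp: c_def)
  qed
qed

lemma mart_diff_cond_exp:
  assumes YF: "\<And>n. Y n \<in> borel_measurable (F (Suc n))" and Yi: "\<And>n. integrable M (Y n)"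
  shows "mart_diff (\<lambda>n \<omega>. Y n \<omega> - real_cond_exp M (F n) (Y n) \<omega>)"
  unfolding mart_diff_def
proof (intro allI conjI impI)
  fix n
  interpret S: finite_measure_subalgebra M "F n" by (rule finite_measure_subalgebra_F)
  have cF: "real_cond_exp M (F n) (Y n) \<in> borel_measurable (F n)" by simp
  have "real_cond_exp M (F n) (Y n) \<in> borel_measurable (F (Suc n))"
    by (rule measurable_F_mono[OF _ cF]) simp
  then show "(\<lambda>\<omega>. Y n \<omega> - real_cond_exp M (F n) (Y n) \<omega>) \<in> borel_measurable (F (Suc n))"
    using YF[of n] by measurable
  show "integrable M (\<lambda>\<omega>. Y n \<omega> - real_cond_exp M (F n) (Y n) \<omega>)"
    by (intro Bochner_Integration.integrable_diff Yi S.real_cond_exp_int)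
  fix g :: "'a \<Rightarrow> real" and K assume g: "g \<in> borel_measurable (F n)" "\<forall>\<omega>. \<bar>g \<omega>\<bar> \<le> K"
  have [measurable]: "g \<in> borel_measurable M" by (rule measurable_F_M[OF g(1)])
  have YM: "Y n \<in> borel_measurable M" using Yi by simp
  have gY: "integrable M (\<lambda>\<omega>. g \<omega> * Y n \<omega>)"
    by (rule integrable_bounded_mult[OF Yi]) (use g in auto)
  show "(LINT \<omega>|M. g \<omega> * (Y n \<omega> - real_cond_exp M (F n) (Y n) \<omega>)) = 0"
    using S.real_cond_exp_intg[OF gY g(1) YM] gY by (simp add: right_diff_distrib)
qed

lemma cond_exp_bounded:
  assumes Yi: "integrable M Y" and Yb: "AE \<omega> in M. 0 \<le> Y \<omega> \<and> Y \<omega> \<le> K"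
  shows "AE \<omega> in M. 0 \<le> real_cond_exp M (F n) Y \<omega> \<and> real_cond_exp M (F n) Y \<omega> \<le> K"
proof -
  interpret S: finite_measure_subalgebra M "F n" by (rule finite_measure_subalgebra_F)
  have "AE \<omega> in M. 0 \<le> real_cond_exp M (F n) Y \<omega>"
    by (rule S.real_cond_exp_ge_c[OF Yi]) (use Yb in auto)
  moreover have "AE \<omega> in M. real_cond_exp M (F n) Y \<omega> \<le> K"
    by (rule S.real_cond_exp_le_c[OF Yi]) (use Yb in auto)
  ultimately show ?thesis by eventually_elim simp
qed

text \<open>The conditional moment of order \<open>3/2\<close> of the deviation of a variable with values in \<open>{0..K}\<close> from its
  conditional mean \<open>a\<close> is at most \<open>2 * sqrt K * a\<close>, so \<open>a\<close> itself can serve as a weight in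
  \<open>mart_diff_lln\<close>.\<close>

lemma cond_exp_deviation:
  fixes n :: nat
  assumes Yi: "integrable M Y" and Yb: "AE \<omega> in M. 0 \<le> Y \<omega> \<and> Y \<omega> \<le> K"
  defines "a \<equiv> real_cond_exp M (F n) Y"
  shows "integrable M (\<lambda>\<omega>. pow32 (Y \<omega> - a \<omega>))"
    and "\<And>g. g \<in> borel_measurable (F n) \<Longrightarrow> (\<And>\<omega>. 0 \<le> g \<omega> \<and> g \<omega> \<le> 1) \<Longrightarrow>
      (LINT \<omega>|M. g \<omega> * pow32 (Y \<omega> - a \<omega>)) \<le> 2 * sqrt K * (LINT \<omega>|M. g \<omega> * a \<omega>)"
proof -
  interpret S: finite_measure_subalgebra M "F n" by (rule finite_measure_subalgebra_F)
  have [measurable]: "Y \<in> borel_measurable M" using Yi by simp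
  have ai: "integrable M a" unfolding a_def by (rule S.real_cond_exp_int[OF Yi])
  then have [measurable]: "a \<in> borel_measurable M" by simp
  have ab: "AE \<omega> in M. 0 \<le> a \<omega> \<and> a \<omega> \<le> K" unfolding a_def by (rule cond_exp_bounded[OF Yi Yb])
  have le: "AE \<omega> in M. pow32 (Y \<omega> - a \<omega>) \<le> sqrt K * Y \<omega> + sqrt K * a \<omega>"
    using Yb ab
  proof eventually_elim
    case (elim \<omega>)
    have "pow32 (Y \<omega> - a \<omega>) \<le> pow32 (Y \<omega>) + pow32 (a \<omega>)" using elim by (intro pow32_diff_le) auto
    also have "\<dots> \<le> sqrt K * Y \<omega> + sqrt K * a \<omega>" using elim by (intro add_mono pow32_le_linear) auto
    finally show ?case .
  qed
  show int: "integrable M (\<lambda>\<omega>. pow32 (Y \<omega> - a \<omega>))"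
    by (rule Bochner_Integration.integrable_bound[of _ "\<lambda>\<omega>. sqrt K * Y \<omega> + sqrt K * a \<omega>"])
      (use Yi ai le in \<open>auto elim!: eventually_mono\<close>)
  fix g assume gF: "g \<in> borel_measurable (F n)" and g: "\<And>\<omega>. 0 \<le> g \<omega> \<and> g \<omega> \<le> (1::real)"
  have gM [measurable]: "g \<in> borel_measurable M" by (rule measurable_F_M[OF gF])
  have gi: "integrable M (\<lambda>\<omega>. g \<omega> * f \<omega>)" if "integrable M f" for f :: "'a \<Rightarrow> real"
    by (rule integrable_bounded_mult[OF that, of _ 1]) (use g in auto)
  have "(LINT \<omega>|M. g \<omega> * pow32 (Y \<omega> - a \<omega>))
      \<le> (LINT \<omega>|M. sqrt K * (g \<omega> * Y \<omega>) + sqrt K * (g \<omega> * a \<omega>))"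
  proof (rule integral_mono_AE)
    show "AE \<omega> in M. g \<omega> * pow32 (Y \<omega> - a \<omega>) \<le> sqrt K * (g \<omega> * Y \<omega>) + sqrt K * (g \<omega> * a \<omega>)"
      using le
    proof eventually_elim
      case (elim \<omega>)
      then have "g \<omega> * pow32 (Y \<omega> - a \<omega>) \<le> g \<omega> * (sqrt K * Y \<omega> + sqrt K * a \<omega>)"
        using g by (intro mult_left_mono) auto
      then show ?case by (simp add: algebra_simps)
    qed
  qed (use gi[OF int] gi[OF Yi] gi[OF ai] in auto)
  also have "\<dots> = sqrt K * (LINT \<omega>|M. g \<omega> * Y \<omega>) + sqrt K * (LINT \<omega>|M. g \<omega> * a \<omega>)"
    using gi[OF Yi] gi[OF ai] by simp
  also have "(LINT \<omega>|M. g \<omega> * Y \<omega>) = (LINT \<omega>|M. g \<omega> * a \<omega>)"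
    unfolding a_def by (rule S.real_cond_exp_intg(2)[symmetric, OF gi[OF Yi] gF]) simp
  finally show "(LINT \<omega>|M. g \<omega> * pow32 (Y \<omega> - a \<omega>)) \<le> 2 * sqrt K * (LINT \<omega>|M. g \<omega> * a \<omega>)" by simp
qed

theorem average_tendsto:
  assumes YF: "\<And>n. Y n \<in> borel_measurable (F (Suc n))"
    and Yb: "\<And>n. AE \<omega> in M. 0 \<le> Y n \<omega> \<and> Y n \<omega> \<le> K"
    and lim: "AE \<omega> in M. (\<lambda>n. real_cond_exp M (F n) (Y n) \<omega>) \<longlonglongrightarrow> L \<omega>"
  shows "AE \<omega> in M. (\<lambda>n. (\<Sum>i<n. Y i \<omega>) / real n) \<longlonglongrightarrow> L \<omega>"
proof -
  have [measurable]: "Y n \<in> borel_measurable M" for n by (rule measurable_F_M[OF YF])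
  have Yi: "integrable M (Y n)" for n
    by (rule integrable_const_bound[of _ K]) (use Yb[of n] in auto)
  have K: "0 \<le> K" by (rule AE_bound_nonneg[OF Yb[of 0]])
  let ?a = "\<lambda>n. real_cond_exp M (F n) (Y n)"
  have "AE \<omega> in M. diverges (\<lambda>n. \<Sum>i<n. 1::real) \<longrightarrow>
      (\<lambda>n. (\<Sum>i<n. Y i \<omega> - ?a i \<omega>) / (\<Sum>i<n. 1)) \<longlonglongrightarrow> 0"
  proof (rule mart_diff_lln[OF mart_diff_cond_exp[OF YF Yi]])
    show "integrable M (\<lambda>\<omega>. pow32 (Y n \<omega> - ?a n \<omega>))" for n
      by (rule cond_exp_deviation[OF Yi Yb])
    show "0 \<le> 2 * sqrt K * K" using K by simp
    fix n g assume gF: "g \<in> borel_measurable (F n)" and g: "\<And>\<omega>. 0 \<le> g \<omega> \<and> g \<omega> \<le> (1::real)"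
    interpret S: finite_measure_subalgebra M "F n" by (rule finite_measure_subalgebra_F)
    have gM [measurable]: "g \<in> borel_measurable M" by (rule measurable_F_M[OF gF])
    have gi: "integrable M (\<lambda>\<omega>. g \<omega> * f \<omega>)" if "integrable M f" for f :: "'a \<Rightarrow> real"
      by (rule integrable_bounded_mult[OF that, of _ 1]) (use g in auto)
    have "(LINT \<omega>|M. g \<omega> * pow32 (Y n \<omega> - ?a n \<omega>)) \<le> 2 * sqrt K * (LINT \<omega>|M. g \<omega> * ?a n \<omega>)"
      by (rule cond_exp_deviation(2)[OF Yi Yb gF g])
    also have "(LINT \<omega>|M. g \<omega> * ?a n \<omega>) \<le> (LINT \<omega>|M. K * (g \<omega> * 1))"
    proof (rule integral_mono_AE)
      show "AE \<omega> in M. g \<omega> * ?a n \<omega> \<le> K * (g \<omega> * 1)"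
        using cond_exp_bounded[OF Yi[of n] Yb, of n]
      proof eventually_elim
        case (elim \<omega>)
        then show ?case using mult_left_mono[of "?a n \<omega>" K "g \<omega>"] g by (simp add: mult.commute)
      qed
    qed (use gi[OF S.real_cond_exp_int(1)[OF Yi]] gi[of "\<lambda>_. 1"] in auto)
    finally show "(LINT \<omega>|M. g \<omega> * pow32 (Y n \<omega> - ?a n \<omega>)) \<le> 2 * sqrt K * K * (LINT \<omega>|M. g \<omega> * 1)"
      using K by (simp add: mult_left_mono)
  qed auto
  then show ?thesis using lim
  proof eventually_elim
    case (elim \<omega>)
    have W: "diverges (\<lambda>n. \<Sum>i<n. 1::real)"
      by (simp add: filterlim_real_sequentially)
    have "(\<lambda>n. (\<Sum>i<n. Y i \<omega> - ?a i \<omega>) / (\<Sum>i<n. 1) + (\<Sum>i<n. 1 * ?a i \<omega>) / (\<Sum>i<n. 1)) \<longlonglongrightarrow> 0 + L \<omega>"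
      using elim W by (intro tendsto_add toeplitz) auto
    then show ?case by (simp add: sum_subtractf add_divide_distrib[symmetric])
  qed
qed

text \<open>The divergent half of the conditional Borel--Cantelli lemma, for bounded nonnegative variables in
  place of events.\<close>

theorem cond_borel_cantelli:
  assumes YF: "\<And>n. Y n \<in> borel_measurable (F (Suc n))"
    and Yb: "\<And>n. AE \<omega> in M. 0 \<le> Y n \<omega> \<and> Y n \<omega> \<le> K"
  shows "AE \<omega> in M. diverges (\<lambda>n. \<Sum>i<n. real_cond_exp M (F i) (Y i) \<omega>) \<longrightarrow>
    diverges (\<lambda>n. \<Sum>i<n. Y i \<omega>)"
proof -
  have [measurable]: "Y n \<in> borel_measurable M" for n by (rule measurable_F_M[OF YF])
  have Yi: "integrable M (Y n)" for n
    by (rule integrable_const_bound[of _ K]) (use Yb[of n] in auto)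
  have K: "0 \<le> K" by (rule AE_bound_nonneg[OF Yb[of 0]])
  let ?a = "\<lambda>n. real_cond_exp M (F n) (Y n)"
  have ab: "AE \<omega> in M. \<forall>n. 0 \<le> ?a n \<omega>"
    unfolding AE_all_countable using cond_exp_bounded[OF Yi Yb] by auto
  have ai: "integrable M (?a n)" for n
  proof -
    interpret S: finite_measure_subalgebra M "F n" by (rule finite_measure_subalgebra_F)
    show ?thesis by (rule S.real_cond_exp_int[OF Yi])
  qed
  \<comment> \<open>the conditional means are nonnegative only almost surely; weights must be nonnegative everywhere\<close>
  have "AE \<omega> in M. diverges (\<lambda>n. \<Sum>i<n. max 0 (?a i \<omega>)) \<longrightarrow>
      (\<lambda>n. (\<Sum>i<n. Y i \<omega> - ?a i \<omega>) / (\<Sum>i<n. max 0 (?a i \<omega>))) \<longlonglongrightarrow> 0"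
  proof (rule mart_diff_lln[OF mart_diff_cond_exp[OF YF Yi]])
    show "integrable M (\<lambda>\<omega>. pow32 (Y n \<omega> - ?a n \<omega>))" for n
      by (rule cond_exp_deviation[OF Yi Yb])
    show "0 \<le> 2 * sqrt K" using K by simp
    show "integrable M (\<lambda>\<omega>. max 0 (?a n \<omega>))" for n using ai by simp
    show "(\<lambda>\<omega>. max 0 (?a n \<omega>)) \<in> borel_measurable (F n)" for n by simp
    fix n g assume gF: "g \<in> borel_measurable (F n)" and g: "\<And>\<omega>. 0 \<le> g \<omega> \<and> g \<omega> \<le> (1::real)"
    have gM [measurable]: "g \<in> borel_measurable M" by (rule measurable_F_M[OF gF])
    have [measurable]: "?a n \<in> borel_measurable M" using ai[of n] by simp
    have "(LINT \<omega>|M. g \<omega> * pow32 (Y n \<omega> - ?a n \<omega>)) \<le> 2 * sqrt K * (LINT \<omega>|M. g \<omega> * ?a n \<omega>)"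
      by (rule cond_exp_deviation(2)[OF Yi Yb gF g])
    also have "(LINT \<omega>|M. g \<omega> * ?a n \<omega>) = (LINT \<omega>|M. g \<omega> * max 0 (?a n \<omega>))"
      by (rule integral_cong_AE) (use ab in \<open>auto elim!: eventually_mono\<close>)
    finally show "(LINT \<omega>|M. g \<omega> * pow32 (Y n \<omega> - ?a n \<omega>))
      \<le> 2 * sqrt K * (LINT \<omega>|M. g \<omega> * max 0 (?a n \<omega>))" .
  qed auto
  then show ?thesis using ab
  proof eventually_elim
    case (elim \<omega>)
    show ?case
    proof
      assume W: "diverges (\<lambda>n. \<Sum>i<n. ?a i \<omega>)"
      have m: "max 0 (?a i \<omega>) = ?a i \<omega>" for i using elim(2) by simp
      have "(\<lambda>n. (\<Sum>i<n. Y i \<omega> - ?a i \<omega>) / (\<Sum>i<n. ?a i \<omega>) + 1) \<longlonglongrightarrow> 0 + 1"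
        using elim(1) W unfolding m by (intro tendsto_intros) auto
      then have l: "(\<lambda>n. (\<Sum>i<n. Y i \<omega> - ?a i \<omega>) / (\<Sum>i<n. ?a i \<omega>) + 1) \<longlonglongrightarrow> 1" by simp
      have "diverges (\<lambda>n. ((\<Sum>i<n. Y i \<omega> - ?a i \<omega>) / (\<Sum>i<n. ?a i \<omega>) + 1) * (\<Sum>i<n. ?a i \<omega>))"
        by (rule filterlim_tendsto_pos_mult_at_top[OF l _ W]) simp
      moreover have "eventually (\<lambda>n. (\<Sum>i<n. ?a i \<omega>) > 0) sequentially"
        using W unfolding filterlim_at_top_dense by blast
      then have "eventually (\<lambda>n. ((\<Sum>i<n. Y i \<omega> - ?a i \<omega>) / (\<Sum>i<n. ?a i \<omega>) + 1) * (\<Sum>i<n. ?a i \<omega>)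
          = (\<Sum>i<n. Y i \<omega>)) sequentially"
        by eventually_elim (simp add: field_simps sum_subtractf)
      ultimately show "diverges (\<lambda>n. \<Sum>i<n. Y i \<omega>)"
        by (simp add: filterlim_cong)
    qed
  qed
qed

text \<open>A strong law for weighted averages with random weights \<open>w n\<close>, where \<open>Y n\<close> is independent of
  everything known at time \<open>n\<close>, the weight included. Independence is required only in the form in
  which it is used.\<close>

theorem weighted_slln:
  assumes wF: "\<And>n. w n \<in> borel_measurable (F n)"
    and wb: "\<And>n. AE \<omega> in M. 0 \<le> w n \<omega> \<and> w n \<omega> \<le> K"
    and YF: "\<And>n. Y n \<in> borel_measurable (F (Suc n))"
    and Y0: "\<And>n \<omega>. 0 \<le> Y n \<omega>"
    and Yi: "\<And>n. integrable M (\<lambda>\<omega>. pow32 (Y n \<omega>))"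
    and YC: "\<And>n. (LINT \<omega>|M. pow32 (Y n \<omega>)) \<le> C"
    and ind: "\<And>n g B. g \<in> borel_measurable (F n) \<Longrightarrow> (\<And>\<omega>. \<bar>g \<omega>\<bar> \<le> B) \<Longrightarrow>
      (LINT \<omega>|M. g \<omega> * Y n \<omega>) = (LINT \<omega>|M. g \<omega>) * (LINT \<omega>|M. Y n \<omega>) \<and>
      (LINT \<omega>|M. g \<omega> * pow32 (Y n \<omega>)) = (LINT \<omega>|M. g \<omega>) * (LINT \<omega>|M. pow32 (Y n \<omega>))"
    and lim: "(\<lambda>n. LINT \<omega>|M. Y n \<omega>) \<longlonglongrightarrow> y"
  shows "AE \<omega> in M. diverges (\<lambda>n. \<Sum>i<n. w i \<omega>) \<longrightarrow>
    (\<lambda>n. (\<Sum>i<n. w i \<omega> * Y i \<omega>) / (\<Sum>i<n. w i \<omega>)) \<longlonglongrightarrow> y"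
proof -
  have [measurable]: "Y n \<in> borel_measurable M" for n by (rule measurable_F_M[OF YF])
  have K: "0 \<le> K" by (rule AE_bound_nonneg[OF wb[of 0]])
  \<comment> \<open>the weights are bounded only almost surely; truncation makes the bounds hold everywhere\<close>
  define v where "v n \<omega> = max 0 (min K (w n \<omega>))" for n \<omega>
  have v: "0 \<le> v n \<omega>" "v n \<omega> \<le> K" for n \<omega> using K by (auto simp: v_def)
  have vF: "v n \<in> borel_measurable (F n)" for n using wF[of n] unfolding v_def [abs_def] by measurable
  have [measurable]: "v n \<in> borel_measurable M" for n by (rule measurable_F_M[OF vF])
  have vw: "AE \<omega> in M. \<forall>n. v n \<omega> = w n \<omega>"
    unfolding AE_all_countable
  proof
    fix n show "AE \<omega> in M. v n \<omega> = w n \<omega>" using wb[of n] by eventually_elim (simp add: v_def)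
  qed
  have vi: "integrable M (v n)" for n
    by (rule integrable_const_bound[of _ K]) (use v in auto)
  define e where "e n = (LINT \<omega>|M. Y n \<omega>)" for n
  have Yi1: "integrable M (Y n)" for n by (rule integrable_of_pow32) (simp_all add: Yi)
  have e0: "0 \<le> e n" for n unfolding e_def by (rule Bochner_Integration.integral_nonneg) (simp add: Y0)
  have eC: "e n \<le> 1 + C" for n
  proof -
    have "e n \<le> (LINT \<omega>|M. 1 + pow32 (Y n \<omega>))"
      unfolding e_def using abs_le_pow32 Y0 Yi Yi1
      by (intro integral_mono) (auto intro: order_trans[OF abs_ge_self])
    also have "\<dots> \<le> 1 + C" using YC[of n] Yi by (simp add: prob_space)
    finally show ?thesis .
  qed
  have "0 \<le> (LINT \<omega>|M. pow32 (Y 0 \<omega>))" by (rule Bochner_Integration.integral_nonneg) simp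
  then have C0: "0 \<le> C" using YC[of 0] by linarith
  have Dmart: "mart_diff (\<lambda>n \<omega>. Y n \<omega> - e n)"
    unfolding mart_diff_def
  proof (intro allI conjI impI)
    fix n
    show "(\<lambda>\<omega>. Y n \<omega> - e n) \<in> borel_measurable (F (Suc n))" using YF[of n] by measurable
    show "integrable M (\<lambda>\<omega>. Y n \<omega> - e n)" using Yi1 by simp
    fix g :: "'a \<Rightarrow> real" and B assume g: "g \<in> borel_measurable (F n)" "\<forall>\<omega>. \<bar>g \<omega>\<bar> \<le> B"
    have [measurable]: "g \<in> borel_measurable M" by (rule measurable_F_M[OF g(1)])
    have gY: "integrable M (\<lambda>\<omega>. g \<omega> * Y n \<omega>)"
      by (rule integrable_bounded_mult[OF Yi1]) (use g in auto)
    have gi: "integrable M g"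
      by (rule integrable_const_bound[of _ B]) (use g in auto)
    show "(LINT \<omega>|M. g \<omega> * (Y n \<omega> - e n)) = 0"
      using ind[OF g(1), of B] g(2) gY gi by (simp add: right_diff_distrib e_def)
  qed
  have md: "mart_diff (\<lambda>n \<omega>. v n \<omega> * (Y n \<omega> - e n))"
    by (rule mart_diff_transform[OF Dmart vF, of K]) (use v in auto)
  define C' where "C' = pow32 (1 + C)"
  have le: "pow32 (v n \<omega> * (Y n \<omega> - e n)) \<le> sqrt K * v n \<omega> * (pow32 (Y n \<omega>) + C')" for n \<omega>
  proof -
    have "pow32 (Y n \<omega> - e n) \<le> pow32 (Y n \<omega>) + pow32 (e n)"
      by (rule pow32_diff_le[OF Y0 e0])
    also have "pow32 (e n) \<le> C'"
      unfolding C'_def using e0[of n] eC[of n] by (intro pow32_mono) auto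
    finally have "pow32 (Y n \<omega> - e n) \<le> pow32 (Y n \<omega>) + C'" by simp
    moreover have "pow32 (v n \<omega>) \<le> sqrt K * v n \<omega>" by (intro pow32_le_linear v)
    ultimately show ?thesis unfolding pow32_mult using v K by (intro mult_mono) auto
  qed
  have vYi: "integrable M (\<lambda>\<omega>. (sqrt K * v n \<omega>) * (pow32 (Y n \<omega>) + C'))" for n
    by (rule integrable_bounded_mult[of _ _ "sqrt K * K"])
      (use v K Yi in \<open>auto simp: abs_mult intro!: mult_left_mono\<close>)
  have Dint: "integrable M (\<lambda>\<omega>. pow32 (v n \<omega> * (Y n \<omega> - e n)))" for n
    by (rule Bochner_Integration.integrable_bound[OF vYi[of n]])
      (auto intro!: AE_I2 order_trans[OF le abs_ge_self])
  have "AE \<omega> in M. diverges (\<lambda>n. \<Sum>i<n. v i \<omega>) \<longrightarrow>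
      (\<lambda>n. (\<Sum>i<n. v i \<omega> * (Y i \<omega> - e i)) / (\<Sum>i<n. v i \<omega>)) \<longlonglongrightarrow> 0"
  proof (rule mart_diff_lln[OF md Dint vF v(1) vi])
    show "0 \<le> sqrt K * (C + C')" using K C0 by (simp add: C'_def)
    fix n g assume gF: "g \<in> borel_measurable (F n)" and g: "\<And>\<omega>. 0 \<le> g \<omega> \<and> g \<omega> \<le> (1::real)"
    have gM [measurable]: "g \<in> borel_measurable M" by (rule measurable_F_M[OF gF])
    have gi: "integrable M (\<lambda>\<omega>. g \<omega> * f \<omega>)" if "integrable M f" for f :: "'a \<Rightarrow> real"
      by (rule integrable_bounded_mult[OF that, of _ 1]) (use g in auto)
    have gvF: "(\<lambda>\<omega>. g \<omega> * v n \<omega>) \<in> borel_measurable (F n)" using gF vF[of n] by measurable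
    have gvb: "\<bar>g \<omega> * v n \<omega>\<bar> \<le> 1 * K" for \<omega>
      unfolding abs_mult using g[of \<omega>] v[of n \<omega>] by (intro mult_mono) auto
    have gvY: "integrable M (\<lambda>\<omega>. (g \<omega> * v n \<omega>) * pow32 (Y n \<omega>))"
      by (rule integrable_bounded_mult[OF Yi, of _ "1 * K"]) (use gvb in auto)
    have gv: "integrable M (\<lambda>\<omega>. g \<omega> * v n \<omega>)" by (rule gi[OF vi])
    have gv0: "0 \<le> (LINT \<omega>|M. g \<omega> * v n \<omega>)" by (rule Bochner_Integration.integral_nonneg) (use g v in auto)
    have "(LINT \<omega>|M. g \<omega> * pow32 (v n \<omega> * (Y n \<omega> - e n)))
        \<le> (LINT \<omega>|M. sqrt K * ((g \<omega> * v n \<omega>) * pow32 (Y n \<omega>)) + sqrt K * C' * (g \<omega> * v n \<omega>))"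
    proof (rule integral_mono)
      show "integrable M (\<lambda>\<omega>. g \<omega> * pow32 (v n \<omega> * (Y n \<omega> - e n)))" by (rule gi[OF Dint])
      show "integrable M (\<lambda>\<omega>. sqrt K * ((g \<omega> * v n \<omega>) * pow32 (Y n \<omega>)) + sqrt K * C' * (g \<omega> * v n \<omega>))"
        using gvY gv by (intro Bochner_Integration.integrable_add integrable_mult_right)
      fix \<omega>
      show "g \<omega> * pow32 (v n \<omega> * (Y n \<omega> - e n))
        \<le> sqrt K * ((g \<omega> * v n \<omega>) * pow32 (Y n \<omega>)) + sqrt K * C' * (g \<omega> * v n \<omega>)"
        using mult_left_mono[OF le[of n \<omega>], of "g \<omega>"] g[of \<omega>] by (simp add: algebra_simps)
    qed
    also have "\<dots> = sqrt K * (LINT \<omega>|M. (g \<omega> * v n \<omega>) * pow32 (Y n \<omega>)) + sqrt K * C' * (LINT \<omega>|M. g \<omega> * v n \<omega>)"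
      using gvY gv by simp
    also have "(LINT \<omega>|M. (g \<omega> * v n \<omega>) * pow32 (Y n \<omega>))
        = (LINT \<omega>|M. g \<omega> * v n \<omega>) * (LINT \<omega>|M. pow32 (Y n \<omega>))"
      using ind[OF gvF gvb] by blast
    also have "sqrt K * ((LINT \<omega>|M. g \<omega> * v n \<omega>) * (LINT \<omega>|M. pow32 (Y n \<omega>)))
        \<le> sqrt K * ((LINT \<omega>|M. g \<omega> * v n \<omega>) * C)"
      using K gv0 YC by (intro mult_left_mono) auto
    finally show "(LINT \<omega>|M. g \<omega> * pow32 (v n \<omega> * (Y n \<omega> - e n)))
        \<le> sqrt K * (C + C') * (LINT \<omega>|M. g \<omega> * v n \<omega>)" by (simp add: algebra_simps)
  qed
  then show ?thesis using vw
  proof eventually_elim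
    case (elim \<omega>)
    show ?case
    proof
      assume W: "diverges (\<lambda>n. \<Sum>i<n. w i \<omega>)"
      have W': "diverges (\<lambda>n. \<Sum>i<n. v i \<omega>)" using W elim(2) by simp
      have "(\<lambda>n. (\<Sum>i<n. v i \<omega> * (Y i \<omega> - e i)) / (\<Sum>i<n. v i \<omega>)
          + (\<Sum>i<n. v i \<omega> * e i) / (\<Sum>i<n. v i \<omega>)) \<longlonglongrightarrow> 0 + y"
      proof (rule tendsto_add)
        show "(\<lambda>n. (\<Sum>i<n. v i \<omega> * (Y i \<omega> - e i)) / (\<Sum>i<n. v i \<omega>)) \<longlonglongrightarrow> 0"
          using elim(1) W' by blast
        show "(\<lambda>n. (\<Sum>i<n. v i \<omega> * e i) / (\<Sum>i<n. v i \<omega>)) \<longlonglongrightarrow> y"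
          using lim by (intro toeplitz v W') (simp add: e_def)
      qed
      then show "(\<lambda>n. (\<Sum>i<n. w i \<omega> * Y i \<omega>) / (\<Sum>i<n. w i \<omega>)) \<longlonglongrightarrow> y"
        using elim(2) by (simp add: add_divide_distrib[symmetric] sum.distrib[symmetric] algebra_simps)
    qed
  qed
qed

end

lemma (in prob_space) AE_summable_of_bounded_integrals:
  fixes f :: "nat \<Rightarrow> 'a \<Rightarrow> real"
  assumes f0: "\<And>n \<omega>. 0 \<le> f n \<omega>" and fi: "\<And>n. integrable M (f n)"
    and C: "\<And>n. (\<Sum>i<n. LINT \<omega>|M. f i \<omega>) \<le> C"
  shows "AE \<omega> in M. summable (\<lambda>n. f n \<omega>)"
proof -
  have [measurable]: "f n \<in> borel_measurable M" for n using fi by simp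
  have "(\<integral>\<^sup>+\<omega>. (\<Sum>n. ennreal (f n \<omega>)) \<partial>M) = (\<Sum>n. \<integral>\<^sup>+\<omega>. ennreal (f n \<omega>) \<partial>M)"
    by (rule nn_integral_suminf) simp
  also have "\<dots> = (\<Sum>n. ennreal (LINT \<omega>|M. f n \<omega>))"
    using f0 fi by (simp add: nn_integral_eq_integral)
  also have "\<dots> \<le> ennreal C"
  proof (rule suminf_le_const[OF summableI])
    fix n
    have "(\<Sum>i<n. ennreal (LINT \<omega>|M. f i \<omega>)) = ennreal (\<Sum>i<n. LINT \<omega>|M. f i \<omega>)"
      using f0 by (intro sum_ennreal Bochner_Integration.integral_nonneg)
    also have "\<dots> \<le> ennreal C" by (intro ennreal_leI C)
    finally show "(\<Sum>i<n. ennreal (LINT \<omega>|M. f i \<omega>)) \<le> ennreal C" .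
  qed
  finally have "(\<integral>\<^sup>+\<omega>. (\<Sum>n. ennreal (f n \<omega>)) \<partial>M) \<noteq> \<infinity>" by (auto simp: top_unique)
  then have "AE \<omega> in M. (\<Sum>n. ennreal (f n \<omega>)) \<noteq> \<infinity>" by (intro nn_integral_PInf_AE) auto
  then show ?thesis by eventually_elim (intro summable_suminf_not_top f0, simp)
qed

section \<open>Factorial moments of the multivariate hypergeometric distribution\<close>

lemma sum_PiE_insert:
  fixes f :: "('b \<Rightarrow> 'c) \<Rightarrow> 'd::comm_monoid_add"
  assumes "a \<notin> I"
  shows "(\<Sum>x\<in>PiE (insert a I) T. f x) = (\<Sum>y\<in>T a. \<Sum>x\<in>PiE I T. f (x(a := y)))"
proof -
  have "(\<Sum>x\<in>PiE (insert a I) T. f x) = (\<Sum>(y, x)\<in>T a \<times> PiE I T. f (x(a := y)))"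
    unfolding PiE_insert_eq using assms
    by (subst sum.reindex) (auto intro!: inj_combinator sum.cong)
  then show ?thesis by (simp add: sum.cartesian_product)
qed

text \<open>Vandermonde's identity for two coefficient sequences of the form \<open>x ^ e * (1 + x) ^ h\<close>.\<close>

lemma vandermonde_shifted:
  fixes c e h H r :: nat
  assumes "r \<le> c"
  shows "(\<Sum>y\<le>c. (if e \<le> y then h choose (y - e) else 0) *
      (if y \<le> r \<and> E \<le> r - y then H choose (r - y - E) else 0))
    = (if e + E \<le> r then (h + H) choose (r - (e + E)) else 0)"
proof (cases "e + E \<le> r")
  case True
  define p where "p = r - (e + E)"
  have r: "r = p + e + E" using True by (simp add: p_def)
  have "(\<Sum>y\<le>c. (if e \<le> y then h choose (y - e) else 0) *
      (if y \<le> r \<and> E \<le> r - y then H choose (r - y - E) else 0))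
    = (\<Sum>y\<in>{e..p + e}. (h choose (y - e)) * (H choose (p + e - y)))"
    by (rule sum.mono_neutral_cong_right) (use assms r in auto)
  also have "\<dots> = (\<Sum>j\<in>{0..p}. (h choose j) * (H choose (p - j)))"
    using sum.shift_bounds_cl_nat_ivl[of "\<lambda>y. (h choose (y - e)) * (H choose (p + e - y))" 0 e p] by simp
  also have "\<dots> = (h + H) choose p" by (simp add: atLeast0AtMost vandermonde)
  finally show ?thesis using True by (simp add: p_def)
next
  case False
  then show ?thesis by (auto intro!: sum.neutral)
qed

text \<open>Vandermonde's identity for several factors \<open>x ^ e k * (1 + x) ^ h k\<close>. The arguments are restricted
  to \<open>{..c}\<close> only to make the index set finite; this loses nothing since \<open>r \<le> c\<close>.\<close>

lemma multi_vandermonde: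
  fixes e h :: "'b \<Rightarrow> nat"
  assumes "finite I" "r \<le> c"
  shows "(\<Sum>x\<in>PiE I (\<lambda>_. {..c}). if sum x I = r
      then \<Prod>k\<in>I. if e k \<le> x k then h k choose (x k - e k) else 0 else 0)
    = (if sum e I \<le> r then sum h I choose (r - sum e I) else 0)"
  using assms
proof (induction I arbitrary: r rule: finite_induct)
  case empty
  then show ?case by (cases r) (simp_all add: PiE_empty_domain)
next
  case (insert a I)
  let ?g = "\<lambda>k y. if e k \<le> y then h k choose (y - e k) else 0"
  have *: "(if sum (x(a := y)) (insert a I) = r then \<Prod>k\<in>insert a I. ?g k ((x(a := y)) k) else 0)
    = ?g a y * (if y \<le> r then if sum x I = r - y then \<Prod>k\<in>I. ?g k (x k) else 0 else 0)" for x y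
  proof -
    have 1: "sum (x(a := y)) I = sum x I" "(\<Prod>k\<in>I. ?g k ((x(a := y)) k)) = (\<Prod>k\<in>I. ?g k (x k))"
      using insert.hyps by (auto intro!: sum.cong prod.cong)
    have 2: "sum (x(a := y)) (insert a I) = y + sum x I"
      "(\<Prod>k\<in>insert a I. ?g k ((x(a := y)) k)) = ?g a y * (\<Prod>k\<in>I. ?g k (x k))"
      using insert.hyps 1 by simp_all
    show ?thesis unfolding 2 by auto
  qed
  have "(\<Sum>x\<in>PiE (insert a I) (\<lambda>_. {..c}). if sum x (insert a I) = r
      then \<Prod>k\<in>insert a I. ?g k (x k) else 0)
    = (\<Sum>y\<le>c. ?g a y * (\<Sum>x\<in>PiE I (\<lambda>_. {..c}).
        if y \<le> r then if sum x I = r - y then \<Prod>k\<in>I. ?g k (x k) else 0 else 0))"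
    by (simp only: sum_PiE_insert[OF insert.hyps(2)] * sum_distrib_left)
  also have "\<dots> = (\<Sum>y\<le>c. ?g a y * (if y \<le> r \<and> sum e I \<le> r - y
      then sum h I choose (r - y - sum e I) else 0))"
  proof (intro sum.cong refl arg_cong2[where f = "(*)"])
    fix y
    show "(\<Sum>x\<in>PiE I (\<lambda>_. {..c}). if y \<le> r then if sum x I = r - y
        then \<Prod>k\<in>I. ?g k (x k) else 0 else 0)
      = (if y \<le> r \<and> sum e I \<le> r - y then sum h I choose (r - y - sum e I) else 0)"
      using insert.IH[of "r - y"] insert.prems by (cases "y \<le> r") simp_all
  qed
  also have "\<dots> = (if e a + sum e I \<le> r then (h a + sum h I) choose (r - (e a + sum e I)) else 0)"
    by (rule vandermonde_shifted[OF insert.prems])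
  finally show ?case using insert.hyps by simp
qed

text \<open>The mean of the product of the coordinates in \<open>K\<close>. By \<open>y * (h choose y) = h * ((h - 1) choose (y - 1))\<close>,
  each factor lowers one population size by one and shifts the corresponding coordinate.\<close>

lemma mv_hypergeometric_factorial_moment:
  fixes h :: "nat \<Rightarrow> nat"
  assumes K: "K \<subseteq> {1..d}" and h: "\<And>k. k \<in> {1..d} \<Longrightarrow> 0 < h k"
    and s: "s = (\<Sum>k=1..d. h k)" and r: "r \<le> c"
  shows "(\<Sum>x\<in>PiE {1..d} (\<lambda>_. {..c}). (\<Prod>k\<in>K. real (x k)) * mv_hypergeometric d s r h x)
    = (\<Prod>k\<in>K. real (h k)) * real (if card K \<le> r then (s - card K) choose (r - card K) else 0)
      / real (s choose r)"
proof -
  define e where "e k = (if k \<in> K then 1 else 0 :: nat)" for k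
  define h' where "h' k = h k - e k" for k
  have fK: "finite K" using K finite_subset by blast
  have se: "sum e {1..d} = card K"
  proof -
    have "sum e {1..d} = (\<Sum>k\<in>{1..d} \<inter> K. 1)" unfolding e_def by (subst sum.inter_restrict) auto
    also have "{1..d} \<inter> K = K" using K by auto
    finally show ?thesis by simp
  qed
  have "sum h' {1..d} + sum e {1..d} = s"
    unfolding s sum.distrib[symmetric]
  proof (rule sum.cong)
    fix k assume "k \<in> {1..d}"
    then show "h' k + e k = h k" using h[of k] by (simp add: h'_def e_def)
  qed simp
  then have sh: "sum h' {1..d} = s - card K" using se by simp
  have pt: "(\<Prod>k\<in>K. real (x k)) * mv_hypergeometric d s r h x
    = (\<Prod>k\<in>K. real (h k)) * (real (if sum x {1..d} = r
      then \<Prod>k\<in>{1..d}. if e k \<le> x k then h' k choose (x k - e k) else 0 else 0) / real (s choose r))"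
    for x
  proof -
    have mv: "mv_hypergeometric d s r h x =
      (if sum x {1..d} = r then real (\<Prod>k\<in>{1..d}. h k choose x k) / real (s choose r) else 0)"
    proof (cases "\<forall>k\<in>{1..d}. x k \<le> h k")
      case False
      then obtain k where "k \<in> {1..d}" "h k choose x k = 0" by (auto simp: not_le)
      then have "(\<Prod>k\<in>{1..d}. h k choose x k) = 0" by (intro prod_zero) auto
      then show ?thesis using False by (simp add: mv_hypergeometric_def)
    qed (simp add: mv_hypergeometric_def)
    have "(\<Prod>k\<in>K. x k) * (\<Prod>k\<in>{1..d}. h k choose x k)
        = (\<Prod>k\<in>{1..d}. (if k \<in> K then x k else 1) * (h k choose x k))"
      using K fK by (simp add: prod.distrib prod.inter_restrict[symmetric] Int_absorb1)
    also have "\<dots> = (\<Prod>k\<in>{1..d}. (if k \<in> K then h k else 1) *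
        (if e k \<le> x k then h' k choose (x k - e k) else 0))"
    proof (rule prod.cong)
      fix k assume "k \<in> {1..d}"
      show "(if k \<in> K then x k else 1) * (h k choose x k) = (if k \<in> K then h k else 1) *
        (if e k \<le> x k then h' k choose (x k - e k) else 0)"
        using times_binomial_minus1_eq[of "x k" "h k"] by (cases "x k") (auto simp: e_def h'_def)
    qed simp
    also have "\<dots> = (\<Prod>k\<in>K. h k) * (\<Prod>k\<in>{1..d}. if e k \<le> x k then h' k choose (x k - e k) else 0)"
      using K fK by (simp add: prod.distrib prod.inter_restrict[symmetric] Int_absorb1)
    finally have "real ((\<Prod>k\<in>K. x k) * (\<Prod>k\<in>{1..d}. h k choose x k)) =
        real ((\<Prod>k\<in>K. h k) * (\<Prod>k\<in>{1..d}. if e k \<le> x k then h' k choose (x k - e k) else 0))"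
      by (rule arg_cong)
    then have "(\<Prod>k\<in>K. real (x k)) * real (\<Prod>k\<in>{1..d}. h k choose x k) =
        (\<Prod>k\<in>K. real (h k)) * real (\<Prod>k\<in>{1..d}. if e k \<le> x k then h' k choose (x k - e k) else 0)"
      by (simp only: of_nat_mult of_nat_prod)
    then show ?thesis unfolding mv by (cases "sum x {1..d} = r") (simp_all only: if_True if_False simp_thms times_divide_eq_right of_nat_0 mult_zero_right div_0)
  qed
  show ?thesis
    unfolding pt sum_distrib_left[symmetric] sum_divide_distrib[symmetric] of_nat_sum[symmetric]
    using multi_vandermonde[OF finite_atLeastAtMost r, of 1 d e h'] unfolding se sh by simp
qed

corollary mv_hypergeometric_mean:
  fixes h :: "nat \<Rightarrow> nat"
  assumes k: "k \<in> {1..d}" and h: "\<And>k. k \<in> {1..d} \<Longrightarrow> 0 < h k"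
    and s: "s = (\<Sum>k=1..d. h k)" and r: "1 \<le> r" "r \<le> c" "r \<le> s"
  shows "(\<Sum>x\<in>PiE {1..d} (\<lambda>_. {..c}). real (x k) * mv_hypergeometric d s r h x)
    = real r * (real (h k) / real s)"
proof -
  have e: "(\<Sum>x\<in>PiE {1..d} (\<lambda>_. {..c}). real (x k) * mv_hypergeometric d s r h x)
    = real (h k) * real ((s - 1) choose (r - 1)) / real (s choose r)"
    using mv_hypergeometric_factorial_moment[of "{k}", OF _ h s r(2)] k r by simp
  have "r * (s choose r) = s * ((s - 1) choose (r - 1))"
    using r by (intro times_binomial_minus1_eq) simp
  then have "real r * real (s choose r) = real s * real ((s - 1) choose (r - 1))"
    by (metis of_nat_mult)
  moreover have "0 < real (s choose r)" "0 < real s" using r by auto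
  ultimately show ?thesis unfolding e by (simp add: field_simps)
qed

corollary mv_hypergeometric_mixed_moment:
  fixes h :: "nat \<Rightarrow> nat"
  assumes k: "k \<in> {1..d}" "l \<in> {1..d}" "k \<noteq> l" and h: "\<And>k. k \<in> {1..d} \<Longrightarrow> 0 < h k"
    and s: "s = (\<Sum>k=1..d. h k)" and r: "1 \<le> r" "r \<le> c" "r \<le> s" and s2: "2 \<le> s"
  shows "(\<Sum>x\<in>PiE {1..d} (\<lambda>_. {..c}). real (x k) * real (x l) * mv_hypergeometric d s r h x)
    = (real r * (real r - 1)) * (real (h k) * real (h l) / (real s * (real s - 1)))"
proof -
  have e: "(\<Sum>x\<in>PiE {1..d} (\<lambda>_. {..c}). real (x k) * real (x l) * mv_hypergeometric d s r h x)
    = real (h k) * real (h l) * real (if 2 \<le> r then (s - 2) choose (r - 2) else 0) / real (s choose r)"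
  proof -
    have c: "card {k, l} = 2" using k(3) unfolding card_2_iff by blast
    have p: "(\<Prod>j\<in>{k, l}. f j) = f k * f l" for f :: "nat \<Rightarrow> real" using k(3) by simp
    show ?thesis
      using mv_hypergeometric_factorial_moment[of "{k, l}", OF _ h s r(2)] k(1,2) unfolding c p by blast
  qed
  show ?thesis
  proof (cases "2 \<le> r")
    case True
    have "r * (s choose r) = s * ((s - 1) choose (r - 1))"
      using r by (intro times_binomial_minus1_eq) simp
    then have 1: "real r * real (s choose r) = real s * real ((s - 1) choose (r - 1))"
      by (metis of_nat_mult)
    have "(r - 1) * ((s - 1) choose (r - 1)) = (s - 1) * ((s - 1 - 1) choose (r - 1 - 1))"
      using True by (intro times_binomial_minus1_eq) simp
    then have "real (r - 1) * real ((s - 1) choose (r - 1)) = real (s - 1) * real ((s - 2) choose (r - 2))"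
      by (metis of_nat_mult diff_diff_left one_add_one)
    then have 2: "(real r - 1) * real ((s - 1) choose (r - 1)) = (real s - 1) * real ((s - 2) choose (r - 2))"
      using True s2 by (simp add: of_nat_diff)
    have p: "0 < real (s choose r)" "0 < real s" "0 < real s - 1" using r s2 by auto
    have "real s * (real s - 1) * real ((s - 2) choose (r - 2))
        = (real r * (real r - 1)) * real (s choose r)"
      using 1 2 by algebra
    note product = this
    have cross: "a / b = c / e" if "0 < b" "0 < e" "e * a = c * b" for a b c e :: real
      using that by (simp add: frac_eq_eq mult.commute)
    have "real ((s - 2) choose (r - 2)) / real (s choose r)
        = (real r * (real r - 1)) / (real s * (real s - 1))"
      by (rule cross[OF p(1) mult_pos_pos[OF p(2,3)] product])
    then show ?thesis unfolding e using True
      by (simp only: if_True times_divide_eq_right[symmetric])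
        (simp only: times_divide_eq_right mult.commute mult.left_commute mult.assoc)
  next
    case False
    then have "r = 1" using r by simp
    then show ?thesis unfolding e by simp
  qed
qed

section \<open>Growth of the colours along a path\<close>

text \<open>The deterministic part of the growth analysis, for one path of the urn: \<open>h n k\<close> balls of colour
  \<open>k\<close>, increments \<open>a n k\<close>, total \<open>s n\<close>, and \<open>\<nu> n\<close> balls drawn in the step from \<open>n\<close> to \<open>Suc n\<close> with
  mean replacements \<open>\<mu> n k\<close>; the colours in \<open>{1..t}\<close> are those of maximal limiting mean. The last
  three assumptions are what the martingale theorems provide.\<close>

locale reinforced_path =
  fixes d t :: nat and h a \<mu> :: "nat \<Rightarrow> nat \<Rightarrow> real" and \<nu> s m :: "nat \<Rightarrow> real" and b C :: real
  assumes d: "1 \<le> d" and t: "1 \<le> t" "t \<le> d"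
    and h_pos: "\<And>n k. k \<in> {1..d} \<Longrightarrow> 0 < h n k"
    and h_Suc: "\<And>n k. k \<in> {1..d} \<Longrightarrow> h (Suc n) k = h n k + a n k"
    and a_nonneg: "\<And>n k. k \<in> {1..d} \<Longrightarrow> 0 \<le> a n k"
    and s_eq: "\<And>n. s n = (\<Sum>k=1..d. h n k)"
    and s_top: "diverges s"
    and \<nu>_bounds: "\<And>n. 1 \<le> \<nu> n \<and> \<nu> n \<le> C"
    and \<mu>_bounds: "\<And>n k. k \<in> {1..d} \<Longrightarrow> 0 \<le> \<mu> n k \<and> \<mu> n k \<le> b"
    and \<mu>_lim: "\<And>k. k \<in> {1..d} \<Longrightarrow> (\<lambda>n. \<mu> n k) \<longlonglongrightarrow> m k"
    and \<mu>_top: "\<And>n k. k \<in> {1..t} \<Longrightarrow> \<mu> n k = \<mu> n 1"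
    and m_pos: "\<And>k. k \<in> {1..d} \<Longrightarrow> 0 < m k"
    and m_gap: "\<And>k. k \<in> {1..d} \<Longrightarrow> k \<notin> {1..t} \<Longrightarrow> m k < m 1"
    and conv_h: "\<And>k. k \<in> {1..d} \<Longrightarrow>
      convergent (\<lambda>n. \<Sum>i<n. (a i k - \<mu> i k * (\<nu> i * (h i k / s i))) / h i k)"
    and conv_s: "\<And>k. k \<in> {1..d} \<Longrightarrow>
      convergent (\<lambda>n. \<Sum>i<n. (a i k - \<mu> i k * (\<nu> i * (h i k / s i))) / s i)"
    and summ: "\<And>k. k \<in> {1..d} \<Longrightarrow> summable (\<lambda>i. pow32 (a i k / h i k))"
begin

lemma one_mem: "1 \<in> {1..d}" using d by simp

lemma s_pos: "0 < s n"
  unfolding s_eq using h_pos one_mem by (intro sum_pos) auto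

lemma h_le_s: "k \<in> {1..d} \<Longrightarrow> h n k \<le> s n"
  unfolding s_eq using h_pos by (intro member_le_sum) (auto intro: less_imp_le)

text \<open>The logarithm of each colour count follows its own drift in the common clock
  \<open>\<Sum>i<n. \<nu> i / s i\<close>, up to a convergent error.\<close>

lemma log_growth:
  assumes k: "k \<in> {1..d}"
  shows "convergent (\<lambda>n. ln (h n k) - (\<Sum>i<n. \<mu> i k * (\<nu> i / s i)))"
proof -
  let ?B = "\<lambda>i. a i k - \<mu> i k * (\<nu> i * (h i k / s i))"
  let ?r = "\<lambda>i. a i k / h i k - ln (1 + a i k / h i k)"
  have q: "0 \<le> a i k / h i k" for i using a_nonneg[OF k] h_pos[OF k] by (simp add: less_imp_le)
  have "summable ?r"
  proof (rule summable_comparison_test'[OF summ[OF k], of 0])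
    fix i
    have "ln (1 + a i k / h i k) \<le> a i k / h i k" using q by (rule ln_add_one_self_le_self)
    then show "norm (?r i) \<le> pow32 (a i k / h i k)"
      using diff_ln_le_pow32[OF q[of i]] by simp
  qed
  then have "convergent (\<lambda>n. \<Sum>i<n. ?r i)" by (simp add: summable_iff_convergent)
  then have "convergent (\<lambda>n. (ln (h 0 k) + (\<Sum>i<n. ?B i / h i k)) - (\<Sum>i<n. ?r i))"
    by (intro convergent_diff convergent_add convergent_const conv_h[OF k])
  moreover have "(ln (h 0 k) + (\<Sum>i<n. ?B i / h i k)) - (\<Sum>i<n. ?r i)
      = ln (h n k) - (\<Sum>i<n. \<mu> i k * (\<nu> i / s i))" for n
  proof (induction n)
    case 0 show ?case by simp
  next
    case (Suc n)
    have p: "0 < h n k" "0 < s n" by (rule h_pos[OF k], rule s_pos)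
    have "h (Suc n) k = h n k * (1 + a n k / h n k)"
      using p by (simp add: h_Suc[OF k] field_simps)
    then have "ln (h (Suc n) k) = ln (h n k) + ln (1 + a n k / h n k)"
      using p q[of n] by (simp add: ln_mult)
    moreover have "?B n / h n k = a n k / h n k - \<mu> n k * (\<nu> n / s n)"
      using p by (simp add: field_simps)
    ultimately show ?case using Suc by simp
  qed
  ultimately show ?thesis by simp
qed

lemma weight_nonneg: "0 \<le> \<nu> i / s i"
  using \<nu>_bounds[of i] s_pos[of i] by simp

text \<open>The total tends to infinity, while its logarithm grows at most proportionally to the clock.\<close>

lemma clock_at_top: "diverges (\<lambda>n. \<Sum>i<n. \<nu> i / s i)"
proof -
  let ?B = "\<lambda>i k. a i k - \<mu> i k * (\<nu> i * (h i k / s i))"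
  have b: "0 \<le> b" using \<mu>_bounds[OF one_mem, of 0] by linarith
  have s_Suc: "s (Suc n) = s n + (\<Sum>k=1..d. a n k)" for n
    by (simp add: s_eq h_Suc sum.distrib)
  have "convergent (\<lambda>n. ln (s 0) + (\<Sum>k=1..d. \<Sum>i<n. ?B i k / s i))"
    by (intro convergent_add convergent_const convergent_sum conv_s)
  then have "Bseq (\<lambda>n. ln (s 0) + (\<Sum>k=1..d. \<Sum>i<n. ?B i k / s i))"
    by (rule convergent_imp_Bseq)
  then obtain c where c: "\<And>n. \<bar>ln (s 0) + (\<Sum>k=1..d. \<Sum>i<n. ?B i k / s i)\<bar> \<le> c"
    unfolding Bseq_def by auto
  have up: "ln (s n) \<le> (ln (s 0) + (\<Sum>k=1..d. \<Sum>i<n. ?B i k / s i)) + b * (\<Sum>i<n. \<nu> i / s i)" for n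
  proof (induction n)
    case 0 show ?case by simp
  next
    case (Suc n)
    have p: "0 < s n" by (rule s_pos)
    have a0: "0 \<le> (\<Sum>k=1..d. a n k)" by (intro sum_nonneg a_nonneg) auto
    have "s (Suc n) = s n * (1 + (\<Sum>k=1..d. a n k) / s n)" using p by (simp add: s_Suc field_simps)
    moreover have "0 < 1 + (\<Sum>k=1..d. a n k) / s n" using p a0 by (intro add_pos_nonneg) auto
    ultimately have "ln (s (Suc n)) = ln (s n) + ln (1 + (\<Sum>k=1..d. a n k) / s n)"
      using p by (simp only: ln_mult_pos)
    also have "ln (1 + (\<Sum>k=1..d. a n k) / s n) \<le> (\<Sum>k=1..d. a n k) / s n"
      using p a0 by (intro ln_add_one_self_le_self) simp
    also have "(\<Sum>k=1..d. a n k) / s n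
        = (\<Sum>k=1..d. ?B n k / s n) + (\<Sum>k=1..d. \<mu> n k * h n k) / s n * (\<nu> n / s n)"
    proof -
      have "(\<Sum>k=1..d. \<mu> n k * h n k) / s n * (\<nu> n / s n)
          = (\<Sum>k=1..d. (\<mu> n k * (\<nu> n * (h n k / s n))) / s n)"
        unfolding sum_divide_distrib sum_distrib_right by (intro sum.cong) (auto simp: field_simps)
      then show ?thesis by (simp add: sum.distrib[symmetric] sum_divide_distrib diff_divide_distrib)
    qed
    also have "(\<Sum>k=1..d. \<mu> n k * h n k) / s n * (\<nu> n / s n) \<le> b * (\<nu> n / s n)"
    proof (rule mult_right_mono[OF _ weight_nonneg])
      have "(\<Sum>k=1..d. \<mu> n k * h n k) \<le> (\<Sum>k=1..d. b * h n k)"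
        using \<mu>_bounds h_pos by (intro sum_mono mult_right_mono) (auto intro: less_imp_le)
      also have "\<dots> = b * s n" by (simp add: s_eq sum_distrib_left)
      finally show "(\<Sum>k=1..d. \<mu> n k * h n k) / s n \<le> b" using p by (simp add: field_simps)
    qed
    finally show ?case using Suc by (simp add: sum.distrib distrib_left)
  qed
  have "diverges (\<lambda>n. ln (s n))"
    by (rule filterlim_compose[OF ln_at_top s_top])
  then have "diverges (\<lambda>n. c + b * (\<Sum>i<n. \<nu> i / s i))"
  proof (rule filterlim_at_top_mono, intro always_eventually allI)
    fix n show "ln (s n) \<le> c + b * (\<Sum>i<n. \<nu> i / s i)"
      using up[of n] c[of n] by linarith
  qed
  then have lim: "diverges (\<lambda>n. - c + (c + b * (\<Sum>i<n. \<nu> i / s i)))"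
    by (rule filterlim_tendsto_add_at_top[OF tendsto_const])
  have "b \<noteq> 0"
  proof
    assume "b = 0"
    then have "diverges (\<lambda>n::nat. 0::real)" using lim by simp
    then have "eventually (\<lambda>n::nat. (1::real) \<le> 0) sequentially" unfolding filterlim_at_top by blast
    then show False by simp
  qed
  then have "0 < inverse b" using b by simp
  from filterlim_tendsto_pos_mult_at_top[OF tendsto_const this lim]
  show ?thesis using \<open>b \<noteq> 0\<close> by (simp add: field_simps)
qed

lemma drift_at_top:
  assumes "c \<longlonglongrightarrow> l" "0 < l"
  shows "diverges (\<lambda>n. \<Sum>i<n. c i * (\<nu> i / s i))"
proof (rule sum_at_top_comparison[OF clock_at_top, of "l / 2"])
  have "eventually (\<lambda>i. l / 2 < c i) sequentially"
    using assms by (intro order_tendstoD(1)[OF assms(1)]) simp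
  then show "eventually (\<lambda>i. l / 2 * (\<nu> i / s i) \<le> c i * (\<nu> i / s i)) sequentially"
    by eventually_elim (intro mult_right_mono weight_nonneg, simp)
qed (use assms in simp)

lemma h_at_top:
  assumes k: "k \<in> {1..d}" shows "diverges (\<lambda>n. h n k)"
proof -
  obtain L where L: "(\<lambda>n. ln (h n k) - (\<Sum>i<n. \<mu> i k * (\<nu> i / s i))) \<longlonglongrightarrow> L"
    using log_growth[OF k] unfolding convergent_def by blast
  have "diverges (\<lambda>n. (ln (h n k) - (\<Sum>i<n. \<mu> i k * (\<nu> i / s i))) + (\<Sum>i<n. \<mu> i k * (\<nu> i / s i)))"
    by (rule filterlim_tendsto_add_at_top[OF L drift_at_top[OF \<mu>_lim[OF k] m_pos[OF k]]])
  then have "diverges (\<lambda>n. exp (ln (h n k)))"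
    by (intro filterlim_compose[OF exp_at_top]) simp
  then show ?thesis using h_pos[OF k] by simp
qed

lemma ratio_convergent:
  assumes k: "k \<in> {1..d}" shows "convergent (\<lambda>n. h n k / h n 1)"
proof -
  let ?f = "\<lambda>k n. ln (h n k) - (\<Sum>i<n. \<mu> i k * (\<nu> i / s i))"
  obtain L where L: "(\<lambda>n. ?f k n - ?f 1 n) \<longlonglongrightarrow> L"
    using convergent_diff[OF log_growth[OF k] log_growth[OF one_mem]] unfolding convergent_def by blast
  have eq: "h n k / h n 1 = exp (ln (h n k) - ln (h n 1))" for n
    using h_pos[OF k] h_pos[OF one_mem] by (simp add: exp_diff)
  show ?thesis
  proof (cases "k \<in> {1..t}")
    case True
    then have "?f k n - ?f 1 n = ln (h n k) - ln (h n 1)" for n using \<mu>_top[OF True] by simp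
    then have "(\<lambda>n. exp (ln (h n k) - ln (h n 1))) \<longlonglongrightarrow> exp L" using L by (intro tendsto_exp) simp
    then show ?thesis unfolding eq convergent_def by blast
  next
    case False
    have "(\<lambda>i. \<mu> i 1 - \<mu> i k) \<longlonglongrightarrow> m 1 - m k" by (intro tendsto_diff \<mu>_lim k one_mem)
    then have D: "diverges (\<lambda>n. \<Sum>i<n. (\<mu> i 1 - \<mu> i k) * (\<nu> i / s i))"
      using m_gap[OF k False] by (intro drift_at_top) auto
    have "diverges (\<lambda>n. - (?f k n - ?f 1 n) + (\<Sum>i<n. (\<mu> i 1 - \<mu> i k) * (\<nu> i / s i)))"
      by (rule filterlim_tendsto_add_at_top[OF tendsto_minus[OF L] D])
    then have "diverges (\<lambda>n. - (ln (h n k) - ln (h n 1)))"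
    proof (rule filterlim_cong[THEN iffD1, rotated -1, OF _ refl refl always_eventually, rule_format])
      show "- (?f k n - ?f 1 n) + (\<Sum>i<n. (\<mu> i 1 - \<mu> i k) * (\<nu> i / s i))
          = - (ln (h n k) - ln (h n 1))" for n
        by (simp only: left_diff_distrib sum_subtractf)
    qed
    then have "filterlim (\<lambda>n. ln (h n k) - ln (h n 1)) at_bot sequentially"
      by (simp add: filterlim_uminus_at_top)
    then have "(\<lambda>n. exp (ln (h n k) - ln (h n 1))) \<longlonglongrightarrow> 0"
      by (rule filterlim_compose[OF exp_at_bot])
    then show ?thesis unfolding eq convergent_def by blast
  qed
qed

lemma first_share_limit: "\<exists>z. 0 < z \<and> (\<lambda>n. h n 1 / s n) \<longlonglongrightarrow> z"
proof -
  have "convergent (\<lambda>n. \<Sum>k=1..d. h n k / h n 1)" by (intro convergent_sum ratio_convergent)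
  then obtain R where R: "(\<lambda>n. \<Sum>k=1..d. h n k / h n 1) \<longlonglongrightarrow> R" unfolding convergent_def by blast
  have p: "0 < h n 1" for n by (rule h_pos[OF one_mem])
  have eq: "(\<Sum>k=1..d. h n k / h n 1) = s n / h n 1" for n
    by (simp add: s_eq sum_divide_distrib)
  have "1 \<le> s n / h n 1" for n using h_le_s[OF one_mem, of n] p[of n] by simp
  then have "1 \<le> R" using R unfolding eq by (intro LIMSEQ_le_const) auto
  moreover have "(\<lambda>n. inverse (s n / h n 1)) \<longlonglongrightarrow> inverse R"
    using R \<open>1 \<le> R\<close> unfolding eq by (intro tendsto_inverse) auto
  ultimately show ?thesis by (intro exI[of _ "inverse R"]) auto
qed

lemma share_convergent:
  assumes k: "k \<in> {1..d}" shows "convergent (\<lambda>n. h n k / s n)"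
proof -
  obtain z where "(\<lambda>n. h n 1 / s n) \<longlonglongrightarrow> z" using first_share_limit by blast
  then have "convergent (\<lambda>n. h n 1 / s n)" by (auto simp: convergent_def)
  then have "convergent (\<lambda>n. (h n k / h n 1) * (h n 1 / s n))"
    by (intro convergent_mult ratio_convergent k)
  moreover have "h n 1 \<noteq> 0" for n using h_pos[OF one_mem, of n] by simp
  ultimately show ?thesis by simp
qed

text \<open>The terms are eventually at least a multiple of \<open>\<nu> i / s i\<close>: in the logarithm of
  \<open>h n k * h n l / h n 1\<close> the drifts add up to \<open>\<mu> n k + \<mu> n l - \<mu> n 1\<close>, which has a positive limit, and
  \<open>h n 1\<close> is comparable to \<open>s n\<close>.\<close>

lemma pair_sum_at_top:
  assumes k: "k \<in> {1..d}" and l: "l \<in> {1..d}" and gap: "m 1 < m k + m l"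
    and p: "p \<longlonglongrightarrow> p0" "0 < p0" and s2: "\<And>n. 2 \<le> s n"
  shows "diverges (\<lambda>n. \<Sum>i<n. p i * (h i k * h i l / (s i * (s i - 1))))"
proof -
  let ?f = "\<lambda>k n. ln (h n k) - (\<Sum>i<n. \<mu> i k * (\<nu> i / s i))"
  obtain L where L: "(\<lambda>n. ?f k n + ?f l n - ?f 1 n) \<longlonglongrightarrow> L"
    using convergent_diff[OF convergent_add[OF log_growth[OF k] log_growth[OF l]] log_growth[OF one_mem]]
    unfolding convergent_def by blast
  have "(\<lambda>i. \<mu> i k + \<mu> i l - \<mu> i 1) \<longlonglongrightarrow> m k + m l - m 1"
    by (intro tendsto_intros \<mu>_lim k l one_mem)
  then have D: "diverges (\<lambda>n. \<Sum>i<n. (\<mu> i k + \<mu> i l - \<mu> i 1) * (\<nu> i / s i))"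
    using gap by (intro drift_at_top) auto
  have "diverges (\<lambda>n. (?f k n + ?f l n - ?f 1 n)
      + (\<Sum>i<n. (\<mu> i k + \<mu> i l - \<mu> i 1) * (\<nu> i / s i)))"
    by (rule filterlim_tendsto_add_at_top[OF L D])
  then have "diverges (\<lambda>n. ln (h n k) + ln (h n l) - ln (h n 1))"
  proof (rule filterlim_cong[THEN iffD1, rotated -1, OF _ refl refl always_eventually, rule_format])
    show "(?f k n + ?f l n - ?f 1 n) + (\<Sum>i<n. (\<mu> i k + \<mu> i l - \<mu> i 1) * (\<nu> i / s i))
        = ln (h n k) + ln (h n l) - ln (h n 1)" for n
      by (simp only: left_diff_distrib distrib_right sum_subtractf sum.distrib)
  qed
  then have ev: "eventually (\<lambda>n. 0 \<le> ln (h n k) + ln (h n l) - ln (h n 1)) sequentially"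
    unfolding filterlim_at_top by blast
  obtain z where z: "0 < z" "(\<lambda>n. h n 1 / s n) \<longlonglongrightarrow> z" using first_share_limit by blast
  have ez: "eventually (\<lambda>n. z / 2 < h n 1 / s n) sequentially"
    using z by (intro order_tendstoD(1)[OF z(2)]) simp
  have ep: "eventually (\<lambda>n. p0 / 2 < p n) sequentially"
    using p by (intro order_tendstoD(1)[OF p(1)]) simp
  have C: "0 < C" using \<nu>_bounds[of 0] by linarith
  show ?thesis
  proof (rule sum_at_top_comparison[OF clock_at_top, of "p0 / 2 * (z / 2 / C)"])
    show "0 < p0 / 2 * (z / 2 / C)" using p z C by simp
    show "eventually (\<lambda>i. p0 / 2 * (z / 2 / C) * (\<nu> i / s i)
        \<le> p i * (h i k * h i l / (s i * (s i - 1)))) sequentially"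
      using ev ez ep
    proof eventually_elim
      case (elim n)
      have pos: "0 < h n k" "0 < h n l" "0 < h n 1" "0 < s n"
        by (rule h_pos[OF k], rule h_pos[OF l], rule h_pos[OF one_mem], rule s_pos)
      have "ln (h n 1) \<le> ln (h n k * h n l)" using elim(1) pos by (simp add: ln_mult)
      then have hh: "h n 1 \<le> h n k * h n l" using pos by (simp add: ln_le_cancel_iff)
      have "z / 2 * s n \<le> h n 1" using elim(2) pos by (simp add: field_simps)
      then have hs: "z / 2 * s n \<le> h n k * h n l" using hh by linarith
      have "z / 2 / C * (\<nu> n / s n) \<le> z / 2 / C * (C / s n)"
        using \<nu>_bounds[of n] z C pos by (intro mult_left_mono divide_right_mono) auto
      also have "\<dots> = z / 2 * s n / (s n * s n)" using C pos by (simp add: field_simps)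
      also have "\<dots> \<le> h n k * h n l / (s n * s n)" using hs pos by (intro divide_right_mono) auto
      also have "\<dots> \<le> h n k * h n l / (s n * (s n - 1))"
        using pos s2[of n] by (intro divide_left_mono) auto
      finally have *: "z / 2 / C * (\<nu> n / s n) \<le> h n k * h n l / (s n * (s n - 1))" .
      have "p0 / 2 * (z / 2 / C * (\<nu> n / s n)) \<le> p n * (h n k * h n l / (s n * (s n - 1)))"
      proof (rule mult_mono)
        show "0 \<le> z / 2 / C * (\<nu> n / s n)"
          using z C weight_nonneg[of n] by (intro mult_nonneg_nonneg) auto
      qed (use * elim(3) p in auto)
      then show ?case by (simp only: mult.assoc)
    qed
  qed
qed

end

section \<open>Filtrations and conditional means of the urn\<close>

lemma space_gen_algebra [simp]: "space (gen_algebra M V) = space M"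
  unfolding gen_algebra_def by (rule space_measure_of) auto

lemma sets_gen_algebra:
  "sets (gen_algebra M V) = sigma_sets (space M) {f -` B \<inter> space M | f B. f \<in> V}"
  unfolding gen_algebra_def by (rule sets_measure_of) auto

lemma measurable_gen_algebra: "f \<in> V \<Longrightarrow> f \<in> measurable (gen_algebra M V) (count_space UNIV)"
  by (rule measurableI) (auto simp: sets_gen_algebra intro: sigma_sets.Basic)

lemma subalgebra_gen_algebra:
  assumes "\<And>f. f \<in> V \<Longrightarrow> f \<in> measurable M (count_space UNIV)"
  shows "subalgebra M (gen_algebra M V)"
  unfolding subalgebra_def sets_gen_algebra
  using assms by (auto intro!: sets.sigma_sets_subset measurable_sets[where A = "count_space UNIV"])

lemma subalgebra_gen_algebra_mono: "V \<subseteq> W \<Longrightarrow> subalgebra (gen_algebra M W) (gen_algebra M V)"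
  unfolding subalgebra_def sets_gen_algebra by (auto intro!: sigma_sets_mono')

context reinforced_urn
begin

text \<open>The sigma-algebras generated by the first \<open>n\<close> stages, without and with the number of balls drawn next.\<close>

abbreviation "Fa \<equiv> F_alg M d N X A"
abbreviation "Ga \<equiv> G_alg M d N X A"

text \<open>The information available just before the replacement matrix of stage \<open>Suc n\<close> is revealed.\<close>

definition Kalg :: "nat \<Rightarrow> 'a measure" where
  "Kalg n = gen_algebra M (insert (N (Suc n)) (history d N X A n) \<union> {X (Suc n) k | k. k \<in> {1..d}})"

text \<open>The information contained in the replacement matrix of stage \<open>Suc n\<close>.\<close>

definition Ralg :: "nat \<Rightarrow> 'a measure" where
  "Ralg n = gen_algebra M {A (Suc n) k | k. k \<in> {1..d}}"

lemma history_measurable: "f \<in> history d N X A n \<Longrightarrow> f \<in> measurable M (count_space UNIV)"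
  unfolding history_def using N_measurable X_measurable A_measurable by auto

lemma history_mono: "history d N X A n \<subseteq> history d N X A (Suc n)"
proof -
  have "{1..n} \<subseteq> {1..Suc n}" by auto
  then show ?thesis unfolding history_def by blast
qed

lemma history_new:
  "N (Suc n) \<in> history d N X A (Suc n)"
  "k \<in> {1..d} \<Longrightarrow> X (Suc n) k \<in> history d N X A (Suc n)"
  "k \<in> {1..d} \<Longrightarrow> A (Suc n) k \<in> history d N X A (Suc n)"
  unfolding history_def by auto

sublocale F: nat_filtration M Fa
proof
  fix n
  show "subalgebra M (Fa n)"
    unfolding F_alg_def by (intro subalgebra_gen_algebra history_measurable)
  show "subalgebra (Fa (Suc n)) (Fa n)"
    unfolding F_alg_def by (intro subalgebra_gen_algebra_mono history_mono)
qed

sublocale K: nat_filtration M Kalg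
proof
  fix n
  show "subalgebra M (Kalg n)"
    unfolding Kalg_def
    by (intro subalgebra_gen_algebra) (auto intro: history_measurable N_measurable X_measurable)
  have "insert (N (Suc n)) (history d N X A n) \<union> {X (Suc n) k | k. k \<in> {1..d}}
      \<subseteq> history d N X A (Suc n)"
    using history_mono history_new by auto
  then show "subalgebra (Kalg (Suc n)) (Kalg n)"
    unfolding Kalg_def by (intro subalgebra_gen_algebra_mono) auto
qed

lemma subalgebra_Ga: "subalgebra M (Ga n)"
  unfolding G_alg_def
  by (intro subalgebra_gen_algebra) (auto intro: history_measurable N_measurable)

lemma subalgebra_Ga_Fa: "subalgebra (Ga n) (Fa n)"
  unfolding G_alg_def F_alg_def by (intro subalgebra_gen_algebra_mono) auto

lemma subalgebra_Kalg_Ga: "subalgebra (Kalg n) (Ga n)"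
  unfolding G_alg_def Kalg_def by (intro subalgebra_gen_algebra_mono) auto

lemma measurable_Fa_Ga: "f \<in> measurable (Fa n) R \<Longrightarrow> f \<in> measurable (Ga n) R"
  by (rule measurable_from_subalg[OF subalgebra_Ga_Fa])

lemma measurable_Ga_Kalg: "f \<in> measurable (Ga n) R \<Longrightarrow> f \<in> measurable (Kalg n) R"
  by (rule measurable_from_subalg[OF subalgebra_Kalg_Ga])

lemma measurable_new:
  "N (Suc n) \<in> measurable (Fa (Suc n)) (count_space UNIV)"
  "k \<in> {1..d} \<Longrightarrow> X (Suc n) k \<in> measurable (Fa (Suc n)) (count_space UNIV)"
  "k \<in> {1..d} \<Longrightarrow> A (Suc n) k \<in> measurable (Fa (Suc n)) (count_space UNIV)"
  "N (Suc n) \<in> measurable (Ga n) (count_space UNIV)"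
  "k \<in> {1..d} \<Longrightarrow> X (Suc n) k \<in> measurable (Kalg n) (count_space UNIV)"
  "k \<in> {1..d} \<Longrightarrow> A (Suc n) k \<in> measurable (Kalg (Suc n)) (count_space UNIV)"
  "k \<in> {1..d} \<Longrightarrow> A (Suc n) k \<in> measurable (Ralg n) (count_space UNIV)"
  unfolding F_alg_def G_alg_def Kalg_def Ralg_def using history_new
  by (auto intro!: measurable_gen_algebra)

lemma measurable_new_M [measurable]:
  "N (Suc n) \<in> measurable M (count_space UNIV)"
  "k \<in> {1..d} \<Longrightarrow> X (Suc n) k \<in> measurable M (count_space UNIV)"
  "k \<in> {1..d} \<Longrightarrow> A (Suc n) k \<in> measurable M (count_space UNIV)"
  using N_measurable X_measurable A_measurable by auto

lemma balls_measurable: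
  assumes k: "k \<in> {1..d}" shows "balls H0 X A n k \<in> measurable (Fa n) (count_space UNIV)"
proof -
  have [measurable]: "i \<in> {1..n} \<Longrightarrow> X i k \<in> measurable (Fa n) (count_space UNIV)"
    "i \<in> {1..n} \<Longrightarrow> A i k \<in> measurable (Fa n) (count_space UNIV)" for i
    unfolding F_alg_def history_def using k by (auto intro!: measurable_gen_algebra)
  show ?thesis unfolding balls_def [abs_def] by measurable
qed

lemma total_measurable: "total d H0 X A n \<in> measurable (Fa n) (count_space UNIV)"
proof -
  have [measurable]: "k \<in> {1..d} \<Longrightarrow> balls H0 X A n k \<in> measurable (Fa n) (count_space UNIV)" for k
    by (rule balls_measurable)
  show ?thesis unfolding total_def [abs_def] by measurable
qed

text \<open>Real-valued versions of the number of balls of a colour, of the total, and of the number of balls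
  of a colour that are added in the step from \<open>n\<close> to \<open>Suc n\<close>.\<close>

definition cnt :: "nat \<Rightarrow> nat \<Rightarrow> 'a \<Rightarrow> real" where "cnt n k \<omega> = real (balls H0 X A n k \<omega>)"
definition tot :: "nat \<Rightarrow> 'a \<Rightarrow> real" where "tot n \<omega> = real (total d H0 X A n \<omega>)"
definition incr :: "nat \<Rightarrow> nat \<Rightarrow> 'a \<Rightarrow> real" where "incr n k \<omega> = real (A (Suc n) k \<omega>) * real (X (Suc n) k \<omega>)"

lemma cnt_measurable: "k \<in> {1..d} \<Longrightarrow> cnt n k \<in> borel_measurable (Fa n)"
  unfolding cnt_def [abs_def] using balls_measurable[of k n] by measurable

lemma tot_measurable: "tot n \<in> borel_measurable (Fa n)"
  unfolding tot_def [abs_def] using total_measurable[of n] by measurable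

lemma cnt_measurable_M [measurable]: "k \<in> {1..d} \<Longrightarrow> cnt n k \<in> borel_measurable M"
  by (rule F.measurable_F_M[OF cnt_measurable])

lemma tot_measurable_M [measurable]: "tot n \<in> borel_measurable M"
  by (rule F.measurable_F_M[OF tot_measurable])

lemma cnt_Suc: "cnt (Suc n) k \<omega> = cnt n k \<omega> + incr n k \<omega>"
  by (simp add: cnt_def incr_def balls_def)

lemma balls_pos: "k \<in> {1..d} \<Longrightarrow> 0 < balls H0 X A n k \<omega>"
  using initial[of k] by (simp add: balls_def)

lemma cnt_ge_1: "k \<in> {1..d} \<Longrightarrow> 1 \<le> cnt n k \<omega>"
  using balls_pos[of k n \<omega>] by (simp add: cnt_def)

lemma tot_eq: "tot n \<omega> = (\<Sum>k=1..d. cnt n k \<omega>)"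
  by (simp add: tot_def cnt_def total_def)

lemma total_ge_2: "2 \<le> total d H0 X A n \<omega>"
proof -
  have "(\<Sum>k=1..d. 1) \<le> total d H0 X A n \<omega>"
    unfolding total_def using balls_pos by (intro sum_mono) (auto simp: Suc_le_eq)
  then show ?thesis using colours by simp
qed

lemma tot_ge_2: "2 \<le> tot n \<omega>"
  using total_ge_2[of n \<omega>] by (simp add: tot_def)

lemma cnt_le_tot: "k \<in> {1..d} \<Longrightarrow> cnt n k \<omega> \<le> tot n \<omega>"
  unfolding tot_eq using cnt_ge_1 by (intro member_le_sum) (auto intro: order_trans[OF zero_le_one])

text \<open>The outcomes at which the almost sure constraints on the draws hold at every stage.\<close>

definition regular :: "'a \<Rightarrow> bool" where
  "regular \<omega> \<longleftrightarrow> (\<forall>n. N (Suc n) \<omega> \<in> {1..min (total d H0 X A n \<omega>) C1} \<and>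
    (\<Sum>k=1..d. X (Suc n) k \<omega>) = N (Suc n) \<omega> \<and> (\<forall>k\<in>{1..d}. 1 \<le> A (Suc n) k \<omega>))"

lemma AE_regular: "AE \<omega> in M. regular \<omega>"
proof -
  have "AE \<omega> in M. \<forall>k\<in>{1..d}. 1 \<le> A (Suc n) k \<omega>" for n
    using A_ge_1 by (intro AE_finite_allI) auto
  then show ?thesis
    unfolding regular_def AE_all_countable
    using draw_size draw_total by (auto intro!: AE_conjI)
qed

lemma regular_N: "regular \<omega> \<Longrightarrow> 1 \<le> N (Suc n) \<omega> \<and> N (Suc n) \<omega> \<le> C1 \<and> N (Suc n) \<omega> \<le> total d H0 X A n \<omega>"
  unfolding regular_def by auto

lemma regular_X: "regular \<omega> \<Longrightarrow> k \<in> {1..d} \<Longrightarrow> X (Suc n) k \<omega> \<le> N (Suc n) \<omega>"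
  unfolding regular_def using member_le_sum[of k "{1..d}" "\<lambda>k. X (Suc n) k \<omega>"] by auto

lemma regular_X_le: "regular \<omega> \<Longrightarrow> k \<in> {1..d} \<Longrightarrow> X (Suc n) k \<omega> \<le> C1"
  using regular_X[of \<omega> k n] regular_N[of \<omega> n] by linarith

lemma regular_A: "regular \<omega> \<Longrightarrow> k \<in> {1..d} \<Longrightarrow> 1 \<le> A (Suc n) k \<omega>"
  unfolding regular_def by auto

lemma regular_incr: "regular \<omega> \<Longrightarrow> k \<in> {1..d} \<Longrightarrow> real (X (Suc n) k \<omega>) \<le> incr n k \<omega>"
  using regular_A[of \<omega> k n] mult_right_mono[of 1 "real (A (Suc n) k \<omega>)" "real (X (Suc n) k \<omega>)"]
  by (simp add: incr_def)

lemma regular_tot_ge: "regular \<omega> \<Longrightarrow> real n \<le> tot n \<omega>"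
proof (induction n)
  case 0 then show ?case by (simp add: tot_def)
next
  case (Suc n)
  have "1 \<le> real (N (Suc n) \<omega>)" using regular_N[OF Suc.prems, of n] by simp
  also have "\<dots> = (\<Sum>k=1..d. real (X (Suc n) k \<omega>))"
    using Suc.prems unfolding regular_def by (metis of_nat_sum)
  also have "\<dots> \<le> (\<Sum>k=1..d. incr n k \<omega>)" by (intro sum_mono regular_incr Suc.prems)
  finally have "1 \<le> (\<Sum>k=1..d. incr n k \<omega>)" .
  then show ?case using Suc by (simp add: tot_eq cnt_Suc sum.distrib)
qed

lemma regular_cnt_ge:
  assumes "regular \<omega>" "k \<in> {1..d}"
  shows "1 + (\<Sum>i<n. real (X (Suc i) k \<omega>)) \<le> cnt n k \<omega>"
proof (induction n)
  case 0 then show ?case using cnt_ge_1[OF assms(2)] by simp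
next
  case (Suc n) then show ?case using regular_incr[OF assms, of n] by (simp add: cnt_Suc)
qed

text \<open>The law of the draw, integrated: a function of the draw may be replaced by its hypergeometric mean
  under the integral against any bounded function of the past and the number of balls drawn. Up to a
  null set the draw is bounded by \<open>C1\<close>, so finitely many values suffice.\<close>

lemma draw_integral:
  fixes \<phi> :: "(nat \<Rightarrow> nat) \<Rightarrow> real"
  assumes gG: "g \<in> borel_measurable (Ga n)" and gb: "\<And>\<omega>. \<bar>g \<omega>\<bar> \<le> b"
    and \<Psi>[measurable]: "\<Psi> \<in> borel_measurable M"
    and eq: "\<And>\<omega>. regular \<omega> \<Longrightarrow> (\<Sum>x\<in>PiE {1..d} (\<lambda>_. {..C1}). \<phi> x * mv_hypergeometric d (total d H0 X A n \<omega>)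
        (N (Suc n) \<omega>) (\<lambda>k. balls H0 X A n k \<omega>) x) = \<Psi> \<omega>"
    and meas: "(\<lambda>\<omega>. \<phi> (restrict (\<lambda>k. X (Suc n) k \<omega>) {1..d})) \<in> borel_measurable M"
  shows "(LINT \<omega>|M. g \<omega> * \<phi> (restrict (\<lambda>k. X (Suc n) k \<omega>) {1..d})) = (LINT \<omega>|M. g \<omega> * \<Psi> \<omega>)"
proof -
  let ?P = "PiE {1..d} (\<lambda>_. {..C1})"
  let ?E = "\<lambda>x. {\<omega> \<in> space M. \<forall>k\<in>{1..d}. X (Suc n) k \<omega> = x k}"
  interpret S: finite_measure_subalgebra M "Ga n"
    by (simp add: finite_measure_axioms finite_measure_subalgebra_axioms_def
      finite_measure_subalgebra_def subalgebra_Ga)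
  have gM [measurable]: "g \<in> borel_measurable M" by (rule measurable_from_subalg[OF subalgebra_Ga gG])
  have fin: "finite ?P" by (intro finite_PiE) auto
  have E [measurable]: "?E x \<in> sets M" for x by measurable
  have gE: "integrable M (\<lambda>\<omega>. g \<omega> * indicator (?E x) \<omega>)" for x
  proof (rule F.integrable_bounded_mult[of _ _ b])
    show "integrable M (indicator (?E x) :: 'a \<Rightarrow> real)"
      by (rule integrable_real_indicator[OF E]) (simp add: emeasure_eq_measure)
  qed (use gb in auto)
  have iE: "integrable M (\<lambda>\<omega>. g \<omega> * real_cond_exp M (Ga n) (indicator (?E x)) \<omega>)" for x
    using S.real_cond_exp_intg(1)[OF gE gG] by simp
  have "AE \<omega> in M. \<phi> (restrict (\<lambda>k. X (Suc n) k \<omega>) {1..d}) = (\<Sum>x\<in>?P. \<phi> x * indicator (?E x) \<omega>)"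
    using AE_regular AE_space
  proof eventually_elim
    case (elim \<omega>)
    let ?y = "restrict (\<lambda>k. X (Suc n) k \<omega>) {1..d}"
    have y: "?y \<in> ?P" using regular_X_le[OF elim(1)] by auto
    have "(\<Sum>x\<in>?P. \<phi> x * indicator (?E x) \<omega>) = (\<Sum>x\<in>?P. if x = ?y then \<phi> ?y else 0)"
    proof (rule sum.cong)
      fix x assume x: "x \<in> ?P"
      have "\<omega> \<in> ?E x \<longleftrightarrow> x = ?y"
      proof
        assume "\<omega> \<in> ?E x"
        then show "x = ?y" using x by (intro PiE_ext[OF x y]) auto
      qed (use elim(2) in simp)
      then show "\<phi> x * indicator (?E x) \<omega> = (if x = ?y then \<phi> ?y else 0)" by (simp add: indicator_def)
    qed simp
    then show ?case using y fin by simp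
  qed
  then have "(LINT \<omega>|M. g \<omega> * \<phi> (restrict (\<lambda>k. X (Suc n) k \<omega>) {1..d}))
      = (LINT \<omega>|M. (\<Sum>x\<in>?P. \<phi> x * (g \<omega> * indicator (?E x) \<omega>)))"
    using meas by (intro integral_cong_AE) (auto elim!: eventually_mono simp: sum_distrib_left ac_simps)
  also have "\<dots> = (\<Sum>x\<in>?P. \<phi> x * (LINT \<omega>|M. g \<omega> * indicator (?E x) \<omega>))"
    by (subst Bochner_Integration.integral_sum) (use gE in auto)
  also have "\<dots> = (\<Sum>x\<in>?P. \<phi> x * (LINT \<omega>|M. g \<omega> * real_cond_exp M (Ga n) (indicator (?E x)) \<omega>))"
    using S.real_cond_exp_intg(2)[OF gE gG] by simp
  also have "\<dots> = (LINT \<omega>|M. (\<Sum>x\<in>?P. \<phi> x * (g \<omega> * real_cond_exp M (Ga n) (indicator (?E x)) \<omega>)))"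
    by (subst Bochner_Integration.integral_sum) (use iE in auto)
  also have "\<dots> = (LINT \<omega>|M. g \<omega> * \<Psi> \<omega>)"
  proof (rule integral_cong_AE)
    have "AE \<omega> in M. \<forall>x\<in>?P. real_cond_exp M (Ga n) (indicator (?E x)) \<omega> =
      mv_hypergeometric d (total d H0 X A n \<omega>) (N (Suc n) \<omega>) (\<lambda>k. balls H0 X A n k \<omega>) x"
      using draw_law fin by (intro AE_finite_allI) auto
    then show "AE \<omega> in M. (\<Sum>x\<in>?P. \<phi> x * (g \<omega> * real_cond_exp M (Ga n) (indicator (?E x)) \<omega>)) = g \<omega> * \<Psi> \<omega>"
      using AE_regular
    proof eventually_elim
      case (elim \<omega>)
      then show ?case unfolding eq[OF elim(2), symmetric]
        by (simp add: sum_distrib_left ac_simps)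
    qed
  qed auto
  finally show ?thesis .
qed

lemma draw_mean:
  assumes k: "k \<in> {1..d}" and g: "g \<in> borel_measurable (Ga n)" "\<And>\<omega>. \<bar>g \<omega>\<bar> \<le> b"
  shows "(LINT \<omega>|M. g \<omega> * real (X (Suc n) k \<omega>))
    = (LINT \<omega>|M. g \<omega> * (real (N (Suc n) \<omega>) * (cnt n k \<omega> / tot n \<omega>)))"
proof -
  have "(LINT \<omega>|M. g \<omega> * real (restrict (\<lambda>k. X (Suc n) k \<omega>) {1..d} k))
    = (LINT \<omega>|M. g \<omega> * (real (N (Suc n) \<omega>) * (cnt n k \<omega> / tot n \<omega>)))"
  proof (rule draw_integral[OF g, of _ "\<lambda>x. real (x k)"])
    show "(\<lambda>\<omega>. real (restrict (\<lambda>k. X (Suc n) k \<omega>) {1..d} k)) \<in> borel_measurable M"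
      unfolding restrict_apply'[OF k] using measurable_new_M(2)[OF k] by measurable
    fix \<omega> assume "regular \<omega>"
    then show "(\<Sum>x\<in>PiE {1..d} (\<lambda>_. {..C1}). real (x k) * mv_hypergeometric d (total d H0 X A n \<omega>)
        (N (Suc n) \<omega>) (\<lambda>k. balls H0 X A n k \<omega>) x) = real (N (Suc n) \<omega>) * (cnt n k \<omega> / tot n \<omega>)"
      unfolding cnt_def tot_def using regular_N[of \<omega> n]
      by (intro mv_hypergeometric_mean k balls_pos total_def) auto
  qed (use k in measurable)
  then show ?thesis using k by simp
qed

lemma draw_mixed_moment:
  assumes k: "k \<in> {1..d}" "l \<in> {1..d}" "k \<noteq> l"
    and g: "g \<in> borel_measurable (Ga n)" "\<And>\<omega>. \<bar>g \<omega>\<bar> \<le> b"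
  shows "(LINT \<omega>|M. g \<omega> * (real (X (Suc n) k \<omega>) * real (X (Suc n) l \<omega>)))
    = (LINT \<omega>|M. g \<omega> * ((real (N (Suc n) \<omega>) * (real (N (Suc n) \<omega>) - 1)) *
        (cnt n k \<omega> * cnt n l \<omega> / (tot n \<omega> * (tot n \<omega> - 1)))))"
proof -
  have "(LINT \<omega>|M. g \<omega> * (real (restrict (\<lambda>k. X (Suc n) k \<omega>) {1..d} k) *
      real (restrict (\<lambda>k. X (Suc n) k \<omega>) {1..d} l)))
    = (LINT \<omega>|M. g \<omega> * ((real (N (Suc n) \<omega>) * (real (N (Suc n) \<omega>) - 1)) *
        (cnt n k \<omega> * cnt n l \<omega> / (tot n \<omega> * (tot n \<omega> - 1)))))"
  proof (rule draw_integral[OF g, of _ "\<lambda>x. real (x k) * real (x l)"])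
    show "(\<lambda>\<omega>. real (restrict (\<lambda>k. X (Suc n) k \<omega>) {1..d} k) *
        real (restrict (\<lambda>k. X (Suc n) k \<omega>) {1..d} l)) \<in> borel_measurable M"
      unfolding restrict_apply'[OF k(1)] restrict_apply'[OF k(2)]
      using measurable_new_M(2)[OF k(1)] measurable_new_M(2)[OF k(2)] by measurable
    fix \<omega> assume "regular \<omega>"
    then show "(\<Sum>x\<in>PiE {1..d} (\<lambda>_. {..C1}). real (x k) * real (x l) * mv_hypergeometric d
        (total d H0 X A n \<omega>) (N (Suc n) \<omega>) (\<lambda>k. balls H0 X A n k \<omega>) x)
      = (real (N (Suc n) \<omega>) * (real (N (Suc n) \<omega>) - 1)) *
        (cnt n k \<omega> * cnt n l \<omega> / (tot n \<omega> * (tot n \<omega> - 1)))"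
      unfolding cnt_def tot_def using regular_N[of \<omega> n]
      by (intro mv_hypergeometric_mixed_moment k balls_pos total_def total_ge_2) auto
  qed (use k in measurable)
  then show ?thesis using k by simp
qed

lemma indep_integral:
  assumes f: "f \<in> borel_measurable (Kalg n)" "integrable M f"
    and Y: "Y \<in> borel_measurable (Ralg n)" "integrable M Y"
  shows "(LINT \<omega>|M. f \<omega> * Y \<omega>) = (LINT \<omega>|M. f \<omega>) * (LINT \<omega>|M. Y \<omega>)"
    and "integrable M (\<lambda>\<omega>. f \<omega> * Y \<omega> :: real)"
proof -
  have i: "indep_set (sets (Ralg n)) (sets (Kalg n))"
    unfolding Ralg_def Kalg_def using indep[of n] by simp
  have sub: "sigma_sets (space M) {f -` B \<inter> space M | B. B \<in> sets borel} \<subseteq> sets L"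
    if "f \<in> borel_measurable L" "space L = space M" for f :: "'a \<Rightarrow> real" and L
  proof -
    have "{f -` B \<inter> space L | B. B \<in> sets borel} \<subseteq> sets L" using measurable_sets[OF that(1)] by blast
    from sets.sigma_sets_subset[OF this] show ?thesis by (simp only: that(2))
  qed
  have sp: "space (Ralg n) = space M" "space (Kalg n) = space M" by (simp_all add: Ralg_def Kalg_def)
  have "indep_var borel Y borel f"
    unfolding indep_var_eq
  proof (intro conjI)
    show "random_variable borel Y" "random_variable borel f" using f(2) Y(2) by auto
    show "indep_set (sigma_sets (space M) {Y -` A \<inter> space M |A. A \<in> sets borel})
        (sigma_sets (space M) {f -` A \<inter> space M |A. A \<in> sets borel})"
      unfolding indep_set_def
    proof (rule indep_sets_mono_sets[OF i[unfolded indep_set_def]])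
      fix j :: bool
      show "case_bool (sigma_sets (space M) {Y -` A \<inter> space M |A. A \<in> sets borel})
          (sigma_sets (space M) {f -` A \<inter> space M |A. A \<in> sets borel}) j
        \<subseteq> case_bool (sets (Ralg n)) (sets (Kalg n)) j"
        using sub[OF Y(1) sp(1)] sub[OF f(1) sp(2)] by (cases j) simp_all
    qed
  qed
  from indep_var_lebesgue_integral[OF this Y(2) f(2)] indep_var_integrable[OF this Y(2) f(2)]
  show "(LINT \<omega>|M. f \<omega> * Y \<omega>) = (LINT \<omega>|M. f \<omega>) * (LINT \<omega>|M. Y \<omega>)"
    "integrable M (\<lambda>\<omega>. f \<omega> * Y \<omega>)"
    by (simp_all add: mult.commute)
qed

end

section \<open>Convergence of the scaled increments\<close>

text \<open>The urn with replacements whose third moments are bounded uniformly over the stages.\<close>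

locale bounded_urn = reinforced_urn M d H0 C1 N X A
  for M :: "'a measure" and d H0 C1 N X A +
  fixes C2 :: real
  assumes C2_nonneg: "0 \<le> C2"
    and third_moment: "\<And>n k. k \<in> {1..d} \<Longrightarrow>
      (\<integral>\<^sup>+\<omega>. ennreal (real (A (Suc n) k \<omega>) ^ 3) \<partial>M) \<le> ennreal C2"
begin

text \<open>The mean replacement in the step from \<open>n\<close> to \<open>Suc n\<close>.\<close>

definition mrepl :: "nat \<Rightarrow> nat \<Rightarrow> real" where "mrepl n k = mean_repl M A (Suc n) k"

lemma cube_integrable:
  assumes k: "k \<in> {1..d}"
  shows "integrable M (\<lambda>\<omega>. real (A (Suc n) k \<omega>) ^ 3)" "(LINT \<omega>|M. real (A (Suc n) k \<omega>) ^ 3) \<le> C2"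
proof -
  have [measurable]: "A (Suc n) k \<in> measurable M (count_space UNIV)" using k by simp
  show i: "integrable M (\<lambda>\<omega>. real (A (Suc n) k \<omega>) ^ 3)"
    using third_moment[OF k, of n] by (intro integrableI_nonneg) (auto simp: less_top[symmetric] top_unique)
  have "ennreal (LINT \<omega>|M. real (A (Suc n) k \<omega>) ^ 3) \<le> ennreal C2"
    using nn_integral_eq_integral[OF i] third_moment[OF k, of n] by simp
  then show "(LINT \<omega>|M. real (A (Suc n) k \<omega>) ^ 3) \<le> C2" using C2_nonneg by simp
qed

lemma dominated_by_cube:
  assumes k: "k \<in> {1..d}" and [measurable]: "f \<in> borel_measurable M"
    and f: "\<And>\<omega>. 0 \<le> f \<omega> \<and> f \<omega> \<le> real (A (Suc n) k \<omega>) ^ 3"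
  shows "integrable M f" "(LINT \<omega>|M. f \<omega>) \<le> C2"
proof -
  show i: "integrable M f"
    by (rule Bochner_Integration.integrable_bound[OF cube_integrable(1)[OF k]]) (use f in auto)
  have "(LINT \<omega>|M. f \<omega>) \<le> (LINT \<omega>|M. real (A (Suc n) k \<omega>) ^ 3)"
    using f by (intro integral_mono i cube_integrable k) auto
  then show "(LINT \<omega>|M. f \<omega>) \<le> C2" using cube_integrable(2)[OF k, of n] by linarith
qed

lemma A_moments:
  assumes k: "k \<in> {1..d}"
  shows "integrable M (\<lambda>\<omega>. real (A (Suc n) k \<omega>))" "(LINT \<omega>|M. real (A (Suc n) k \<omega>)) \<le> C2"
    "integrable M (\<lambda>\<omega>. pow32 (real (A (Suc n) k \<omega>)))" "(LINT \<omega>|M. pow32 (real (A (Suc n) k \<omega>))) \<le> C2"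
proof -
  have [measurable]: "A (Suc n) k \<in> measurable M (count_space UNIV)" using k by simp
  show "integrable M (\<lambda>\<omega>. real (A (Suc n) k \<omega>))" "(LINT \<omega>|M. real (A (Suc n) k \<omega>)) \<le> C2"
    by (rule dominated_by_cube[OF k, where n = n], simp, simp only: nat_le_cube of_nat_0_le_iff simp_thms)+
  show "integrable M (\<lambda>\<omega>. pow32 (real (A (Suc n) k \<omega>)))" "(LINT \<omega>|M. pow32 (real (A (Suc n) k \<omega>))) \<le> C2"
    by (rule dominated_by_cube[OF k, where n = n]; simp add: pow32_nat_le_cube)+
qed

lemma AA_moments:
  assumes k: "k \<in> {1..d}" "l \<in> {1..d}"
  shows "integrable M (\<lambda>\<omega>. pow32 (real (A (Suc n) k \<omega>) * real (A (Suc n) l \<omega>)))"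
    "(LINT \<omega>|M. pow32 (real (A (Suc n) k \<omega>) * real (A (Suc n) l \<omega>))) \<le> 2 * C2"
proof -
  have [measurable]: "A (Suc n) k \<in> measurable M (count_space UNIV)"
    "A (Suc n) l \<in> measurable M (count_space UNIV)" using k by simp_all
  let ?f = "\<lambda>\<omega>. pow32 (real (A (Suc n) k \<omega>) * real (A (Suc n) l \<omega>))"
  let ?g = "\<lambda>\<omega>. real (A (Suc n) k \<omega>) ^ 3 + real (A (Suc n) l \<omega>) ^ 3"
  have g: "integrable M ?g" using cube_integrable k by simp
  show i: "integrable M ?f"
    by (rule Bochner_Integration.integrable_bound[OF g]) (auto simp: pow32_product_le)
  have "(LINT \<omega>|M. ?f \<omega>) \<le> (LINT \<omega>|M. ?g \<omega>)" by (intro integral_mono i g) (simp add: pow32_product_le)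
  also have "\<dots> \<le> 2 * C2"
    using cube_integrable[OF k(1), of n] cube_integrable[OF k(2), of n] by simp
  finally show "(LINT \<omega>|M. ?f \<omega>) \<le> 2 * C2" .
qed

lemma mrepl_bounds: assumes k: "k \<in> {1..d}" shows "1 \<le> mrepl n k" "mrepl n k \<le> C2"
proof -
  have "(LINT \<omega>|M. 1) \<le> (LINT \<omega>|M. real (A (Suc n) k \<omega>))"
    using A_ge_1[OF k, of n] A_moments[OF k, of n]
    by (intro integral_mono_AE) (auto elim!: eventually_mono)
  then show "1 \<le> mrepl n k" by (simp add: mrepl_def mean_repl_def prob_space)
  show "mrepl n k \<le> C2" using A_moments[OF k, of n] by (simp add: mrepl_def mean_repl_def)
qed

text \<open>The conditional mean of the number of balls of colour \<open>k\<close> drawn at stage \<open>Suc n\<close>, given the past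
  and the number of balls drawn.\<close>

definition mdraw :: "nat \<Rightarrow> nat \<Rightarrow> 'a \<Rightarrow> real" where "mdraw n k \<omega> = real (N (Suc n) \<omega>) * (cnt n k \<omega> / tot n \<omega>)"

lemma share_bounds: "k \<in> {1..d} \<Longrightarrow> 0 \<le> cnt n k \<omega> / tot n \<omega> \<and> cnt n k \<omega> / tot n \<omega> \<le> 1"
  using cnt_le_tot[of k n \<omega>] tot_ge_2[of n \<omega>] cnt_ge_1[of k n \<omega>] by simp

lemma mdraw_bounds: "regular \<omega> \<Longrightarrow> k \<in> {1..d} \<Longrightarrow> 0 \<le> mdraw n k \<omega> \<and> mdraw n k \<omega> \<le> real C1"
  unfolding mdraw_def using share_bounds[of k n \<omega>] regular_N[of \<omega> n]
    mult_mono[of "real (N (Suc n) \<omega>)" "real C1" "cnt n k \<omega> / tot n \<omega>" 1]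
    mult_nonneg_nonneg[of "real (N (Suc n) \<omega>)" "cnt n k \<omega> / tot n \<omega>"] by auto

lemma X_integrable: "k \<in> {1..d} \<Longrightarrow> integrable M (\<lambda>\<omega>. real (X (Suc n) k \<omega>))"
  using AE_regular regular_X_le[of _ k n]
  by (intro integrable_const_bound[of _ "real C1"]) (auto elim!: eventually_mono)

lemma mdraw_measurable_M [measurable]: "k \<in> {1..d} \<Longrightarrow> mdraw n k \<in> borel_measurable M"
  unfolding mdraw_def [abs_def] by measurable

lemma mdraw_integrable: "k \<in> {1..d} \<Longrightarrow> integrable M (mdraw n k)"
  using AE_regular mdraw_bounds[of _ k n]
  by (intro integrable_const_bound[of _ "real C1"]) (auto elim!: eventually_mono)

lemma gX_integrable:
  assumes k: "k \<in> {1..d}" and g: "g \<in> borel_measurable (Ga n)" "\<And>\<omega>. \<bar>g \<omega>\<bar> \<le> b"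
  shows "(\<lambda>\<omega>. g \<omega> * real (X (Suc n) k \<omega>)) \<in> borel_measurable (Kalg n)"
    "integrable M (\<lambda>\<omega>. g \<omega> * real (X (Suc n) k \<omega>))"
proof -
  have [measurable]: "g \<in> borel_measurable M" by (rule measurable_from_subalg[OF subalgebra_Ga g(1)])
  show "integrable M (\<lambda>\<omega>. g \<omega> * real (X (Suc n) k \<omega>))"
    by (rule F.integrable_bounded_mult[OF X_integrable[OF k]]) (use g in auto)
  show "(\<lambda>\<omega>. g \<omega> * real (X (Suc n) k \<omega>)) \<in> borel_measurable (Kalg n)"
    using measurable_Ga_Kalg[OF g(1)] measurable_new(5)[OF k, of n] by measurable
qed

lemma draw_repl_mean:
  assumes k: "k \<in> {1..d}" and g: "g \<in> borel_measurable (Ga n)" "\<And>\<omega>. \<bar>g \<omega>\<bar> \<le> b"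
  shows "integrable M (\<lambda>\<omega>. g \<omega> * incr n k \<omega>)"
    "(LINT \<omega>|M. g \<omega> * incr n k \<omega>) = mrepl n k * (LINT \<omega>|M. g \<omega> * mdraw n k \<omega>)"
proof -
  have AR: "(\<lambda>\<omega>. real (A (Suc n) k \<omega>)) \<in> borel_measurable (Ralg n)"
    using measurable_new(7)[OF k, of n] by measurable
  note i = indep_integral[OF gX_integrable[OF k g] AR A_moments(1)[OF k]]
  have e: "g \<omega> * incr n k \<omega> = g \<omega> * real (X (Suc n) k \<omega>) * real (A (Suc n) k \<omega>)" for \<omega>
    by (simp add: incr_def)
  show "integrable M (\<lambda>\<omega>. g \<omega> * incr n k \<omega>)" unfolding e by (rule i(2))
  show "(LINT \<omega>|M. g \<omega> * incr n k \<omega>) = mrepl n k * (LINT \<omega>|M. g \<omega> * mdraw n k \<omega>)"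
    unfolding e i(1) draw_mean[OF k g] by (simp add: mrepl_def mean_repl_def mdraw_def)
qed

lemma incr_measurable_M [measurable]: "k \<in> {1..d} \<Longrightarrow> incr n k \<in> borel_measurable M"
  unfolding incr_def [abs_def] by measurable

lemma pow32_incr:
  assumes k: "k \<in> {1..d}"
    and g: "g \<in> borel_measurable (Fa n)" "\<And>\<omega>. 0 \<le> g \<omega> \<and> g \<omega> \<le> 1"
  shows "integrable M (\<lambda>\<omega>. g \<omega> * pow32 (incr n k \<omega>))"
    "(LINT \<omega>|M. g \<omega> * pow32 (incr n k \<omega>)) \<le> sqrt C1 * C2 * (LINT \<omega>|M. g \<omega> * real (X (Suc n) k \<omega>))"
proof -
  have gG: "g \<in> borel_measurable (Ga n)" by (rule measurable_Fa_Ga[OF g(1)])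
  have gb: "\<bar>g \<omega>\<bar> \<le> 1" for \<omega> using g(2)[of \<omega>] by simp
  have [measurable]: "g \<in> borel_measurable M" by (rule F.measurable_F_M[OF g(1)])
  have AR: "(\<lambda>\<omega>. pow32 (real (A (Suc n) k \<omega>))) \<in> borel_measurable (Ralg n)"
    using measurable_new(7)[OF k, of n] by measurable
  note i = indep_integral[OF gX_integrable[OF k gG gb] AR A_moments(3)[OF k]]
  let ?f = "\<lambda>\<omega>. sqrt C1 * (g \<omega> * real (X (Suc n) k \<omega>) * pow32 (real (A (Suc n) k \<omega>)))"
  have fi: "integrable M ?f" using i(2) by (rule integrable_mult_right)
  have le: "AE \<omega> in M. g \<omega> * pow32 (incr n k \<omega>) \<le> ?f \<omega>"
    using AE_regular
  proof eventually_elim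
    case (elim \<omega>)
    have "pow32 (incr n k \<omega>) = pow32 (real (A (Suc n) k \<omega>)) * pow32 (real (X (Suc n) k \<omega>))"
      by (simp add: incr_def pow32_mult)
    also have "\<dots> \<le> pow32 (real (A (Suc n) k \<omega>)) * (sqrt C1 * real (X (Suc n) k \<omega>))"
      using regular_X_le[OF elim k, of n] by (intro mult_left_mono pow32_le_linear) auto
    finally have "g \<omega> * pow32 (incr n k \<omega>)
        \<le> g \<omega> * (pow32 (real (A (Suc n) k \<omega>)) * (sqrt C1 * real (X (Suc n) k \<omega>)))"
      using g(2) by (intro mult_left_mono) auto
    then show ?case by (simp add: ac_simps)
  qed
  show gi: "integrable M (\<lambda>\<omega>. g \<omega> * pow32 (incr n k \<omega>))"
    by (rule Bochner_Integration.integrable_bound[OF fi])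
      (use k le g(2) in \<open>auto simp: abs_mult elim!: eventually_mono intro: order_trans[OF _ abs_ge_self]\<close>)
  have "(LINT \<omega>|M. g \<omega> * pow32 (incr n k \<omega>)) \<le> (LINT \<omega>|M. ?f \<omega>)"
    by (rule integral_mono_AE[OF gi fi le])
  also have "\<dots> = sqrt C1 * ((LINT \<omega>|M. g \<omega> * real (X (Suc n) k \<omega>)) *
      (LINT \<omega>|M. pow32 (real (A (Suc n) k \<omega>))))" by (simp add: i(1))
  also have "\<dots> \<le> sqrt C1 * ((LINT \<omega>|M. g \<omega> * real (X (Suc n) k \<omega>)) * C2)"
    using A_moments(4)[OF k, of n] g(2)
    by (intro mult_left_mono Bochner_Integration.integral_nonneg) auto
  finally show "(LINT \<omega>|M. g \<omega> * pow32 (incr n k \<omega>))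
      \<le> sqrt C1 * C2 * (LINT \<omega>|M. g \<omega> * real (X (Suc n) k \<omega>))" by (simp add: ac_simps)
qed

text \<open>A bound that does not depend on the path: colour \<open>k\<close> gains at least one ball per drawn ball, so
  \<open>cnt i k\<close> dominates one plus the number of earlier draws. That the draw at stage \<open>Suc i\<close> is not yet
  included costs a factor \<open>1 + C1\<close> in the comparison with \<open>sum_div_pow32_le\<close>.\<close>

lemma regular_draws_sum:
  assumes r: "regular \<omega>" and k: "k \<in> {1..d}"
  shows "(\<Sum>i<n. pow32 (1 / cnt i k \<omega>) * real (X (Suc i) k \<omega>)) \<le> 2 * pow32 (1 + real C1)"
proof -
  define x where "x i = real (X (Suc i) k \<omega>)" for i
  define V where "V i = 1 + (\<Sum>j<i. x j)" for i
  have V1: "1 \<le> V i" for i by (simp add: V_def x_def sum_nonneg)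
  have "pow32 (1 / cnt i k \<omega>) \<le> pow32 (1 + real C1) * pow32 (1 / V (Suc i))" for i
  proof -
    have "V (Suc i) = V i + x i" by (simp add: V_def)
    also have "\<dots> \<le> V i + real C1 * V i"
      using regular_X_le[OF r k, of i] mult_left_mono[OF V1[of i], of "real C1"] by (simp add: x_def)
    finally have "V (Suc i) \<le> (1 + real C1) * V i" by (simp add: algebra_simps)
    then have "1 / V i \<le> (1 + real C1) * (1 / V (Suc i))"
      using V1[of i] V1[of "Suc i"] by (simp add: field_simps)
    moreover have "1 / cnt i k \<omega> \<le> 1 / V i"
      using regular_cnt_ge[OF r k, of i] V1[of i] by (intro divide_left_mono) (auto simp: V_def x_def)
    ultimately have "1 / cnt i k \<omega> \<le> (1 + real C1) * (1 / V (Suc i))" by linarith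
    then show ?thesis unfolding pow32_mult[symmetric]
      using cnt_ge_1[OF k, of i \<omega>] V1[of "Suc i"] by (intro pow32_mono) (auto simp: abs_of_nonneg)
  qed
  then have "(\<Sum>i<n. pow32 (1 / cnt i k \<omega>) * x i)
      \<le> (\<Sum>i<n. pow32 (1 + real C1) * pow32 (1 / V (Suc i)) * x i)"
    by (intro sum_mono mult_right_mono) (auto simp: x_def)
  also have "\<dots> = pow32 (1 + real C1) * (\<Sum>i<n. x i * pow32 (1 / V (Suc i)))"
    by (simp add: sum_distrib_left ac_simps)
  also have "\<dots> \<le> pow32 (1 + real C1) * 2"
    unfolding V_def by (intro mult_left_mono sum_div_pow32_le) (auto simp: x_def)
  finally show ?thesis by (simp add: x_def)
qed

lemma scaled_draws_bound:
  assumes k: "k \<in> {1..d}" and c: "\<And>n. c n \<in> borel_measurable (Fa n)"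
    and cb: "\<And>n \<omega>. 0 \<le> c n \<omega> \<and> c n \<omega> \<le> 1 / cnt n k \<omega>"
  shows "\<And>n \<omega>. 0 \<le> pow32 (c n \<omega>) \<and> pow32 (c n \<omega>) \<le> 1"
    and "\<And>n. (\<lambda>\<omega>. pow32 (c n \<omega>)) \<in> borel_measurable (Fa n)"
    and "\<And>n. (\<Sum>i<n. LINT \<omega>|M. pow32 (c i \<omega>) * real (X (Suc i) k \<omega>)) \<le> 2 * pow32 (1 + real C1)"
proof -
  have c1: "c n \<omega> \<le> 1" for n \<omega>
  proof -
    have "1 / cnt n k \<omega> \<le> 1" using cnt_ge_1[OF k, of n \<omega>] by simp
    then show ?thesis using cb[of n \<omega>] by linarith
  qed
  have p01: "0 \<le> pow32 (c n \<omega>) \<and> pow32 (c n \<omega>) \<le> 1" for n \<omega>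
    using pow32_mono[of "c n \<omega>" 1] c1[of n \<omega>] cb[of n \<omega>] by (simp add: pow32_def[of 1])
  then show "\<And>n \<omega>. 0 \<le> pow32 (c n \<omega>) \<and> pow32 (c n \<omega>) \<le> 1" .
  show pF: "(\<lambda>\<omega>. pow32 (c n \<omega>)) \<in> borel_measurable (Fa n)" for n using c[of n] by measurable
  have gi: "integrable M (\<lambda>\<omega>. pow32 (c n \<omega>) * real (X (Suc n) k \<omega>))" for n
    by (rule gX_integrable(2)[OF k measurable_Fa_Ga[OF pF], where b = 1]) (use p01 in auto)
  fix n
  have "(\<Sum>i<n. LINT \<omega>|M. pow32 (c i \<omega>) * real (X (Suc i) k \<omega>))
      = (LINT \<omega>|M. (\<Sum>i<n. pow32 (c i \<omega>) * real (X (Suc i) k \<omega>)))"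
    using gi by simp
  also have "\<dots> \<le> (LINT \<omega>|M. 2 * pow32 (1 + real C1))"
  proof (rule integral_mono_AE)
    show "AE \<omega> in M. (\<Sum>i<n. pow32 (c i \<omega>) * real (X (Suc i) k \<omega>)) \<le> 2 * pow32 (1 + real C1)"
      using AE_regular
    proof eventually_elim
      case (elim \<omega>)
      have "(\<Sum>i<n. pow32 (c i \<omega>) * real (X (Suc i) k \<omega>))
          \<le> (\<Sum>i<n. pow32 (1 / cnt i k \<omega>) * real (X (Suc i) k \<omega>))"
      proof (intro sum_mono mult_right_mono pow32_mono)
        show "\<bar>c i \<omega>\<bar> \<le> \<bar>1 / cnt i k \<omega>\<bar>" for i using cb[of i \<omega>] by linarith
      qed simp
      also have "\<dots> \<le> 2 * pow32 (1 + real C1)" by (rule regular_draws_sum[OF elim k])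
      finally show ?case .
    qed
  qed (use gi in auto)
  finally show "(\<Sum>i<n. LINT \<omega>|M. pow32 (c i \<omega>) * real (X (Suc i) k \<omega>)) \<le> 2 * pow32 (1 + real C1)"
    by (simp add: prob_space)
qed

lemma centred_mart_diff:
  assumes k: "k \<in> {1..d}" shows "F.mart_diff (\<lambda>n \<omega>. incr n k \<omega> - mrepl n k * mdraw n k \<omega>)"
  unfolding F.mart_diff_def
proof (intro allI conjI impI)
  fix n
  have [measurable]: "cnt n k \<in> borel_measurable (Fa (Suc n))" "tot n \<in> borel_measurable (Fa (Suc n))"
    by (rule F.measurable_F_mono[OF _ cnt_measurable[OF k, of n]] F.measurable_F_mono[OF _ tot_measurable[of n]]; simp)+
  have [measurable]: "N (Suc n) \<in> measurable (Fa (Suc n)) (count_space UNIV)"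
    "X (Suc n) k \<in> measurable (Fa (Suc n)) (count_space UNIV)"
    "A (Suc n) k \<in> measurable (Fa (Suc n)) (count_space UNIV)"
    by (rule measurable_new(1), rule measurable_new(2)[OF k], rule measurable_new(3)[OF k])
  show "(\<lambda>\<omega>. incr n k \<omega> - mrepl n k * mdraw n k \<omega>) \<in> borel_measurable (Fa (Suc n))"
    unfolding incr_def mdraw_def by measurable
  have di: "integrable M (incr n k)"
    using draw_repl_mean(1)[OF k, of "\<lambda>_. 1" n 1] by simp
  show "integrable M (\<lambda>\<omega>. incr n k \<omega> - mrepl n k * mdraw n k \<omega>)" using di mdraw_integrable[OF k] by simp
  fix g :: "'a \<Rightarrow> real" and b assume g: "g \<in> borel_measurable (Fa n)" "\<forall>\<omega>. \<bar>g \<omega>\<bar> \<le> b"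
  have [measurable]: "g \<in> borel_measurable M" by (rule F.measurable_F_M[OF g(1)])
  have gu: "integrable M (\<lambda>\<omega>. g \<omega> * mdraw n k \<omega>)"
    by (rule F.integrable_bounded_mult[OF mdraw_integrable[OF k]]) (use g in auto)
  note gd = draw_repl_mean[OF k measurable_Fa_Ga[OF g(1)], of b]
  have "(LINT \<omega>|M. g \<omega> * (incr n k \<omega> - mrepl n k * mdraw n k \<omega>))
      = (LINT \<omega>|M. g \<omega> * incr n k \<omega> - mrepl n k * (g \<omega> * mdraw n k \<omega>))"
    by (simp add: algebra_simps)
  also have "\<dots> = 0" using gd g(2) gu by simp
  finally show "(LINT \<omega>|M. g \<omega> * (incr n k \<omega> - mrepl n k * mdraw n k \<omega>)) = 0" .
qed

text \<open>The martingale input to the growth analysis. It is applied with \<open>c n\<close> equal to \<open>1 / cnt n k\<close> and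
  to \<open>1 / tot n\<close>.\<close>

lemma scaled_increments_convergent:
  assumes k: "k \<in> {1..d}" and c: "\<And>n. c n \<in> borel_measurable (Fa n)"
    and cb: "\<And>n \<omega>. 0 \<le> c n \<omega> \<and> c n \<omega> \<le> 1 / cnt n k \<omega>"
  shows "AE \<omega> in M. convergent (\<lambda>n. \<Sum>i<n. c i \<omega> * (incr i k \<omega> - mrepl i k * mdraw i k \<omega>))"
proof -
  note p = scaled_draws_bound[OF k c cb]
  have c1: "\<bar>c n \<omega>\<bar> \<le> 1" for n \<omega>
  proof -
    have "1 / cnt n k \<omega> \<le> 1" using cnt_ge_1[OF k, of n \<omega>] by simp
    then show ?thesis using cb[of n \<omega>] by linarith
  qed
  let ?D = "\<lambda>n \<omega>. incr n k \<omega> - mrepl n k * mdraw n k \<omega>"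
  let ?E = "sqrt C1 * C2 + pow32 C2 * sqrt C1"
  have D: "F.mart_diff (\<lambda>n \<omega>. c n \<omega> * ?D n \<omega>)"
    by (rule F.mart_diff_transform[OF centred_mart_diff[OF k] c c1])
  have pM [measurable]: "(\<lambda>\<omega>. pow32 (c n \<omega>)) \<in> borel_measurable M" for n
    by (rule F.measurable_F_M[OF p(2)])
  have pu: "integrable M (\<lambda>\<omega>. pow32 (c n \<omega>) * mdraw n k \<omega>)" for n
    by (rule F.integrable_bounded_mult[OF mdraw_integrable[OF k], of _ 1]) (use p(1) in auto)
  let ?f = "\<lambda>n \<omega>. pow32 (c n \<omega>) * pow32 (incr n k \<omega>) + pow32 C2 * sqrt C1 * (pow32 (c n \<omega>) * mdraw n k \<omega>)"
  have pd: "integrable M (\<lambda>\<omega>. pow32 (c n \<omega>) * pow32 (incr n k \<omega>))"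
    "(LINT \<omega>|M. pow32 (c n \<omega>) * pow32 (incr n k \<omega>))
      \<le> sqrt C1 * C2 * (LINT \<omega>|M. pow32 (c n \<omega>) * real (X (Suc n) k \<omega>))" for n
    using pow32_incr[OF k p(2) p(1)] by auto
  have fi: "integrable M (?f n)" for n
    using pd(1) pu by (intro Bochner_Integration.integrable_add integrable_mult_right)
  have le: "AE \<omega> in M. pow32 (c n \<omega> * ?D n \<omega>) \<le> ?f n \<omega>" for n
    using AE_regular
  proof eventually_elim
    case (elim \<omega>)
    have u: "0 \<le> mdraw n k \<omega>" "mdraw n k \<omega> \<le> real C1" using mdraw_bounds[OF elim k] by auto
    have "pow32 (?D n \<omega>) \<le> pow32 (incr n k \<omega>) + pow32 (mrepl n k * mdraw n k \<omega>)"
      using u mrepl_bounds[OF k, of n] by (intro pow32_diff_le) (auto simp: incr_def)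
    also have "pow32 (mrepl n k * mdraw n k \<omega>) \<le> pow32 C2 * (sqrt C1 * mdraw n k \<omega>)"
      unfolding pow32_mult using mrepl_bounds[OF k, of n] u
      by (intro mult_mono pow32_mono pow32_le_linear) auto
    finally have "pow32 (c n \<omega>) * pow32 (?D n \<omega>)
        \<le> pow32 (c n \<omega>) * (pow32 (incr n k \<omega>) + pow32 C2 * (sqrt C1 * mdraw n k \<omega>))"
      by (intro mult_left_mono) auto
    then show ?case
      unfolding pow32_mult distrib_left by (simp only: mult.left_commute mult.commute mult.assoc)
  qed
  have Dm [measurable]: "(\<lambda>\<omega>. c n \<omega> * ?D n \<omega>) \<in> borel_measurable M" for n
    using D F.measurable_F_M by (auto simp: F.mart_diff_def)
  have Di: "integrable M (\<lambda>\<omega>. pow32 (c n \<omega> * ?D n \<omega>))" for n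
  proof (rule Bochner_Integration.integrable_bound[OF fi[of n]])
    show "(\<lambda>\<omega>. pow32 (c n \<omega> * ?D n \<omega>)) \<in> borel_measurable M"
      by (rule measurable_compose[OF Dm pow32_measurable])
    show "AE \<omega> in M. norm (pow32 (c n \<omega> * ?D n \<omega>)) \<le> norm (?f n \<omega>)"
      using le[of n] by eventually_elim (metis abs_ge_self abs_of_nonneg order_trans pow32_nonneg real_norm_def)
  qed
  show ?thesis
  proof (rule F.mart_diff_convergent[OF D Di])
    fix n
    have "(LINT \<omega>|M. pow32 (c i \<omega> * ?D i \<omega>))
        \<le> ?E * (LINT \<omega>|M. pow32 (c i \<omega>) * real (X (Suc i) k \<omega>))" for i
    proof -
      have "(LINT \<omega>|M. pow32 (c i \<omega> * ?D i \<omega>)) \<le> (LINT \<omega>|M. ?f i \<omega>)"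
        by (rule integral_mono_AE[OF Di fi le])
      also have "\<dots> = (LINT \<omega>|M. pow32 (c i \<omega>) * pow32 (incr i k \<omega>))
          + pow32 C2 * sqrt C1 * (LINT \<omega>|M. pow32 (c i \<omega>) * mdraw i k \<omega>)"
        using pd(1) pu by simp
      also have "(LINT \<omega>|M. pow32 (c i \<omega>) * mdraw i k \<omega>) = (LINT \<omega>|M. pow32 (c i \<omega>) * real (X (Suc i) k \<omega>))"
        unfolding mdraw_def
        by (rule draw_mean[OF k measurable_Fa_Ga[OF p(2)], where b = 1, symmetric]) (use p(1) in auto)
      finally show ?thesis using pd(2)[of i] by (simp add: algebra_simps)
    qed
    then have "(\<Sum>i<n. LINT \<omega>|M. pow32 (c i \<omega> * ?D i \<omega>))
        \<le> (\<Sum>i<n. ?E * (LINT \<omega>|M. pow32 (c i \<omega>) * real (X (Suc i) k \<omega>)))"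
      by (rule sum_mono)
    also have "\<dots> \<le> ?E * (2 * pow32 (1 + real C1))"
      unfolding sum_distrib_left[symmetric] using p(3)[of n] C2_nonneg by (intro mult_left_mono) auto
    finally show "(\<Sum>i<n. LINT \<omega>|M. pow32 (c i \<omega> * ?D i \<omega>)) \<le> ?E * (2 * pow32 (1 + real C1))" .
  qed
qed

lemma relative_increments_summable:
  assumes k: "k \<in> {1..d}"
  shows "AE \<omega> in M. summable (\<lambda>i. pow32 (incr i k \<omega> / cnt i k \<omega>))"
proof -
  have c: "(\<lambda>\<omega>. 1 / cnt n k \<omega>) \<in> borel_measurable (Fa n)" for n using cnt_measurable[OF k, of n] by measurable
  have cb: "0 \<le> 1 / cnt n k \<omega> \<and> 1 / cnt n k \<omega> \<le> 1 / cnt n k \<omega>" for n \<omega>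
    using cnt_ge_1[OF k, of n \<omega>] by simp
  note p = scaled_draws_bound[OF k c cb]
  have e: "pow32 (incr i k \<omega> / cnt i k \<omega>) = pow32 (1 / cnt i k \<omega>) * pow32 (incr i k \<omega>)" for i \<omega>
    by (simp add: pow32_mult[symmetric])
  note pd = pow32_incr[OF k p(2) p(1)]
  have "(\<Sum>i<n. LINT \<omega>|M. pow32 (1 / cnt i k \<omega>) * pow32 (incr i k \<omega>))
      \<le> sqrt C1 * C2 * (2 * pow32 (1 + real C1))" for n
  proof -
    have "(\<Sum>i<n. LINT \<omega>|M. pow32 (1 / cnt i k \<omega>) * pow32 (incr i k \<omega>))
        \<le> (\<Sum>i<n. sqrt C1 * C2 * (LINT \<omega>|M. pow32 (1 / cnt i k \<omega>) * real (X (Suc i) k \<omega>)))"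
      by (intro sum_mono pd(2))
    also have "\<dots> \<le> sqrt C1 * C2 * (2 * pow32 (1 + real C1))"
      unfolding sum_distrib_left[symmetric] using p(3)[of n] C2_nonneg by (intro mult_left_mono) auto
    finally show ?thesis .
  qed
  then show ?thesis unfolding e by (intro AE_summable_of_bounded_integrals pd(1)) auto
qed

theorem AE_reinforced_path:
  assumes t: "1 \<le> t" "t \<le> d"
    and lim: "\<And>k. k \<in> {1..d} \<Longrightarrow> (\<lambda>n. mrepl n k) \<longlonglongrightarrow> m k"
    and top: "\<And>n k. k \<in> {1..t} \<Longrightarrow> mrepl n k = mrepl n 1"
    and gap: "\<And>k. k \<in> {1..d} \<Longrightarrow> k \<notin> {1..t} \<Longrightarrow> m k < m 1"
  shows "AE \<omega> in M. reinforced_path d t (\<lambda>n k. cnt n k \<omega>) (\<lambda>n k. incr n k \<omega>) mrepl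
    (\<lambda>n. real (N (Suc n) \<omega>)) (\<lambda>n. tot n \<omega>) m C2 (real C1)"
proof -
  have A: "AE \<omega> in M. \<forall>k\<in>{1..d}. convergent (\<lambda>n. \<Sum>i<n. (1 / cnt i k \<omega>) * (incr i k \<omega> - mrepl i k * mdraw i k \<omega>))"
  proof (intro AE_finite_allI scaled_increments_convergent)
    fix k n \<omega> assume k: "k \<in> {1..d}"
    show "(\<lambda>\<omega>. 1 / cnt n k \<omega>) \<in> borel_measurable (Fa n)" using cnt_measurable[OF k, of n] by measurable
    show "0 \<le> 1 / cnt n k \<omega> \<and> 1 / cnt n k \<omega> \<le> 1 / cnt n k \<omega>" using cnt_ge_1[OF k, of n \<omega>] by simp
  qed auto
  have B: "AE \<omega> in M. \<forall>k\<in>{1..d}. convergent (\<lambda>n. \<Sum>i<n. (1 / tot i \<omega>) * (incr i k \<omega> - mrepl i k * mdraw i k \<omega>))"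
  proof (intro AE_finite_allI scaled_increments_convergent)
    fix k n \<omega> assume k: "k \<in> {1..d}"
    show "(\<lambda>\<omega>. 1 / tot n \<omega>) \<in> borel_measurable (Fa n)" using tot_measurable[of n] by measurable
    show "0 \<le> 1 / tot n \<omega> \<and> 1 / tot n \<omega> \<le> 1 / cnt n k \<omega>"
      using cnt_ge_1[OF k, of n \<omega>] cnt_le_tot[OF k, of n \<omega>] by (auto simp: frac_le)
  qed auto
  have C: "AE \<omega> in M. \<forall>k\<in>{1..d}. summable (\<lambda>i. pow32 (incr i k \<omega> / cnt i k \<omega>))"
    by (intro AE_finite_allI relative_increments_summable) auto
  from A B C AE_regular show ?thesis
  proof eventually_elim
    case (elim \<omega>)
    show ?case
    proof
      show "1 \<le> d" using colours by simp
      show "diverges (\<lambda>n. tot n \<omega>)"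
        by (rule filterlim_at_top_mono[OF filterlim_real_sequentially])
          (simp add: regular_tot_ge[OF elim(4)])
      show "0 < m k" if "k \<in> {1..d}" for k
      proof -
        have "1 \<le> m k" using lim[OF that] mrepl_bounds[OF that] by (intro LIMSEQ_le_const) auto
        then show ?thesis by simp
      qed
      fix n k assume k: "k \<in> {1..d}"
      show "0 < cnt n k \<omega>" using cnt_ge_1[OF k, of n \<omega>] by simp
      show "0 \<le> incr n k \<omega>" by (simp add: incr_def)
      show "0 \<le> mrepl n k \<and> mrepl n k \<le> C2" using mrepl_bounds[OF k, of n] by simp
      show "convergent (\<lambda>n. \<Sum>i<n. (incr i k \<omega> - mrepl i k * (real (N (Suc i) \<omega>) * (cnt i k \<omega> / tot i \<omega>))) / cnt i k \<omega>)"
        using elim(1) k by (auto simp: mdraw_def)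
      show "convergent (\<lambda>n. \<Sum>i<n. (incr i k \<omega> - mrepl i k * (real (N (Suc i) \<omega>) * (cnt i k \<omega> / tot i \<omega>))) / tot i \<omega>)"
        using elim(2) k by (auto simp: mdraw_def)
      show "summable (\<lambda>i. pow32 (incr i k \<omega> / cnt i k \<omega>))" using elim(3) k by auto
      show "cnt (Suc n) k \<omega> = cnt n k \<omega> + incr n k \<omega>" by (rule cnt_Suc)
      show "(\<lambda>n. mrepl n k) \<longlonglongrightarrow> m k" by (rule lim[OF k])
      show "m k < m 1" if "k \<notin> {1..t}" by (rule gap[OF k that])
    next
      fix n
      show "tot n \<omega> = (\<Sum>k=1..d. cnt n k \<omega>)" by (rule tot_eq)
      show "1 \<le> real (N (Suc n) \<omega>) \<and> real (N (Suc n) \<omega>) \<le> real C1"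
        using regular_N[OF elim(4), of n] by simp
      show "mrepl n k = mrepl n 1" if "k \<in> {1..t}" for k by (rule top[OF that])
    qed (rule t)+
  qed
qed

end

section \<open>Conditional means of the draws and weighted averages of the replacements\<close>

context reinforced_urn
begin

text \<open>A colour that is no longer drawn stops growing.\<close>

lemma infinitely_many_draws:
  assumes k: "k \<in> {1..d}" and h: "diverges (\<lambda>n. cnt n k \<omega>)"
  shows "\<exists>i\<ge>n. 1 \<le> X (Suc i) k \<omega>"
proof (rule ccontr)
  assume "\<not> (\<exists>i\<ge>n. 1 \<le> X (Suc i) k \<omega>)"
  then have z: "X (Suc i) k \<omega> = 0" if "i \<ge> n" for i using that by (cases "X (Suc i) k \<omega>") fastforce+
  have "cnt m k \<omega> = cnt n k \<omega>" if "m \<ge> n" for m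
    using that
  proof (induction m rule: dec_induct)
    case (step m) then show ?case using z[of m] by (simp add: cnt_Suc incr_def)
  qed simp
  moreover have "eventually (\<lambda>m. cnt n k \<omega> < cnt m k \<omega>) sequentially"
    using h unfolding filterlim_at_top_dense by blast
  then obtain n1 where "\<And>m. m \<ge> n1 \<Longrightarrow> cnt n k \<omega> < cnt m k \<omega>" by (auto simp: eventually_sequentially)
  ultimately show False using max.cobounded1[of n n1] max.cobounded2[of n1 n] by (metis less_irrefl)
qed

lemma cond_exp_eqI:
  assumes f: "integrable M f" and g: "g \<in> borel_measurable (Fa n)" "integrable M g"
    and eq: "\<And>B. B \<in> sets (Fa n) \<Longrightarrow> (LINT \<omega>|M. indicator B \<omega> * f \<omega>) = (LINT \<omega>|M. indicator B \<omega> * g \<omega>)"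
  shows "AE \<omega> in M. real_cond_exp M (Fa n) f \<omega> = g \<omega>"
proof -
  interpret S: finite_measure_subalgebra M "Fa n" by (rule F.finite_measure_subalgebra_F)
  show ?thesis
    by (rule S.real_cond_exp_charact) (use assms in \<open>simp_all add: set_lebesgue_integral_def\<close>)
qed

lemma integrable_bounded:
  fixes f :: "'a \<Rightarrow> real"
  assumes "f \<in> borel_measurable M" "\<And>\<omega>. regular \<omega> \<Longrightarrow> \<bar>f \<omega>\<bar> \<le> b"
  shows "integrable M f"
  using AE_regular assms by (intro integrable_const_bound[of _ b]) (auto elim!: eventually_mono)

lemma cond_exp_draw_fraction:
  assumes k: "k \<in> {1..d}"
  shows "AE \<omega> in M. real_cond_exp M (Fa n) (\<lambda>\<omega>. real (X (Suc n) k \<omega>) / real (N (Suc n) \<omega>)) \<omega>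
    = cnt n k \<omega> / tot n \<omega>"
proof (rule cond_exp_eqI)
  have [measurable]: "X (Suc n) k \<in> measurable M (count_space UNIV)" "cnt n k \<in> borel_measurable M"
    using k by simp_all
  show "(\<lambda>\<omega>. cnt n k \<omega> / tot n \<omega>) \<in> borel_measurable (Fa n)"
    using cnt_measurable[OF k, of n] tot_measurable[of n] by measurable
  show "integrable M (\<lambda>\<omega>. real (X (Suc n) k \<omega>) / real (N (Suc n) \<omega>))"
    using regular_X[OF _ k, of _ n] by (intro integrable_bounded[of _ 1]) (auto simp: divide_le_eq_1)
  show "integrable M (\<lambda>\<omega>. cnt n k \<omega> / tot n \<omega>)"
  proof (rule integrable_bounded[of _ 1])
    show "\<bar>cnt n k \<omega> / tot n \<omega>\<bar> \<le> 1" for \<omega>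
      using cnt_le_tot[OF k, of n \<omega>] cnt_ge_1[OF k, of n \<omega>] by simp
  qed measurable
  fix B assume B: "B \<in> sets (Fa n)"
  have BM [measurable]: "B \<in> sets M" using B F.subalg[of n] by (auto simp: subalgebra_def)
  have BG: "(indicator B :: 'a \<Rightarrow> real) \<in> borel_measurable (Ga n)"
    by (rule measurable_Fa_Ga) (use B in simp)
  have g: "(\<lambda>\<omega>. indicator B \<omega> / real (N (Suc n) \<omega>)) \<in> borel_measurable (Ga n)"
    using BG measurable_new(4)[of n] by measurable
  have gb: "\<bar>indicator B \<omega> / real (N (Suc n) \<omega>)\<bar> \<le> 1" for \<omega>
    by (cases "N (Suc n) \<omega> = 0") (auto simp: indicator_def)
  have "(LINT \<omega>|M. indicator B \<omega> * (real (X (Suc n) k \<omega>) / real (N (Suc n) \<omega>)))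
      = (LINT \<omega>|M. indicator B \<omega> / real (N (Suc n) \<omega>) * real (X (Suc n) k \<omega>))" by simp
  also have "\<dots> = (LINT \<omega>|M. indicator B \<omega> / real (N (Suc n) \<omega>) *
      (real (N (Suc n) \<omega>) * (cnt n k \<omega> / tot n \<omega>)))"
    by (rule draw_mean[OF k g gb])
  also have "\<dots> = (LINT \<omega>|M. indicator B \<omega> * (cnt n k \<omega> / tot n \<omega>))"
  proof (rule integral_cong_AE)
    show "AE \<omega> in M. indicator B \<omega> / real (N (Suc n) \<omega>) * (real (N (Suc n) \<omega>) * (cnt n k \<omega> / tot n \<omega>))
        = indicator B \<omega> * (cnt n k \<omega> / tot n \<omega>)"
      using AE_regular
    proof eventually_elim
      case (elim \<omega>)
      then show ?case using regular_N[OF elim, of n] by simp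
    qed
  qed measurable
  finally show "(LINT \<omega>|M. indicator B \<omega> * (real (X (Suc n) k \<omega>) / real (N (Suc n) \<omega>)))
      = (LINT \<omega>|M. indicator B \<omega> * (cnt n k \<omega> / tot n \<omega>))" .
qed

text \<open>Pairs of distinctly coloured balls: the number \<open>N (Suc n)\<close> is not known at time \<open>n\<close>, so its
  factorial moment is averaged a second time.\<close>

lemma cond_exp_draw_pair:
  assumes k: "k \<in> {1..d}" "l \<in> {1..d}" "k \<noteq> l"
  shows "AE \<omega> in M. real_cond_exp M (Fa n) (\<lambda>\<omega>. real (X (Suc n) k \<omega>) * real (X (Suc n) l \<omega>)) \<omega>
    = (real_cond_exp M (Fa n) (\<lambda>\<omega>. (real (N (Suc n) \<omega>))\<^sup>2) \<omega>
        - real_cond_exp M (Fa n) (\<lambda>\<omega>. real (N (Suc n) \<omega>)) \<omega>)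
      * (cnt n k \<omega> * cnt n l \<omega> / (tot n \<omega> * (tot n \<omega> - 1)))"
proof -
  interpret S: finite_measure_subalgebra M "Fa n" by (rule F.finite_measure_subalgebra_F)
  define r where "r \<omega> = cnt n k \<omega> * cnt n l \<omega> / (tot n \<omega> * (tot n \<omega> - 1))" for \<omega>
  let ?N = "\<lambda>\<omega>. real (N (Suc n) \<omega>)" and ?N2 = "\<lambda>\<omega>. (real (N (Suc n) \<omega>))\<^sup>2"
  have [measurable]: "X (Suc n) k \<in> measurable M (count_space UNIV)"
    "X (Suc n) l \<in> measurable M (count_space UNIV)" using k by simp_all
  have rF: "r \<in> borel_measurable (Fa n)"
    unfolding r_def [abs_def]
    using cnt_measurable[OF k(1), of n] cnt_measurable[OF k(2), of n] tot_measurable[of n] by measurable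
  have rM [measurable]: "r \<in> borel_measurable M" by (rule F.measurable_F_M[OF rF])
  have rb: "\<bar>r \<omega>\<bar> \<le> 2" for \<omega>
  proof -
    have h: "0 \<le> cnt n k \<omega>" "0 \<le> cnt n l \<omega>" using cnt_ge_1[OF k(1), of n \<omega>] cnt_ge_1[OF k(2), of n \<omega>] by auto
    have s: "2 \<le> tot n \<omega>" by (rule tot_ge_2)
    have "cnt n k \<omega> * cnt n l \<omega> \<le> tot n \<omega> * tot n \<omega>"
      using cnt_le_tot[OF k(1)] cnt_le_tot[OF k(2)] h s by (intro mult_mono) auto
    also have "\<dots> \<le> tot n \<omega> * (2 * (tot n \<omega> - 1))" using s by (intro mult_left_mono) auto
    finally have "r \<omega> \<le> 2" unfolding r_def using s by (simp add: divide_le_eq algebra_simps)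
    moreover have "0 \<le> r \<omega>" unfolding r_def using h s by auto
    ultimately show ?thesis by simp
  qed
  have Ni: "integrable M ?N" "integrable M ?N2"
  proof -
    show "integrable M ?N" by (rule integrable_bounded[of _ "real C1"]) (auto simp: regular_N)
    show "integrable M ?N2" by (rule integrable_bounded[of _ "(real C1)\<^sup>2"]) (auto simp: regular_N)
  qed
  have ri: "integrable M (\<lambda>\<omega>. r \<omega> * f \<omega>)" if "integrable M f" for f :: "'a \<Rightarrow> real"
    by (rule F.integrable_bounded_mult[OF that rM, of 2]) (use rb in simp)
  have "AE \<omega> in M. real_cond_exp M (Fa n) (\<lambda>\<omega>. real (X (Suc n) k \<omega>) * real (X (Suc n) l \<omega>)) \<omega>
    = r \<omega> * real_cond_exp M (Fa n) ?N2 \<omega> - r \<omega> * real_cond_exp M (Fa n) ?N \<omega>"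
  proof (rule cond_exp_eqI)
    show "integrable M (\<lambda>\<omega>. real (X (Suc n) k \<omega>) * real (X (Suc n) l \<omega>))"
      using regular_X_le[OF _ k(1), of _ n] regular_X_le[OF _ k(2), of _ n]
      by (intro integrable_bounded[of _ "real C1 * real C1"]) (auto simp: abs_mult intro!: mult_mono)
    show "integrable M (\<lambda>\<omega>. r \<omega> * real_cond_exp M (Fa n) ?N2 \<omega> - r \<omega> * real_cond_exp M (Fa n) ?N \<omega>)"
      by (intro Bochner_Integration.integrable_diff ri S.real_cond_exp_int Ni)
    show "(\<lambda>\<omega>. r \<omega> * real_cond_exp M (Fa n) ?N2 \<omega> - r \<omega> * real_cond_exp M (Fa n) ?N \<omega>)
        \<in> borel_measurable (Fa n)"
      using rF by measurable
    fix B assume B: "B \<in> sets (Fa n)"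
    have BM [measurable]: "B \<in> sets M" using B F.subalg[of n] by (auto simp: subalgebra_def)
    have BF: "(\<lambda>\<omega>. indicator B \<omega> * r \<omega>) \<in> borel_measurable (Fa n)" using B rF by measurable
    have Bi: "integrable M (\<lambda>\<omega>. indicator B \<omega> * (r \<omega> * f \<omega>))" if "integrable M f" for f :: "'a \<Rightarrow> real"
      by (rule F.integrable_bounded_mult[OF ri[OF that], of _ 1]) (auto simp: indicator_def)
    have rc: "(LINT \<omega>|M. indicator B \<omega> * (r \<omega> * real_cond_exp M (Fa n) f \<omega>))
        = (LINT \<omega>|M. indicator B \<omega> * (r \<omega> * f \<omega>))" if "integrable M f" for f :: "'a \<Rightarrow> real"
      using S.real_cond_exp_intg(2)[OF _ BF, of f] Bi[OF that] that by (simp add: mult.assoc)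
    have "(LINT \<omega>|M. indicator B \<omega> * (real (X (Suc n) k \<omega>) * real (X (Suc n) l \<omega>)))
        = (LINT \<omega>|M. indicator B \<omega> * ((?N \<omega> * (?N \<omega> - 1)) * r \<omega>))"
      unfolding r_def
    proof (rule draw_mixed_moment[OF k, where b = 1])
      show "(indicator B :: 'a \<Rightarrow> real) \<in> borel_measurable (Ga n)"
        by (rule measurable_Fa_Ga) (use B in simp)
    qed (simp add: indicator_def)
    also have "\<dots> = (LINT \<omega>|M. indicator B \<omega> * (r \<omega> * ?N2 \<omega>) - indicator B \<omega> * (r \<omega> * ?N \<omega>))"
      by (simp add: algebra_simps power2_eq_square)
    also have "\<dots> = (LINT \<omega>|M. indicator B \<omega> * (r \<omega> * ?N2 \<omega>)) - (LINT \<omega>|M. indicator B \<omega> * (r \<omega> * ?N \<omega>))"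
      by (intro Bochner_Integration.integral_diff Bi Ni)
    also have "\<dots> = (LINT \<omega>|M. indicator B \<omega> * (r \<omega> * real_cond_exp M (Fa n) ?N2 \<omega>))
        - (LINT \<omega>|M. indicator B \<omega> * (r \<omega> * real_cond_exp M (Fa n) ?N \<omega>))"
      by (simp only: rc[OF Ni(1)] rc[OF Ni(2)])
    also have "\<dots> = (LINT \<omega>|M. indicator B \<omega> * (r \<omega> * real_cond_exp M (Fa n) ?N2 \<omega>)
        - indicator B \<omega> * (r \<omega> * real_cond_exp M (Fa n) ?N \<omega>))"
      by (intro Bochner_Integration.integral_diff[symmetric] Bi S.real_cond_exp_int Ni)
    finally show "(LINT \<omega>|M. indicator B \<omega> * (real (X (Suc n) k \<omega>) * real (X (Suc n) l \<omega>)))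
        = (LINT \<omega>|M. indicator B \<omega> * (r \<omega> * real_cond_exp M (Fa n) ?N2 \<omega>
        - r \<omega> * real_cond_exp M (Fa n) ?N \<omega>))" by (simp add: right_diff_distrib)
  qed
  then show ?thesis
    unfolding r_def [symmetric] by eventually_elim (simp add: algebra_simps)
qed

lemma repl_slln:
  assumes wK: "\<And>n. w n \<in> borel_measurable (Kalg n)"
    and wb: "\<And>n \<omega>. regular \<omega> \<Longrightarrow> 0 \<le> w n \<omega> \<and> w n \<omega> \<le> b"
    and YR: "\<And>n. Y n \<in> borel_measurable (Ralg n)" and Y0: "\<And>n \<omega>. 0 \<le> Y n \<omega>"
    and Yi: "\<And>n. integrable M (\<lambda>\<omega>. pow32 (Y n \<omega>))"
    and YC: "\<And>n. (LINT \<omega>|M. pow32 (Y n \<omega>)) \<le> C"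
    and lim: "(\<lambda>n. LINT \<omega>|M. Y n \<omega>) \<longlonglongrightarrow> y"
  shows "AE \<omega> in M. diverges (\<lambda>n. \<Sum>i<n. w i \<omega>) \<longrightarrow>
    (\<lambda>n. (\<Sum>i<n. w i \<omega> * Y i \<omega>) / (\<Sum>i<n. w i \<omega>)) \<longlonglongrightarrow> y"
proof (rule K.weighted_slln[OF wK _ _ Y0 Yi YC _ lim])
  fix n
  have "subalgebra (Kalg (Suc n)) (Ralg n)"
    unfolding Kalg_def Ralg_def using history_new(3) by (intro subalgebra_gen_algebra_mono) auto
  then show YK: "Y n \<in> borel_measurable (Kalg (Suc n))" by (rule measurable_from_subalg[OF _ YR])
  have [measurable]: "Y n \<in> borel_measurable M" by (rule K.measurable_F_M[OF YK])
  have Yi1: "integrable M (Y n)" by (rule F.integrable_of_pow32) (simp_all add: Yi)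
  show "AE \<omega> in M. 0 \<le> w n \<omega> \<and> w n \<omega> \<le> b" using AE_regular by eventually_elim (rule wb)
  fix g :: "'a \<Rightarrow> real" and B assume g: "g \<in> borel_measurable (Kalg n)" "\<And>\<omega>. \<bar>g \<omega>\<bar> \<le> B"
  have gi: "integrable M g"
    by (rule integrable_const_bound[of _ B]) (use g K.measurable_F_M[OF g(1)] in auto)
  have pR: "(\<lambda>\<omega>. pow32 (Y n \<omega>)) \<in> borel_measurable (Ralg n)" using YR[of n] by measurable
  show "(LINT \<omega>|M. g \<omega> * Y n \<omega>) = (LINT \<omega>|M. g \<omega>) * (LINT \<omega>|M. Y n \<omega>) \<and>
      (LINT \<omega>|M. g \<omega> * pow32 (Y n \<omega>)) = (LINT \<omega>|M. g \<omega>) * (LINT \<omega>|M. pow32 (Y n \<omega>))"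
    by (intro conjI indep_integral(1)[OF g(1) gi] YR Yi1 pR Yi)
qed

end

section \<open>Strong consistency\<close>

lemma sum_from_1: "(\<Sum>j=1..n. f j) = (\<Sum>i<n. f (Suc i))"
  by (simp add: sum.atLeast1_atMost_eq)

theorem theorem4p1:
  fixes M :: "'a measure" and d C1 t :: nat and H0 :: "nat \<Rightarrow> nat" and C2 :: real
    and N :: "nat \<Rightarrow> 'a \<Rightarrow> nat"
    and X A :: "nat \<Rightarrow> nat \<Rightarrow> 'a \<Rightarrow> nat"
    and m q :: "nat \<Rightarrow> real" and qq :: "nat \<Rightarrow> nat \<Rightarrow> real"
    and Nlim Qlim :: "'a \<Rightarrow> real"
  assumes urn: "reinforced_urn M d H0 C1 N X A"
    and A1: "\<And>k. k \<in> {1..d} \<Longrightarrow>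
      (SUP n\<in>{1..}. \<integral>\<^sup>+\<omega>. ennreal (real (A n k \<omega>) ^ 3) \<partial>M) < ennreal C2"
    and A2_lim: "\<And>k. k \<in> {1..d} \<Longrightarrow> (\<lambda>n. mean_repl M A n k) \<longlonglongrightarrow> m k"
    and A2_t: "t \<in> {1..d}"
    and A2_top: "\<And>k. k \<in> {1..t} \<Longrightarrow> m k = m 1"
    and A2_gap: "t < d \<Longrightarrow> m (t + 1) < m t"
    and A2_decr: "\<And>k. k \<in> {t+1..<d} \<Longrightarrow> m (k + 1) \<le> m k"
    and A2_eq: "\<And>n k. n \<ge> 1 \<Longrightarrow> k \<in> {1..t} \<Longrightarrow> mean_repl M A n k = mean_repl M A n 1"
    and A3: "\<And>k j. k \<in> {1..d} \<Longrightarrow> j \<in> {1..d} \<Longrightarrow>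
      (\<lambda>n. \<bar>mean_repl M A (n + 1) k * m j - m k * mean_repl M A (n + 1) j\<bar> / real n)
        summable_on {1..}"
    and N_rv: "Nlim \<in> borel_measurable M"
    and N_lim: "AE \<omega> in M.
      (\<lambda>n. real_cond_exp M (F_alg M d N X A n) (\<lambda>\<omega>. real (N (n + 1) \<omega>)) \<omega>) \<longlonglongrightarrow> Nlim \<omega>"
    and Q_rv: "Qlim \<in> borel_measurable M"
    and Q_lim: "AE \<omega> in M.
      (\<lambda>n. real_cond_exp M (F_alg M d N X A n) (\<lambda>\<omega>. (real (N (n + 1) \<omega>))\<^sup>2) \<omega>) \<longlonglongrightarrow> Qlim \<omega>"
  shows
    "(AE \<omega> in M. (\<lambda>n. mu_hat N n \<omega>) \<longlonglongrightarrow> Nlim \<omega>) \<and>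
     (AE \<omega> in M. (\<lambda>n. qN_hat N n \<omega>) \<longlonglongrightarrow> Qlim \<omega>) \<and>
     (\<forall>k\<in>{1..d}. AE \<omega> in M.
        convergent (\<lambda>n. proportion d H0 X A n k \<omega>) \<and>
        (\<lambda>n. nu_hat N X n k \<omega>) \<longlonglongrightarrow> lim (\<lambda>n. proportion d H0 X A n k \<omega>)) \<and>
     (\<forall>k\<in>{1..d}. AE \<omega> in M. (\<lambda>n. m_hat X A n k \<omega>) \<longlonglongrightarrow> m k) \<and>
     ((\<forall>k\<in>{1..d}. (\<lambda>n. \<integral>\<omega>. (real (A n k \<omega>))\<^sup>2 \<partial>M) \<longlonglongrightarrow> q k) \<and>
      (\<forall>k\<in>{1..d}. \<forall>s\<in>{1..d}. (\<lambda>n. \<integral>\<omega>. real (A n k \<omega>) * real (A n s \<omega>) \<partial>M) \<longlonglongrightarrow> qq k s) \<longrightarrow>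
        (\<forall>k\<in>{1..d}. AE \<omega> in M. (\<lambda>n. q_hat X A n k \<omega>) \<longlonglongrightarrow> q k) \<and>
        (AE \<omega> in M. Qlim \<omega> > Nlim \<omega> \<longleftrightarrow> Nlim \<omega> > 1) \<and>
        (\<forall>k\<in>{1..d}. \<forall>s\<in>{1..d}. m k + m s > m 1 \<longrightarrow>
          (AE \<omega> in M. Qlim \<omega> > Nlim \<omega> \<longrightarrow> (\<lambda>n. qq_hat X A n k s \<omega>) \<longlonglongrightarrow> qq k s)) \<and>
        (\<forall>k\<in>{1..d}. \<forall>s\<in>{1..d}. m k + m s \<le> m 1 \<longrightarrow>
          (AE \<omega> in M. (\<lambda>n. qq_tilde X A n k s \<omega>) \<longlonglongrightarrow> qq k s)))"
proof -
  interpret reinforced_urn M d H0 C1 N X A by (rule urn)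
  have one: "1 \<in> {1..d}" using colours by simp
  have C2: "0 \<le> C2"
  proof (rule ccontr)
    assume "\<not> 0 \<le> C2"
    then have "ennreal C2 = 0" by (simp add: ennreal_neg)
    then show False using A1[OF one] by simp
  qed
  interpret bounded_urn M d H0 C1 N X A C2
  proof
    show "0 \<le> C2" by (rule C2)
    fix n k assume k: "k \<in> {1..d}"
    have "(\<integral>\<^sup>+\<omega>. ennreal (real (A (Suc n) k \<omega>) ^ 3) \<partial>M)
        \<le> (SUP n\<in>{1..}. \<integral>\<^sup>+\<omega>. ennreal (real (A n k \<omega>) ^ 3) \<partial>M)" by (rule SUP_upper) simp
    also have "\<dots> \<le> ennreal C2" using A1[OF k] by simp
    finally show "(\<integral>\<^sup>+\<omega>. ennreal (real (A (Suc n) k \<omega>) ^ 3) \<partial>M) \<le> ennreal C2" .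
  qed
  have t: "1 \<le> t" "t \<le> d" using A2_t by auto
  have mrepl_lim: "(\<lambda>n. mrepl n k) \<longlonglongrightarrow> m k" if "k \<in> {1..d}" for k
    unfolding mrepl_def using A2_lim[OF that] by (rule LIMSEQ_Suc)
  have gap: "m k < m 1" if k: "k \<in> {1..d}" "k \<notin> {1..t}" for k
  proof -
    have "t + 1 \<le> k" using k by simp
    then have "k \<le> d \<Longrightarrow> m k \<le> m (t + 1)"
    proof (induction k rule: dec_induct)
      case (step j)
      then show ?case using A2_decr[of j] by simp
    qed simp
    moreover have "m (t + 1) < m t" using A2_gap k by auto
    moreover have "m t = m 1" using A2_top[of t] t by simp
    ultimately show ?thesis using k by simp
  qed
  have mrepl_top: "mrepl n k = mrepl n 1" if "k \<in> {1..t}" for n k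
    unfolding mrepl_def by (rule A2_eq[OF _ that]) simp
  have path: "AE \<omega> in M. reinforced_path d t (\<lambda>n k. cnt n k \<omega>) (\<lambda>n k. incr n k \<omega>) mrepl
    (\<lambda>n. real (N (Suc n) \<omega>)) (\<lambda>n. tot n \<omega>) m C2 (real C1)"
    by (rule AE_reinforced_path[OF t mrepl_lim mrepl_top gap])

  have mu: "AE \<omega> in M. (\<lambda>n. mu_hat N n \<omega>) \<longlonglongrightarrow> Nlim \<omega>"
    unfolding mu_hat_def sum_from_1
  proof (rule F.average_tendsto[where K = "real C1"])
    fix n
    show "(\<lambda>\<omega>. real (N (Suc n) \<omega>)) \<in> borel_measurable (Fa (Suc n))"
      using measurable_new(1)[of n] by measurable
    show "AE \<omega> in M. 0 \<le> real (N (Suc n) \<omega>) \<and> real (N (Suc n) \<omega>) \<le> real C1"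
      using AE_regular by eventually_elim (simp add: regular_N)
  qed (use N_lim in simp)
  have qN: "AE \<omega> in M. (\<lambda>n. qN_hat N n \<omega>) \<longlonglongrightarrow> Qlim \<omega>"
    unfolding qN_hat_def sum_from_1
  proof (rule F.average_tendsto[where K = "(real C1)\<^sup>2"])
    fix n
    show "(\<lambda>\<omega>. (real (N (Suc n) \<omega>))\<^sup>2) \<in> borel_measurable (Fa (Suc n))"
      using measurable_new(1)[of n] by measurable
    show "AE \<omega> in M. 0 \<le> (real (N (Suc n) \<omega>))\<^sup>2 \<and> (real (N (Suc n) \<omega>))\<^sup>2 \<le> (real C1)\<^sup>2"
      using AE_regular by eventually_elim (simp add: regular_N)
  qed (use Q_lim in simp)

  have share: "proportion d H0 X A n k \<omega> = cnt n k \<omega> / tot n \<omega>" for n k \<omega>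
    by (simp add: proportion_def cnt_def tot_def)
  have nu: "AE \<omega> in M. convergent (\<lambda>n. proportion d H0 X A n k \<omega>) \<and>
      (\<lambda>n. nu_hat N X n k \<omega>) \<longlonglongrightarrow> lim (\<lambda>n. proportion d H0 X A n k \<omega>)"
    if k: "k \<in> {1..d}" for k
  proof -
    have conv: "AE \<omega> in M. convergent (\<lambda>n. proportion d H0 X A n k \<omega>)"
      unfolding share using path
    proof eventually_elim
      case (elim \<omega>)
      then interpret reinforced_path d t "\<lambda>n k. cnt n k \<omega>" "\<lambda>n k. incr n k \<omega>" mrepl
        "\<lambda>n. real (N (Suc n) \<omega>)" "\<lambda>n. tot n \<omega>" m C2 "real C1" .
      show ?case by (rule share_convergent[OF k])
    qed
    have "AE \<omega> in M. (\<lambda>n. (\<Sum>i<n. real (X (Suc i) k \<omega>) / real (N (Suc i) \<omega>)) / real n)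
        \<longlonglongrightarrow> lim (\<lambda>n. proportion d H0 X A n k \<omega>)"
    proof (rule F.average_tendsto[where K = 1])
      fix n
      show "(\<lambda>\<omega>. real (X (Suc n) k \<omega>) / real (N (Suc n) \<omega>)) \<in> borel_measurable (Fa (Suc n))"
        using measurable_new(1)[of n] measurable_new(2)[OF k, of n] by measurable
      show "AE \<omega> in M. 0 \<le> real (X (Suc n) k \<omega>) / real (N (Suc n) \<omega>) \<and>
          real (X (Suc n) k \<omega>) / real (N (Suc n) \<omega>) \<le> 1"
        using AE_regular by eventually_elim (auto simp: divide_le_eq_1 regular_X[OF _ k])
    next
      have "AE \<omega> in M. \<forall>n. real_cond_exp M (Fa n)
          (\<lambda>\<omega>. real (X (Suc n) k \<omega>) / real (N (Suc n) \<omega>)) \<omega> = proportion d H0 X A n k \<omega>"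
        unfolding AE_all_countable share using cond_exp_draw_fraction[OF k] by blast
      then show "AE \<omega> in M. (\<lambda>n. real_cond_exp M (Fa n)
          (\<lambda>\<omega>. real (X (Suc n) k \<omega>) / real (N (Suc n) \<omega>)) \<omega>) \<longlonglongrightarrow> lim (\<lambda>n. proportion d H0 X A n k \<omega>)"
        using conv by eventually_elim (simp add: convergent_LIMSEQ_iff)
    qed
    with conv show ?thesis
      by eventually_elim (simp add: nu_hat_def sum_from_1 del: One_nat_def)
  qed

  have often: "AE \<omega> in M. \<forall>k\<in>{1..d}. \<forall>n. \<exists>i\<ge>n. 1 \<le> X (Suc i) k \<omega>"
    using path
  proof eventually_elim
    case (elim \<omega>)
    then interpret reinforced_path d t "\<lambda>n k. cnt n k \<omega>" "\<lambda>n k. incr n k \<omega>" mrepl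
      "\<lambda>n. real (N (Suc n) \<omega>)" "\<lambda>n. tot n \<omega>" m C2 "real C1" .
    show ?case by (intro ballI allI infinitely_many_draws h_at_top)
  qed
  have XK: "(\<lambda>\<omega>. real (X (Suc n) k \<omega>)) \<in> borel_measurable (Kalg n)" if "k \<in> {1..d}" for n k
    using measurable_new(5)[OF that, of n] by measurable
  have AR: "(\<lambda>\<omega>. real (A (Suc n) k \<omega>)) \<in> borel_measurable (Ralg n)" if "k \<in> {1..d}" for n k
    using measurable_new(7)[OF that, of n] by measurable
  have single: "AE \<omega> in M. (\<lambda>n. (\<Sum>i<n. real (X (Suc i) k \<omega>) * Y i \<omega>) / (\<Sum>i<n. real (X (Suc i) k \<omega>))) \<longlonglongrightarrow> y"
    if k: "k \<in> {1..d}" and Y: "\<And>n. Y n \<in> borel_measurable (Ralg n)" "\<And>n \<omega>. 0 \<le> Y n \<omega>"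
      "\<And>n. integrable M (\<lambda>\<omega>. pow32 (Y n \<omega>))" "\<And>n. (LINT \<omega>|M. pow32 (Y n \<omega>)) \<le> C"
      "(\<lambda>n. LINT \<omega>|M. Y n \<omega>) \<longlonglongrightarrow> y" for k Y C y
  proof -
    have "AE \<omega> in M. diverges (\<lambda>n. \<Sum>i<n. real (X (Suc i) k \<omega>)) \<longrightarrow>
      (\<lambda>n. (\<Sum>i<n. real (X (Suc i) k \<omega>) * Y i \<omega>) / (\<Sum>i<n. real (X (Suc i) k \<omega>))) \<longlonglongrightarrow> y"
      by (rule repl_slln[OF XK[OF k] _ Y, of "real C1"]) (simp add: regular_X_le[OF _ k])
    then show ?thesis using often
    proof eventually_elim
      case (elim \<omega>)
      have "diverges (\<lambda>n. \<Sum>i<n. real (X (Suc i) k \<omega>))"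
        using elim(2) k by (intro sum_nat_at_top) blast
      then show ?case using elim(1) by blast
    qed
  qed
  have drawn: "real (drawn X n k \<omega>) = (\<Sum>i<n. real (X (Suc i) k \<omega>))" for n k \<omega>
    unfolding drawn_def sum_from_1 by simp

  have m_hat: "AE \<omega> in M. (\<lambda>n. m_hat X A n k \<omega>) \<longlonglongrightarrow> m k" if k: "k \<in> {1..d}" for k
    using single[OF k AR[OF k] _ A_moments(3)[OF k] A_moments(4)[OF k]] mrepl_lim[OF k]
    unfolding m_hat_def sum_from_1 drawn by (simp add: mrepl_def mean_repl_def mult.commute)

  have pair_moment: "(\<lambda>\<omega>. real (A (Suc n) k \<omega>) * real (A (Suc n) s \<omega>)) \<in> borel_measurable (Ralg n)"
    if "k \<in> {1..d}" "s \<in> {1..d}" for n k s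
    using AR[OF that(1), of n] AR[OF that(2), of n] by measurable

  \<comment> \<open>2 (x - 1) is at most x^2 - x, which is at most C1 (x - 1), for integers x between 1 and C1; this survives averaging and passing to the limit\<close>
  have QN: "AE \<omega> in M. 2 * (Nlim \<omega> - 1) \<le> Qlim \<omega> - Nlim \<omega> \<and> Qlim \<omega> - Nlim \<omega> \<le> real C1 * (Nlim \<omega> - 1)"
    using mu qN AE_regular
  proof eventually_elim
    case (elim \<omega>)
    have b: "2 * (mu_hat N n \<omega> - 1) \<le> qN_hat N n \<omega> - mu_hat N n \<omega> \<and>
        qN_hat N n \<omega> - mu_hat N n \<omega> \<le> real C1 * (mu_hat N n \<omega> - 1)" if n: "1 \<le> n" for n
    proof -
      let ?N = "\<lambda>i. real (N (Suc i) \<omega>)"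
      have N: "1 \<le> ?N i" "?N i \<le> real C1" "?N i = 1 \<or> 2 \<le> ?N i" for i
        using regular_N[OF elim(3), of i] by (auto simp: Suc_le_eq le_less)
      have s1: "(\<Sum>i<n. 2 * (?N i - 1)) \<le> (\<Sum>i<n. (?N i)\<^sup>2 - ?N i)"
      proof (rule sum_mono)
        fix i
        have "2 * (?N i - 1) \<le> ?N i * (?N i - 1)"
          using N(1)[of i] N(3)[of i] mult_right_mono[of 2 "?N i" "?N i - 1"] by auto
        then show "2 * (?N i - 1) \<le> (?N i)\<^sup>2 - ?N i" by (simp add: power2_eq_square algebra_simps)
      qed
      have s2: "(\<Sum>i<n. (?N i)\<^sup>2 - ?N i) \<le> (\<Sum>i<n. real C1 * (?N i - 1))"
      proof (rule sum_mono)
        fix i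
        have "?N i * (?N i - 1) \<le> real C1 * (?N i - 1)"
          using N(1,2)[of i] by (intro mult_right_mono) auto
        then show "(?N i)\<^sup>2 - ?N i \<le> real C1 * (?N i - 1)" by (simp add: power2_eq_square algebra_simps)
      qed
      have e1: "(\<Sum>i<n. c * (?N i - 1)) / real n = c * (mu_hat N n \<omega> - 1)" for c
      proof -
        have "(\<Sum>i<n. c * (?N i - 1)) = c * ((\<Sum>i<n. ?N i) - real n)"
          by (simp add: sum_distrib_left[symmetric] sum_subtractf)
        then show ?thesis
          using n by (simp add: mu_hat_def sum_from_1 field_simps del: One_nat_def)
      qed
      have e2: "(\<Sum>i<n. (?N i)\<^sup>2 - ?N i) / real n = qN_hat N n \<omega> - mu_hat N n \<omega>"
        by (simp add: mu_hat_def qN_hat_def sum_from_1 sum_subtractf diff_divide_distrib del: One_nat_def)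
      show ?thesis
        using divide_right_mono[OF s1, of "real n"] divide_right_mono[OF s2, of "real n"]
        unfolding e1 e2 by simp
    qed
    have "2 * (Nlim \<omega> - 1) \<le> Qlim \<omega> - Nlim \<omega>"
      by (rule LIMSEQ_le[of "\<lambda>n. 2 * (mu_hat N n \<omega> - 1)" _ "\<lambda>n. qN_hat N n \<omega> - mu_hat N n \<omega>"])
        (use b elim in \<open>auto intro!: tendsto_intros\<close>)
    moreover have "Qlim \<omega> - Nlim \<omega> \<le> real C1 * (Nlim \<omega> - 1)"
      by (rule LIMSEQ_le[of "\<lambda>n. qN_hat N n \<omega> - mu_hat N n \<omega>" _ "\<lambda>n. real C1 * (mu_hat N n \<omega> - 1)"])
        (use b elim in \<open>auto intro!: tendsto_intros\<close>)
    ultimately show ?case by simp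
  qed
  have event: "AE \<omega> in M. Qlim \<omega> > Nlim \<omega> \<longleftrightarrow> Nlim \<omega> > 1"
    using QN
  proof eventually_elim
    case (elim \<omega>)
    have "Nlim \<omega> > 1" if "Qlim \<omega> > Nlim \<omega>"
    proof -
      have "0 < real C1 * (Nlim \<omega> - 1)" using elim that by linarith
      then show ?thesis by (simp add: zero_less_mult_iff)
    qed
    then show ?case using elim by auto
  qed

  have pair_draws: "AE \<omega> in M. Qlim \<omega> > Nlim \<omega> \<longrightarrow>
      diverges (\<lambda>n. \<Sum>i<n. real (X (Suc i) k \<omega>) * real (X (Suc i) s \<omega>))"
    if k: "k \<in> {1..d}" "s \<in> {1..d}" and g: "m k + m s > m 1" for k s
  proof (cases "k = s")
    case True
    show ?thesis
      using often
    proof eventually_elim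
      case (elim \<omega>)
      have "diverges (\<lambda>n. \<Sum>i<n. real (X (Suc i) k \<omega> * X (Suc i) s \<omega>))"
      proof (rule sum_nat_at_top)
        fix n
        obtain i where "i \<ge> n" "1 \<le> X (Suc i) k \<omega>" using elim k by blast
        then show "\<exists>i\<ge>n. 1 \<le> X (Suc i) k \<omega> * X (Suc i) s \<omega>" using True by (intro exI[of _ i]) simp
      qed
      then show ?case by simp
    qed
  next
    case False
    let ?Y = "\<lambda>n \<omega>. real (X (Suc n) k \<omega>) * real (X (Suc n) s \<omega>)"
    have BC: "AE \<omega> in M. diverges (\<lambda>n. \<Sum>i<n. real_cond_exp M (Fa i) (?Y i) \<omega>) \<longrightarrow>
        diverges (\<lambda>n. \<Sum>i<n. ?Y i \<omega>)"
    proof (rule F.cond_borel_cantelli[where K = "real C1 * real C1"])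
      fix n
      show "?Y n \<in> borel_measurable (Fa (Suc n))"
        using measurable_new(2)[OF k(1), of n] measurable_new(2)[OF k(2), of n] by measurable
      show "AE \<omega> in M. 0 \<le> ?Y n \<omega> \<and> ?Y n \<omega> \<le> real C1 * real C1"
        using AE_regular
      proof eventually_elim
        case (elim \<omega>)
        then show ?case using regular_X_le[OF elim k(1), of n] regular_X_le[OF elim k(2), of n]
          by (intro conjI mult_mono) auto
      qed
    qed
    have ce: "AE \<omega> in M. \<forall>n. real_cond_exp M (Fa n) (?Y n) \<omega>
        = (real_cond_exp M (Fa n) (\<lambda>\<omega>. (real (N (Suc n) \<omega>))\<^sup>2) \<omega>
            - real_cond_exp M (Fa n) (\<lambda>\<omega>. real (N (Suc n) \<omega>)) \<omega>)
          * (cnt n k \<omega> * cnt n s \<omega> / (tot n \<omega> * (tot n \<omega> - 1)))"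
      unfolding AE_all_countable using cond_exp_draw_pair[OF k False] by blast
    show ?thesis
      using BC ce path N_lim Q_lim
    proof eventually_elim
      case (elim \<omega>)
      from elim(3) interpret reinforced_path d t "\<lambda>n k. cnt n k \<omega>" "\<lambda>n k. incr n k \<omega>" mrepl
        "\<lambda>n. real (N (Suc n) \<omega>)" "\<lambda>n. tot n \<omega>" m C2 "real C1" .
      show ?case
      proof
        assume pos: "Qlim \<omega> > Nlim \<omega>"
        let ?p = "\<lambda>n. real_cond_exp M (Fa n) (\<lambda>\<omega>. (real (N (Suc n) \<omega>))\<^sup>2) \<omega>
            - real_cond_exp M (Fa n) (\<lambda>\<omega>. real (N (Suc n) \<omega>)) \<omega>"
        have p: "?p \<longlonglongrightarrow> Qlim \<omega> - Nlim \<omega>" using elim(4,5) by (intro tendsto_diff) simp_all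
        have "diverges (\<lambda>n. \<Sum>i<n. ?p i * (cnt i k \<omega> * cnt i s \<omega> / (tot i \<omega> * (tot i \<omega> - 1))))"
          by (rule pair_sum_at_top[OF k g p]) (use pos tot_ge_2 in auto)
        then show "diverges (\<lambda>n. \<Sum>i<n. ?Y i \<omega>)"
          using elim(1,2) by simp
      qed
    qed
  qed

  have second: "(\<forall>k\<in>{1..d}. AE \<omega> in M. (\<lambda>n. q_hat X A n k \<omega>) \<longlonglongrightarrow> q k) \<and>
        (AE \<omega> in M. Qlim \<omega> > Nlim \<omega> \<longleftrightarrow> Nlim \<omega> > 1) \<and>
        (\<forall>k\<in>{1..d}. \<forall>s\<in>{1..d}. m k + m s > m 1 \<longrightarrow>
          (AE \<omega> in M. Qlim \<omega> > Nlim \<omega> \<longrightarrow> (\<lambda>n. qq_hat X A n k s \<omega>) \<longlonglongrightarrow> qq k s)) \<and>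
        (\<forall>k\<in>{1..d}. \<forall>s\<in>{1..d}. m k + m s \<le> m 1 \<longrightarrow>
          (AE \<omega> in M. (\<lambda>n. qq_tilde X A n k s \<omega>) \<longlonglongrightarrow> qq k s))"
    if q: "\<forall>k\<in>{1..d}. (\<lambda>n. LINT \<omega>|M. (real (A n k \<omega>))\<^sup>2) \<longlonglongrightarrow> q k"
      and qq: "\<forall>k\<in>{1..d}. \<forall>s\<in>{1..d}. (\<lambda>n. LINT \<omega>|M. real (A n k \<omega>) * real (A n s \<omega>)) \<longlonglongrightarrow> qq k s"
  proof (intro conjI ballI impI)
    show "AE \<omega> in M. Qlim \<omega> > Nlim \<omega> \<longleftrightarrow> Nlim \<omega> > 1" by (rule event)
  next
    fix k assume k: "k \<in> {1..d}"
    have "(\<lambda>n. LINT \<omega>|M. real (A (Suc n) k \<omega>) * real (A (Suc n) k \<omega>)) \<longlonglongrightarrow> q k"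
      using LIMSEQ_Suc[OF bspec[OF q k]] by (simp add: power2_eq_square)
    from single[OF k pair_moment[OF k k] _ AA_moments(1)[OF k k] AA_moments(2)[OF k k] this]
    show "AE \<omega> in M. (\<lambda>n. q_hat X A n k \<omega>) \<longlonglongrightarrow> q k"
      unfolding q_hat_def sum_from_1 drawn by (simp add: mult.commute power2_eq_square)
  next
    fix k s assume k: "k \<in> {1..d}" "s \<in> {1..d}"
    have lim: "(\<lambda>n. LINT \<omega>|M. real (A (Suc n) k \<omega>) * real (A (Suc n) s \<omega>)) \<longlonglongrightarrow> qq k s"
      using qq k by (intro LIMSEQ_Suc) auto
    from single[OF k(1) pair_moment[OF k] _ AA_moments(1)[OF k] AA_moments(2)[OF k] lim]
    show "AE \<omega> in M. (\<lambda>n. qq_tilde X A n k s \<omega>) \<longlonglongrightarrow> qq k s"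
      unfolding qq_tilde_def sum_from_1 drawn by (simp add: ac_simps)
  next
    fix k s assume k: "k \<in> {1..d}" "s \<in> {1..d}" and g: "m 1 < m k + m s"
    have lim: "(\<lambda>n. LINT \<omega>|M. real (A (Suc n) k \<omega>) * real (A (Suc n) s \<omega>)) \<longlonglongrightarrow> qq k s"
      using qq k by (intro LIMSEQ_Suc) auto
    have XX: "(\<lambda>\<omega>. real (X (Suc n) k \<omega>) * real (X (Suc n) s \<omega>)) \<in> borel_measurable (Kalg n)" for n
      using XK[OF k(1), of n] XK[OF k(2), of n] by measurable
    have "AE \<omega> in M. diverges (\<lambda>n. \<Sum>i<n. real (X (Suc i) k \<omega>) * real (X (Suc i) s \<omega>)) \<longrightarrow>
      (\<lambda>n. (\<Sum>i<n. real (X (Suc i) k \<omega>) * real (X (Suc i) s \<omega>) *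
        (real (A (Suc i) k \<omega>) * real (A (Suc i) s \<omega>))) /
        (\<Sum>i<n. real (X (Suc i) k \<omega>) * real (X (Suc i) s \<omega>))) \<longlonglongrightarrow> qq k s"
    proof (rule repl_slln[OF XX _ pair_moment[OF k] _ AA_moments(1)[OF k] AA_moments(2)[OF k] lim])
      show "0 \<le> real (X (Suc n) k \<omega>) * real (X (Suc n) s \<omega>) \<and>
          real (X (Suc n) k \<omega>) * real (X (Suc n) s \<omega>) \<le> real C1 * real C1" if "regular \<omega>" for n \<omega>
        using regular_X_le[OF that k(1), of n] regular_X_le[OF that k(2), of n]
        by (intro conjI mult_mono) auto
    qed simp
    then show "AE \<omega> in M. Qlim \<omega> > Nlim \<omega> \<longrightarrow> (\<lambda>n. qq_hat X A n k s \<omega>) \<longlonglongrightarrow> qq k s"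
      using pair_draws[OF k g]
    proof eventually_elim
      case (elim \<omega>)
      then show ?case unfolding qq_hat_def sum_from_1 by (simp add: ac_simps)
    qed
  qed
  show ?thesis using mu qN nu m_hat second by blast
qed

end
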